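(* Let $I\subseteq S$ be a proper monomial ideal. For all $i\in\mathbb Z$ and $\mathbf b\in\mathbb Z^n$, $$\beta_{n-i,\mathbf b}(S/I)=\mu_{i,\mathbf b-\mathbf 1}(S/I).$$
   Context: $k$ is a field, $n\ge 2$, $S=k[x_1,\ldots,x_n]$ with the $\mathbb Z^n$-grading, $\mathbf 1=(1,\ldots,1)\in\mathbb Z^n$. Let $\underline{\mathrm{Ext}}$ and $\underline{\mathrm{Tor}}$ be the derived functors of the $\mathbb Z^n$-graded $\underline{\mathrm{Hom}}$ and of $\otimes$ in the category of $\mathbb Z^n$-graded $S$-modules. The $i$th Bass and Betti numbers of a $\mathbb Z^n$-graded module $N$ in degree $\mathbf b$ are $\mu_{i,\mathbf b}(N)=\dim_k\underline{\mathrm{Ext}}^i_S(k,N)_{\mathbf b}$ and $\beta_{i,\mathbf b}(N)=\dim_k\underline{\mathrm{Tor}}_i^S(k,N)_{\mathbf b}$ (zero for $i<0$), where $k=S/\langle x_1,\ldots,x_n\rangle$ sits in degree $\mathbf 0$. *)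

theory Defs
  imports
    "HOL-Library.Cardinality"
    "HOL-Library.Poly_Mapping"
    "HOL-Library.Function_Algebras"
    "HOL-Algebra.Algebraic_Closure_Type"
    "Jordan_Normal_Form.Missing_VectorSpace"
begin

hide_const (open) Multiset.mult Polynomial.smult Modules.module Modules.module_hom

text \<open>
  The number of variables is \<open>CARD('n)\<close>, and \<open>\<int>\<^sup>n\<close> is \<open>'n \<Rightarrow> int\<close> with the pointwise group structure.
\<close>

type_synonym ('n, 'k) mpoly = "('n \<Rightarrow>\<^sub>0 nat) \<Rightarrow>\<^sub>0 'k"

abbreviation mpoly_ring :: "('n::finite, 'k::field) mpoly ring" where
  "mpoly_ring \<equiv> ring_of_type_algebra"

definition monomial :: "('n::finite \<Rightarrow>\<^sub>0 nat) \<Rightarrow> ('n, 'k::field) mpoly" where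
  "monomial a = Poly_Mapping.single a 1"

definition poly_comp :: "('n \<Rightarrow> int) \<Rightarrow> ('n::finite, 'k::field) mpoly set" where
  "poly_comp b = {p. \<forall>a \<in> Poly_Mapping.keys p. (\<lambda>i. int (Poly_Mapping.lookup a i)) = b}"

definition monomial_ideal :: "('n::finite, 'k::field) mpoly set \<Rightarrow> bool" where
  "monomial_ideal I \<longleftrightarrow> (\<exists>A. I = Idl\<^bsub>mpoly_ring\<^esub> (monomial ` A))"


section \<open>Graded modules\<close>

record ('a, 'm, 'g) gmodule = "('a, 'm) module" +
  hcomp :: "'g \<Rightarrow> 'm set"

type_synonym ('n, 'k, 'm) gr_mod = "(('n, 'k) mpoly, 'm, 'n \<Rightarrow> int) gmodule"

text \<open>The ring fields \<open>mult\<close> and \<open>one\<close> of a module record carry no information.\<close>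

locale graded_module = module "mpoly_ring :: ('n::finite, 'k::field) mpoly ring" M
  for M :: "('n::finite, 'k::field, 'm) gr_mod" (structure) +
  assumes hcomp_subgroup: "additive_subgroup (hcomp M b) M"
    and smult_hcomp: "\<lbrakk>s \<in> poly_comp a; m \<in> hcomp M b\<rbrakk> \<Longrightarrow> s \<odot> m \<in> hcomp M (a + b)"
    and direct_sum: "m \<in> carrier M \<Longrightarrow>
      \<exists>!f. (\<forall>b. f b \<in> hcomp M b) \<and> finite {b. f b \<noteq> \<zero>} \<and> m = (\<Oplus>b\<in>{b. f b \<noteq> \<zero>}. f b)"

definition poly_module :: "('n::finite, 'k::field, ('n, 'k) mpoly) gr_mod" where
  "poly_module = \<lparr>carrier = UNIV, mult = (*), one = 1, zero = 0, add = (+),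
     smult = (*), hcomp = poly_comp\<rparr>"

definition quot_module ::
    "('n::finite, 'k::field, 'm) gr_mod \<Rightarrow> 'm set \<Rightarrow> ('n, 'k, 'm set) gr_mod" where
  "quot_module M U = \<lparr>carrier = a_rcosets\<^bsub>M\<^esub> U, mult = undefined, one = undefined,
     zero = U, add = (<+>\<^bsub>M\<^esub>),
     smult = (\<lambda>s C. \<Union>m\<in>C. U +>\<^bsub>M\<^esub> (s \<odot>\<^bsub>M\<^esub> m)),
     hcomp = (\<lambda>b. (\<lambda>m. U +>\<^bsub>M\<^esub> m) ` hcomp M b)\<rparr>"

definition sub_module ::
    "('n::finite, 'k::field, 'm) gr_mod \<Rightarrow> 'm set \<Rightarrow> ('n, 'k, 'm) gr_mod" where
  "sub_module M U = M\<lparr>carrier := U, hcomp := (\<lambda>b. hcomp M b \<inter> U)\<rparr>"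

definition residue_field_module :: "('n::finite, 'k::field, ('n, 'k) mpoly set) gr_mod" where
  "residue_field_module =
     quot_module poly_module (Idl\<^bsub>mpoly_ring\<^esub> (range (\<lambda>i. monomial (Poly_Mapping.single i 1))))"

text \<open>A graded component as a vector space over \<open>k = S\<^sub>0\<close>.\<close>

definition hcomp_space ::
    "('n::finite, 'k::field, 'm) gr_mod \<Rightarrow> ('n \<Rightarrow> int) \<Rightarrow> ('k, 'm) module" where
  "hcomp_space M b = \<lparr>carrier = hcomp M b, mult = undefined, one = undefined,
     zero = \<zero>\<^bsub>M\<^esub>, add = (\<oplus>\<^bsub>M\<^esub>), smult = (\<lambda>c m. Poly_Mapping.single 0 c \<odot>\<^bsub>M\<^esub> m)\<rparr>"

definition hcomp_dim :: "('n::finite, 'k::field, 'm) gr_mod \<Rightarrow> ('n \<Rightarrow> int) \<Rightarrow> nat" where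
  "hcomp_dim M b = vectorspace.dim (ring_of_type_algebra :: 'k ring) (hcomp_space M b)"


section \<open>Graded Hom\<close>

definition gr_homs :: "('n::finite, 'k::field, 'm) gr_mod \<Rightarrow> ('n, 'k, 'p) gr_mod \<Rightarrow>
    ('n \<Rightarrow> int) \<Rightarrow> ('m \<Rightarrow> 'p) set" where
  "gr_homs M N b =
     {f \<in> module_hom mpoly_ring M N. \<forall>c. f ` hcomp M c \<subseteq> hcomp N (c + b)}"

text \<open>
  The graded Hom is the direct sum over all \<open>b\<close> of the homomorphisms of degree \<open>b\<close>. Its elements
  are extensional, so that homomorphisms agreeing on \<open>carrier M\<close> are equal.
\<close>

definition Hom_module :: "('n::finite, 'k::field, 'm) gr_mod \<Rightarrow> ('n, 'k, 'p) gr_mod \<Rightarrow>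
    ('n, 'k, 'm \<Rightarrow> 'p) gr_mod" where
  "Hom_module M N = \<lparr>
     carrier = {restrict (\<lambda>m. \<Oplus>\<^bsub>N\<^esub>b\<in>D. f b m) (carrier M) | D f.
                  finite D \<and> (\<forall>b\<in>D. f b \<in> gr_homs M N b)},
     mult = undefined, one = undefined,
     zero = restrict (\<lambda>_. \<zero>\<^bsub>N\<^esub>) (carrier M),
     add = (\<lambda>f g. restrict (\<lambda>m. f m \<oplus>\<^bsub>N\<^esub> g m) (carrier M)),
     smult = (\<lambda>s f. restrict (\<lambda>m. s \<odot>\<^bsub>N\<^esub> f m) (carrier M)),
     hcomp = (\<lambda>b. gr_homs M N b \<inter> extensional (carrier M))\<rparr>"


section \<open>Graded tensor product\<close>

text \<open>
  The tensor product is the free \<open>S\<close>-module on the set \<open>carrier M \<times> carrier N\<close>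
  modulo the bilinearity relations. Its component in degree \<open>b\<close> is the \<open>k\<close>-span of the classes of
  the pairs \<open>(m, n)\<close> of homogeneous elements with \<open>deg m + deg n = b\<close>. These pairs do not generate
  the free module, so \<open>pair_module\<close> is not itself graded: its field \<open>hcomp\<close> only serves to induce
  the grading of the quotient.
\<close>

definition pair_module :: "('n::finite, 'k::field, 'm) gr_mod \<Rightarrow> ('n, 'k, 'p) gr_mod \<Rightarrow>
    ('n, 'k, ('m \<times> 'p) \<Rightarrow>\<^sub>0 ('n, 'k) mpoly) gr_mod" where
  "pair_module M N = \<lparr>
     carrier = {x. Poly_Mapping.keys x \<subseteq> carrier M \<times> carrier N},
     mult = undefined, one = undefined, zero = 0, add = (+),
     smult = (\<lambda>s. Poly_Mapping.map (\<lambda>t. s * t)),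
     hcomp = (\<lambda>b. {x. \<forall>(m, n) \<in> Poly_Mapping.keys x.
       (\<exists>c. m \<in> hcomp M c \<and> n \<in> hcomp N (b - c)) \<and> Poly_Mapping.lookup x (m, n) \<in> poly_comp 0})\<rparr>"

definition pair :: "'m \<Rightarrow> 'p \<Rightarrow> ('m \<times> 'p) \<Rightarrow>\<^sub>0 ('n::finite, 'k::field) mpoly" where
  "pair m n = Poly_Mapping.single (m, n) 1"

definition bilinear_relations ::
    "('n::finite, 'k::field, 'm) gr_mod \<Rightarrow> ('n, 'k, 'p) gr_mod \<Rightarrow>
     (('m \<times> 'p) \<Rightarrow>\<^sub>0 ('n, 'k) mpoly) set" where
  "bilinear_relations M N =
     {pair (m \<oplus>\<^bsub>M\<^esub> m') n - pair m n - pair m' n | m m' n.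
        m \<in> carrier M \<and> m' \<in> carrier M \<and> n \<in> carrier N} \<union>
     {pair m (n \<oplus>\<^bsub>N\<^esub> n') - pair m n - pair m n' | m n n'.
        m \<in> carrier M \<and> n \<in> carrier N \<and> n' \<in> carrier N} \<union>
     {pair (s \<odot>\<^bsub>M\<^esub> m) n - s \<odot>\<^bsub>pair_module M N\<^esub> pair m n | s m n.
        m \<in> carrier M \<and> n \<in> carrier N} \<union>
     {pair m (s \<odot>\<^bsub>N\<^esub> n) - s \<odot>\<^bsub>pair_module M N\<^esub> pair m n | s m n.
        m \<in> carrier M \<and> n \<in> carrier N}"

definition tensor_null ::
    "('n::finite, 'k::field, 'm) gr_mod \<Rightarrow> ('n, 'k, 'p) gr_mod \<Rightarrow>
     (('m \<times> 'p) \<Rightarrow>\<^sub>0 ('n, 'k) mpoly) set" where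
  "tensor_null M N = module.span mpoly_ring (pair_module M N) (bilinear_relations M N)"

definition tensor_module :: "('n::finite, 'k::field, 'm) gr_mod \<Rightarrow> ('n, 'k, 'p) gr_mod \<Rightarrow>
    ('n, 'k, (('m \<times> 'p) \<Rightarrow>\<^sub>0 ('n, 'k) mpoly) set) gr_mod" where
  "tensor_module M N = quot_module (pair_module M N) (tensor_null M N)"

text \<open>The map \<open>f \<otimes> N\<close> into \<open>M' \<otimes> N\<close> induced by a homomorphism \<open>f\<close> into \<open>M'\<close>.\<close>

definition tensor_map ::
    "('n::finite, 'k::field, 'm') gr_mod \<Rightarrow> ('n, 'k, 'p) gr_mod \<Rightarrow> ('m \<Rightarrow> 'm') \<Rightarrow>
     (('m \<times> 'p) \<Rightarrow>\<^sub>0 ('n, 'k) mpoly) set \<Rightarrow> (('m' \<times> 'p) \<Rightarrow>\<^sub>0 ('n, 'k) mpoly) set" where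
  "tensor_map M' N f C = (\<Union>x\<in>C. tensor_null M' N +>\<^bsub>pair_module M' N\<^esub>
     (\<Sum>(m, n)\<in>Poly_Mapping.keys x. Poly_Mapping.single (f m, n) (Poly_Mapping.lookup x (m, n))))"


section \<open>Homology and graded free resolutions\<close>

text \<open>In \<open>chain_homology C d\<close> the maps are \<open>d i: C (i + 1) \<rightarrow> C i\<close>, and \<open>C\<close> vanishes in negative
  homological degrees; in \<open>cochain_homology C d\<close> they are \<open>d i: C i \<rightarrow> C (i + 1)\<close>.\<close>

definition chain_homology :: "(nat \<Rightarrow> ('n::finite, 'k::field, 'm) gr_mod) \<Rightarrow>
    (nat \<Rightarrow> 'm \<Rightarrow> 'm) \<Rightarrow> nat \<Rightarrow> ('n, 'k, 'm set) gr_mod" where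
  "chain_homology C d i = quot_module
     (sub_module (C i) (case i of 0 \<Rightarrow> carrier (C 0)
        | Suc j \<Rightarrow> {z \<in> carrier (C (Suc j)). d j z = \<zero>\<^bsub>C j\<^esub>}))
     (d i ` carrier (C (Suc i)))"

definition cochain_homology :: "(nat \<Rightarrow> ('n::finite, 'k::field, 'm) gr_mod) \<Rightarrow>
    (nat \<Rightarrow> 'm \<Rightarrow> 'm) \<Rightarrow> nat \<Rightarrow> ('n, 'k, 'm set) gr_mod" where
  "cochain_homology C d i = quot_module
     (sub_module (C i) {z \<in> carrier (C i). d i z = \<zero>\<^bsub>C (Suc i)\<^esub>})
     (case i of 0 \<Rightarrow> {\<zero>\<^bsub>C 0\<^esub>} | Suc j \<Rightarrow> d j ` carrier (C j))"

definition gr_free :: "('n::finite, 'k::field, 'm) gr_mod \<Rightarrow> bool" where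
  "gr_free F \<longleftrightarrow> graded_module F \<and>
     (\<exists>B \<subseteq> (\<Union>b. hcomp F b). module.span mpoly_ring F B = carrier F \<and>
        \<not> module.lin_dep mpoly_ring F B)"

definition gr_free_resolution :: "('n::finite, 'k::field, 'm) gr_mod \<Rightarrow>
    (nat \<Rightarrow> ('n, 'k, 'p) gr_mod) \<Rightarrow> (nat \<Rightarrow> 'p \<Rightarrow> 'p) \<Rightarrow> ('p \<Rightarrow> 'm) \<Rightarrow> bool" where
  "gr_free_resolution M P d \<epsilon> \<longleftrightarrow>
     (\<forall>i. gr_free (P i)) \<and> (\<forall>i. d i \<in> gr_homs (P (Suc i)) (P i) 0) \<and>
     \<epsilon> \<in> gr_homs (P 0) M 0 \<and> \<epsilon> ` carrier (P 0) = carrier M \<and>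
     d 0 ` carrier (P 1) = {x \<in> carrier (P 0). \<epsilon> x = \<zero>\<^bsub>M\<^esub>} \<and>
     (\<forall>i. d (Suc i) ` carrier (P (Suc (Suc i))) =
          {x \<in> carrier (P (Suc i)). d i x = \<zero>\<^bsub>P i\<^esub>})"

text \<open>
  Tor and Ext are computed from a chosen graded free resolution of the first argument; any two such
  resolutions are homotopy equivalent, so the choice is immaterial up to isomorphism. The carrier
  type is large enough for a resolution of any graded module \<open>M\<close> with elements of type \<open>'m\<close>: the
  free module on the homogeneous elements of \<open>M\<close> embeds in \<open>'m \<Rightarrow>\<^sub>0 S\<close>, and as \<open>S\<close> is infinite the
  kernels and the free modules on them have at most the cardinality of this type, so that copies
  of them live in it as well.
\<close>

definition chosen_resolution :: "('n::finite, 'k::field, 'm) gr_mod \<Rightarrow>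
    (nat \<Rightarrow> ('n, 'k, 'm \<Rightarrow>\<^sub>0 ('n, 'k) mpoly) gr_mod) \<times>
    (nat \<Rightarrow> ('m \<Rightarrow>\<^sub>0 ('n, 'k) mpoly) \<Rightarrow> ('m \<Rightarrow>\<^sub>0 ('n, 'k) mpoly))" where
  "chosen_resolution M = (SOME (P, d). \<exists>\<epsilon>. gr_free_resolution M P d \<epsilon>)"

definition Tor :: "nat \<Rightarrow> ('n::finite, 'k::field, 'm) gr_mod \<Rightarrow> ('n, 'k, 'p) gr_mod \<Rightarrow>
    ('n, 'k, ((('m \<Rightarrow>\<^sub>0 ('n, 'k) mpoly) \<times> 'p) \<Rightarrow>\<^sub>0 ('n, 'k) mpoly) set set) gr_mod" where
  "Tor i M N = (case chosen_resolution M of (P, d) \<Rightarrow>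
     chain_homology (\<lambda>j. tensor_module (P j) N) (\<lambda>j. tensor_map (P j) N (d j)) i)"

definition Ext :: "nat \<Rightarrow> ('n::finite, 'k::field, 'm) gr_mod \<Rightarrow> ('n, 'k, 'p) gr_mod \<Rightarrow>
    ('n, 'k, (('m \<Rightarrow>\<^sub>0 ('n, 'k) mpoly) \<Rightarrow> 'p) set) gr_mod" where
  "Ext i M N = (case chosen_resolution M of (P, d) \<Rightarrow>
     cochain_homology (\<lambda>j. Hom_module (P j) N)
       (\<lambda>j f. compose (carrier (P (Suc j))) f (d j)) i)"

definition betti :: "int \<Rightarrow> ('n \<Rightarrow> int) \<Rightarrow> ('n::finite, 'k::field, 'p) gr_mod \<Rightarrow> nat" where
  "betti i b N = (if i < 0 then 0 else hcomp_dim (Tor (nat i) residue_field_module N) b)"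

definition bass :: "int \<Rightarrow> ('n \<Rightarrow> int) \<Rightarrow> ('n::finite, 'k::field, 'p) gr_mod \<Rightarrow> nat" where
  "bass i b N = (if i < 0 then 0 else hcomp_dim (Ext (nat i) residue_field_module N) b)"

end

theory Submission
  imports Defs "HOL-Library.Countable"
begin

text \<open>
  Tor and Ext may be computed from the Koszul complex, and the Koszul complex is self-dual.

  The Koszul complex \<open>K\<close> is a graded free resolution of \<open>k\<close> (\<open>koszul_resolution\<close>): its part of
  multidegree \<open>b\<close> is the augmented chain complex of the full simplex on the support of \<open>b\<close>, which for
  \<open>b \<noteq> 0\<close> is contracted by the cone over any vertex (\<open>cone_homotopy\<close>). Any two graded free resolutions of
  a module are homotopy equivalent (\<open>resolutions_homotopy_equivalent\<close>), and both \<open>_ \<otimes> N\<close> and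
  \<open>Hom(_, N)\<close> preserve homotopies. Hence the dimensions of \<open>Tor\<close> and \<open>Ext\<close>, which refer to a chosen
  resolution of \<open>k\<close>, are those of the homology of \<open>K \<otimes> N\<close> and of the cohomology of \<open>Hom(K, N)\<close>
  (\<open>betti_koszul\<close>, \<open>bass_koszul\<close>).

  Let \<open>p + q = n\<close>. Up to signs, the products of basis elements \<open>e\<^sub>A\<close> of \<open>K\<^sub>p\<close> and \<open>e\<^sub>B\<close> of \<open>K\<^sub>q\<close> in the exterior
  algebra define a perfect pairing \<open>\<kappa>: K\<^sub>p \<times> K\<^sub>q \<rightarrow> S\<close> in which \<open>e\<^sub>A\<close> is dual to \<open>e\<^sub>B\<close> for
  the complement \<open>B\<close> of \<open>A\<close>. The degrees of two complementary basis elements add up to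
  \<open>(1, \<dots>, 1)\<close>, so \<open>\<kappa>\<close> lowers degrees by \<open>(1, \<dots>, 1)\<close>, and with a suitable choice of signs the
  differential is adjoint to itself: \<open>\<kappa>(d x, y) = \<kappa>(x, d y)\<close> (\<open>koszul_pairing_d\<close>). Therefore
  \<open>x \<otimes> n \<mapsto> \<kappa>(x, _) n\<close> is an isomorphism \<open>K\<^sub>p \<otimes> N \<cong> Hom(K\<^sub>q, N)\<close> that commutes with the
  differentials and lowers degrees by \<open>(1, \<dots>, 1)\<close>. It identifies \<open>Tor\<^sub>p(k, N)\<close> in degree \<open>b\<close> with
  the \<open>q\<close>-th \<open>Ext(k, N)\<close> in degree \<open>b - 1\<close> (\<open>koszul_duality_dim\<close>), which for \<open>q = i\<close> is the claim
  in the range \<open>0 \<le> i \<le> n\<close>. Outside of it both sides vanish, because \<open>K\<close> is concentrated in the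
  homological degrees from \<open>0\<close> to \<open>n\<close>.
\<close>

section \<open>Modules over the polynomial ring\<close>

lemma type_ring_simps [simp]:
  "carrier (ring_of_type_algebra :: 'a::comm_ring_1 ring) = UNIV"
  "x \<otimes>\<^bsub>ring_of_type_algebra\<^esub> y = x * (y :: 'a)"
  "x \<oplus>\<^bsub>ring_of_type_algebra\<^esub> y = x + (y :: 'a)"
  "\<one>\<^bsub>ring_of_type_algebra\<^esub> = (1 :: 'a)"
  "\<zero>\<^bsub>ring_of_type_algebra\<^esub> = (0 :: 'a)"
  by (simp_all add: ring_of_type_algebra_def)

abbreviation const :: "'k \<Rightarrow> ('n::finite, 'k::field) mpoly" where
  "const \<equiv> Poly_Mapping.single 0"

lemma const_mult: "const (c * d) = const c * const d"
  by (simp add: mult_single)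

lemma mpoly_module_criteria:
  fixes M :: "(('n::finite, 'k::field) mpoly, 'm, 'x) module_scheme" (structure)
  assumes "\<zero> \<in> carrier M"
    and add: "\<And>v w. \<lbrakk>v \<in> carrier M; w \<in> carrier M\<rbrakk> \<Longrightarrow> v \<oplus> w \<in> carrier M"
    and smult: "\<And>s v. v \<in> carrier M \<Longrightarrow> s \<odot> v \<in> carrier M"
    and comm: "\<And>v w. \<lbrakk>v \<in> carrier M; w \<in> carrier M\<rbrakk> \<Longrightarrow> v \<oplus> w = w \<oplus> v"
    and assoc: "\<And>u v w. \<lbrakk>u \<in> carrier M; v \<in> carrier M; w \<in> carrier M\<rbrakk> \<Longrightarrow> (u \<oplus> v) \<oplus> w = u \<oplus> (v \<oplus> w)"
    and zero: "\<And>v. v \<in> carrier M \<Longrightarrow> v \<oplus> \<zero> = v"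
    and mult: "\<And>s t v. v \<in> carrier M \<Longrightarrow> (s * t) \<odot> v = s \<odot> (t \<odot> v)"
    and one: "\<And>v. v \<in> carrier M \<Longrightarrow> 1 \<odot> v = v"
    and zero_smult: "\<And>v. v \<in> carrier M \<Longrightarrow> 0 \<odot> v = \<zero>"
    and plus: "\<And>s t v. v \<in> carrier M \<Longrightarrow> (s + t) \<odot> v = s \<odot> v \<oplus> t \<odot> v"
    and smult_add: "\<And>s v w. \<lbrakk>v \<in> carrier M; w \<in> carrier M\<rbrakk> \<Longrightarrow> s \<odot> (v \<oplus> w) = s \<odot> v \<oplus> s \<odot> w"
  shows "module mpoly_ring M"
proof (rule module_criteria)
  show "cring (mpoly_ring :: ('n, 'k) mpoly ring)" by (rule cring_from_type_algebra)
  have "v \<oplus> (- 1) \<odot> v = \<zero>" if "v \<in> carrier M" for v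
    using plus[of v 1 "- 1"] one zero_smult that by simp
  then show "\<forall>v\<in>carrier M. \<exists>w\<in>carrier M. v \<oplus> w = \<zero>"
    using smult by blast
qed ((unfold type_ring_simps)?; (intro allI ballI impI; (elim conjE)?)?; rule assms; assumption)+

locale mpoly_module = module "mpoly_ring :: ('n::finite, 'k::field) mpoly ring" M
  for M :: "(('n::finite, 'k::field) mpoly, 'm, 'x) module_scheme" (structure)
begin

lemma smult_in [simp, intro]: "m \<in> carrier M \<Longrightarrow> s \<odot> m \<in> carrier M"
  by simp

lemma smult_plus: "m \<in> carrier M \<Longrightarrow> (s + t) \<odot> m = s \<odot> m \<oplus> t \<odot> m"
  using smult_l_distr[of s t m] by simp

lemma smult_add: "\<lbrakk>m \<in> carrier M; m' \<in> carrier M\<rbrakk> \<Longrightarrow> s \<odot> (m \<oplus> m') = s \<odot> m \<oplus> s \<odot> m'"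
  using smult_r_distr[of s m m'] by simp

lemma smult_mult: "m \<in> carrier M \<Longrightarrow> (s * t) \<odot> m = s \<odot> (t \<odot> m)"
  using smult_assoc1[of s t m] by simp

lemma smult_1 [simp]: "m \<in> carrier M \<Longrightarrow> 1 \<odot> m = m"
  using smult_one[of m] by simp

lemma smult_0 [simp]: "m \<in> carrier M \<Longrightarrow> 0 \<odot> m = \<zero>"
  using smult_l_null[of m] by simp

lemma smult_zero [simp]: "s \<odot> \<zero> = \<zero>"
  using smult_r_null[of s] by simp

lemma minus_smult: "m \<in> carrier M \<Longrightarrow> \<ominus> m = (- 1) \<odot> m"
  using smult_plus[of m 1 "- 1"] by (auto intro!: minus_equality simp: a_comm)

lemma smult_neg: "m \<in> carrier M \<Longrightarrow> s \<odot> (\<ominus> m) = \<ominus> (s \<odot> m)"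
  by (simp add: minus_smult flip: smult_mult)

lemma minus_self: "m \<in> carrier M \<Longrightarrow> m \<ominus> m = \<zero>"
  by (simp add: a_minus_def r_neg)

lemma minus_zero_iff: "\<lbrakk>m \<in> carrier M; m' \<in> carrier M\<rbrakk> \<Longrightarrow> m \<ominus> m' = \<zero> \<longleftrightarrow> m = m'"
  by (metis a_minus_def add.inv_closed add.inv_inv minus_equality minus_self)

lemma mpoly_module: "module mpoly_ring M"
  by (rule module_axioms)

end

lemma mpoly_moduleI: "module mpoly_ring M \<Longrightarrow> mpoly_module M"
  by (rule mpoly_module.intro)

text \<open>
  Modules whose components are vector spaces over \<open>k\<close>, without any condition on how the components fit
  together. Complexes are made of such modules, so that dimensions of homology make sense degree by
  degree; in particular this covers the free module on pairs from which a tensor product is formed.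
\<close>

locale degreewise_module = mpoly_module M
  for M :: "('n::finite, 'k::field, 'm) gr_mod" (structure) +
  assumes hcomp_carrier: "m \<in> hcomp M b \<Longrightarrow> m \<in> carrier M"
    and hcomp_zero: "\<zero> \<in> hcomp M b"
    and hcomp_add: "\<lbrakk>m \<in> hcomp M b; m' \<in> hcomp M b\<rbrakk> \<Longrightarrow> m \<oplus> m' \<in> hcomp M b"
    and hcomp_const: "m \<in> hcomp M b \<Longrightarrow> const c \<odot> m \<in> hcomp M b"
begin

lemma hcomp_neg: "m \<in> hcomp M b \<Longrightarrow> \<ominus> m \<in> hcomp M b"
  using minus_smult[of m] hcomp_carrier[of m b] hcomp_const[of m b "- 1"] by (simp add: single_uminus)

lemma hcomp_minus: "\<lbrakk>m \<in> hcomp M b; m' \<in> hcomp M b\<rbrakk> \<Longrightarrow> m \<ominus> m' \<in> hcomp M b"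
  by (simp add: a_minus_def hcomp_add hcomp_neg)

lemma hcomp_space_vectorspace:
  "vectorspace (ring_of_type_algebra :: 'k ring) (hcomp_space M b)"
proof (rule vs_criteria)
  show "field (ring_of_type_algebra :: 'k ring)" by (rule field_from_type_algebra)
  show "\<forall>v\<in>carrier (hcomp_space M b). \<exists>w\<in>carrier (hcomp_space M b).
      v \<oplus>\<^bsub>hcomp_space M b\<^esub> w = \<zero>\<^bsub>hcomp_space M b\<^esub>"
    using hcomp_neg hcomp_carrier by (auto simp: hcomp_space_def intro!: bexI[of _ "\<ominus> _"] r_neg)
qed (auto simp: hcomp_space_def hcomp_zero hcomp_add hcomp_const hcomp_carrier
    const_mult single_add smult_mult smult_plus smult_add a_ac)

end

context
  fixes M :: "('n::finite, 'k::field, 'm) gr_mod" (structure) and U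
  assumes M: "module mpoly_ring M" and U: "submodule mpoly_ring U M"
begin

interpretation mpoly_module M by (rule mpoly_moduleI[OF M])

lemma submodule_minus:
  assumes "u \<in> U" "v \<in> U" shows "u \<ominus> v \<in> U"
proof -
  have "\<ominus> v = (- 1) \<odot> v"
    using submodule.subset[OF U] assms by (auto intro: minus_smult)
  then show ?thesis
    using submodule.m_closed[OF U] submodule.smult_closed[OF U] assms by (simp add: a_minus_def)
qed

lemma coset_eq_iff:
  assumes "m \<in> carrier M" "m' \<in> carrier M"
  shows "U +> m = U +> m' \<longleftrightarrow> m \<ominus> m' \<in> U"
proof
  assume "U +> m = U +> m'"
  moreover have "m \<in> U +> m"
    using submodule.zero_closed[OF U] assms by (force simp: a_r_coset_def')
  ultimately obtain u where u: "u \<in> U" "m = u \<oplus> m'" by (auto simp: a_r_coset_def')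
  then have "u \<in> carrier M" using submodule.subset[OF U] by auto
  then have "m \<ominus> m' = u"
    using u assms by (simp add: a_minus_def a_assoc r_neg)
  then show "m \<ominus> m' \<in> U" using u by simp
next
  assume d: "m \<ominus> m' \<in> U"
  have "U +> x \<subseteq> U +> y" if "x \<ominus> y \<in> U" "x \<in> carrier M" "y \<in> carrier M" for x y
  proof
    fix z assume "z \<in> U +> x"
    then obtain u where u: "u \<in> U" "z = u \<oplus> x" by (auto simp: a_r_coset_def')
    have "u \<in> carrier M" using submodule.subset[OF U] u by auto
    then have "z = (u \<oplus> (x \<ominus> y)) \<oplus> y"
      using u that by (simp add: a_minus_def a_assoc l_neg)
    then show "z \<in> U +> y"
      using submodule.m_closed[OF U u(1) that(1)] by (auto simp: a_r_coset_def')
  qed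
  moreover have "m' \<ominus> m \<in> U"
    using submodule_minus[OF submodule.zero_closed[OF U] d] assms
    by (simp add: a_minus_def minus_add a_comm)
  ultimately show "U +> m = U +> m'" using d assms by blast
qed

lemma coset_add:
  assumes "m \<in> carrier M" "m' \<in> carrier M"
  shows "(U +> m) <+> (U +> m') = U +> (m \<oplus> m')"
proof -
  have U': "u \<in> carrier M" if "u \<in> U" for u using submodule.subset[OF U] that by auto
  show ?thesis
  proof (auto simp: a_r_coset_def' set_add_def')
    fix u v assume "u \<in> U" "v \<in> U"
    then show "\<exists>w\<in>U. u \<oplus> m \<oplus> (v \<oplus> m') = w \<oplus> (m \<oplus> m')"
      using submodule.m_closed[OF U] U' assms by (intro bexI[of _ "u \<oplus> v"]) (auto simp: a_ac)
  next
    fix u assume "u \<in> U"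
    then show "\<exists>x\<in>U. \<exists>xa\<in>U. u \<oplus> (m \<oplus> m') = x \<oplus> m \<oplus> (xa \<oplus> m')"
      using submodule.zero_closed[OF U] U' assms
      by (intro bexI[of _ u] bexI[of _ \<zero>]) (auto simp: a_ac)
  qed
qed

text \<open>
  The scalar multiplication of a quotient module is a union over the representatives of a coset, so that
  its value has to be shown independent of the representative.
\<close>

lemma coset_smult:
  assumes "m \<in> carrier M"
  shows "(\<Union>x\<in>U +> m. U +> (s \<odot> x)) = U +> (s \<odot> m)"
proof -
  have U': "u \<in> carrier M" if "u \<in> U" for u using submodule.subset[OF U] that by auto
  have "U +> (s \<odot> x) = U +> (s \<odot> m)" if "x \<in> U +> m" for x
  proof -
    from that obtain u where u: "u \<in> U" "x = u \<oplus> m" by (auto simp: a_r_coset_def')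
    have "s \<odot> x \<ominus> s \<odot> m = s \<odot> u"
      using u U' assms by (simp add: smult_add a_minus_def a_assoc r_neg)
    then show ?thesis
      using u U' assms submodule.smult_closed[OF U] by (simp add: coset_eq_iff)
  qed
  moreover have "m \<in> U +> m"
    using submodule.zero_closed[OF U] assms by (force simp: a_r_coset_def')
  ultimately show ?thesis by blast
qed

lemma quot_module_carrier: "carrier (quot_module M U) = (\<lambda>m. U +> m) ` carrier M"
  by (auto simp: quot_module_def A_RCOSETS_def')

lemma quot_module_add:
  "\<lbrakk>m \<in> carrier M; m' \<in> carrier M\<rbrakk> \<Longrightarrow> (U +> m) \<oplus>\<^bsub>quot_module M U\<^esub> (U +> m') = U +> (m \<oplus> m')"
  by (simp add: quot_module_def coset_add)

lemma quot_module_smult: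
  "m \<in> carrier M \<Longrightarrow> s \<odot>\<^bsub>quot_module M U\<^esub> (U +> m) = U +> (s \<odot> m)"
  by (simp add: quot_module_def coset_smult)

lemmas quot_module_ops = quot_module_add quot_module_smult

lemma quot_module_zero: "\<zero>\<^bsub>quot_module M U\<^esub> = U +> \<zero>"
proof -
  have "U +> \<zero> = U"
    using submodule.subset[OF U] by (force simp: a_r_coset_def')
  then show ?thesis by (simp add: quot_module_def)
qed

lemma quot_module_hcomp: "hcomp (quot_module M U) b = (\<lambda>m. U +> m) ` hcomp M b"
  by (simp add: quot_module_def)

lemma quot_module_module: "module mpoly_ring (quot_module M U)"
  apply (rule mpoly_module_criteria)
            apply (unfold quot_module_carrier quot_module_zero)
            apply simp
           apply ((elim imageE)?, simp add: quot_module_ops)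
          apply ((elim imageE)?, simp add: quot_module_ops)
         apply ((elim imageE)?, simp add: quot_module_ops a_comm)
        apply ((elim imageE)?, simp add: quot_module_ops a_assoc)
       apply ((elim imageE)?, simp add: quot_module_ops)
      apply ((elim imageE)?, simp add: quot_module_ops smult_mult)
     apply ((elim imageE)?, simp add: quot_module_ops)
    apply ((elim imageE)?, simp add: quot_module_ops)
   apply ((elim imageE)?, simp add: quot_module_ops smult_plus)
  apply ((elim imageE)?, simp add: quot_module_ops smult_add)
  done

lemma sub_module_module: "module mpoly_ring (sub_module M U)"
proof -
  have U': "u \<in> carrier M" if "u \<in> U" for u using submodule.subset[OF U] that by auto
  show ?thesis
    by (rule mpoly_module_criteria)
      (auto simp: sub_module_def U' submodule.zero_closed[OF U] submodule.m_closed[OF U]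
        submodule.smult_closed[OF U] smult_plus smult_add smult_mult a_ac)
qed

end

lemma coset_sub_module: "B +>\<^bsub>sub_module M Z\<^esub> m = B +>\<^bsub>M\<^esub> m"
  by (simp add: a_r_coset_def' sub_module_def)

lemma quot_degreewise:
  assumes "degreewise_module M" "submodule mpoly_ring U M"
  shows "degreewise_module (quot_module M U)"
proof -
  interpret degreewise_module M by (rule assms(1))
  note q = quot_module_ops[OF module_axioms assms(2)] quot_module_zero[OF module_axioms assms(2)]
    quot_module_carrier[OF module_axioms assms(2)] quot_module_hcomp[OF module_axioms assms(2)]
  show ?thesis
    by (intro degreewise_module.intro mpoly_moduleI quot_module_module module_axioms assms(2)
        degreewise_module_axioms.intro)
      (auto simp: q hcomp_carrier hcomp_zero hcomp_add hcomp_const intro!: imageI)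
qed

lemma sub_degreewise:
  assumes "degreewise_module M" "submodule mpoly_ring U M"
  shows "degreewise_module (sub_module M U)"
proof -
  interpret degreewise_module M by (rule assms(1))
  show ?thesis
    by (intro degreewise_module.intro mpoly_moduleI sub_module_module module_axioms assms(2)
        degreewise_module_axioms.intro)
      (use submodule.zero_closed[OF assms(2)] submodule.m_closed[OF assms(2)]
        submodule.smult_closed[OF assms(2)] in \<open>auto simp: sub_module_def hcomp_zero hcomp_add hcomp_const\<close>)
qed

lemma submodule_sub_module:
  assumes "module mpoly_ring M" "submodule mpoly_ring Z M" "submodule mpoly_ring B M" "B \<subseteq> Z"
  shows "submodule mpoly_ring B (sub_module M Z)"
  using assms(4) submodule.zero_closed[OF assms(3)] submodule.m_closed[OF assms(3)]
    submodule.smult_closed[OF assms(3)]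
  by (intro submodule.intro sub_module_module assms(1,2)) (auto simp: sub_module_def)

text \<open>
  A bijective linear map matches the finite generating sets of the two spaces by cardinality, so the two
  minima agree; this includes the spaces without a finite generating set, whose dimension is the same
  unspecified number.
\<close>

lemma (in linear_map) dim_eq_of_bij:
  assumes i: "inj_on T (carrier V)" and s: "T ` carrier V = carrier W"
  shows "V.dim = W.dim"
proof -
  let ?P = "\<lambda>n. \<exists>A. finite A \<and> card A = n \<and> A \<subseteq> carrier V \<and> V.module.span A = carrier V"
  let ?Q = "\<lambda>n. \<exists>A. finite A \<and> card A = n \<and> A \<subseteq> carrier W \<and> W.module.span A = carrier W"
  have span_image: "W.module.span (T ` A) = T ` V.module.span A" if A: "finite A" "A \<subseteq> carrier V" for A
  proof
    have TA: "T ` A \<subseteq> carrier W" using A s by auto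
    show "W.module.span (T ` A) \<subseteq> T ` V.module.span A"
    proof
      fix w assume "w \<in> W.module.span (T ` A)"
      then obtain a where a: "a \<in> T ` A \<rightarrow> carrier K" "W.module.lincomb a (T ` A) = w"
        using W.module.finite_in_span A TA by blast
      have "w = T (V.module.lincomb (a \<circ> T) A)"
        using lincomb_linear_image[OF i A(2) a(1) A(1)] a(2) by simp
      moreover have "V.module.lincomb (a \<circ> T) A \<in> V.module.span A"
        unfolding V.module.span_def using A a(1) by (intro CollectI exI[of _ "a \<circ> T"] exI[of _ A]) auto
      ultimately show "w \<in> T ` V.module.span A" by auto
    qed
    show "T ` V.module.span A \<subseteq> W.module.span (T ` A)"
    proof
      fix w assume "w \<in> T ` V.module.span A"
      then obtain a where a: "a \<in> A \<rightarrow> carrier K" "w = T (V.module.lincomb a A)"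
        using V.module.finite_in_span A by blast
      define c where "c = a \<circ> the_inv_into A T"
      have inj: "inj_on T A" using i A(2) inj_on_subset by blast
      have cT: "c (T x) = a x" if "x \<in> A" for x
        using that by (simp add: c_def the_inv_into_f_f[OF inj])
      have cR: "c \<in> T ` A \<rightarrow> carrier K" using a(1) cT by auto
      have "V.module.lincomb (c \<circ> T) A = V.module.lincomb a A"
        using A a(1) cT by (intro V.module.lincomb_cong) auto
      then have "w = W.module.lincomb c (T ` A)"
        using lincomb_linear_image[OF i A(2) cR A(1)] a(2) by simp
      then show "w \<in> W.module.span (T ` A)"
        unfolding W.module.span_def using A cR by blast
    qed
  qed
  have "?P n \<longleftrightarrow> ?Q n" for n
  proof
    assume "?P n"
    then obtain A where A: "finite A" "card A = n" "A \<subseteq> carrier V" "V.module.span A = carrier V" by blast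
    have "card (T ` A) = n" using A card_image i inj_on_subset by metis
    then show "?Q n" using A span_image s by (intro exI[of _ "T ` A"]) auto
  next
    assume "?Q n"
    then obtain A where A: "finite A" "card A = n" "A \<subseteq> carrier W" "W.module.span A = carrier W" by blast
    let ?A = "the_inv_into (carrier V) T ` A"
    have sub: "?A \<subseteq> carrier V"
      using A(3) the_inv_into_into[OF i] s by blast
    have TA: "T ` ?A = A"
    proof -
      have "T (the_inv_into (carrier V) T a) = a" if "a \<in> A" for a
        using A(3) f_the_inv_into_f[OF i] s that by blast
      then show ?thesis by (simp add: image_image)
    qed
    have c: "card ?A = n"
      using A(2) TA A(1) by (metis card_image_le finite_imageI le_antisym)
    have "T ` V.module.span ?A = T ` carrier V"
      using span_image[of ?A] A sub TA s by simp
    moreover have "V.module.span ?A \<subseteq> carrier V" using sub by (rule V.module.span_is_subset2)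
    ultimately have "V.module.span ?A = carrier V"
      using i by (metis inj_on_image_eq_iff subset_refl)
    then show "?P n" using A(1) c sub by (intro exI[of _ ?A]) auto
  qed
  then show ?thesis unfolding V.dim_def W.dim_def by simp
qed

text \<open>
  A map of cycles in a single degree, with an inverse up to boundaries, already induces an isomorphism
  of the homologies in this degree. The degrees \<open>b\<close> and \<open>b'\<close> are independent, so the same lemma
  serves homotopy equivalences and the duality with its shift of degrees.
\<close>

lemma hcomp_dim_quot_eq:
  fixes C :: "('n::finite, 'k::field, 'm) gr_mod" and C' :: "('n, 'k, 'p) gr_mod"
  assumes C: "degreewise_module C" "submodule mpoly_ring Z C" "submodule mpoly_ring B C" "B \<subseteq> Z"
    and C': "degreewise_module C'" "submodule mpoly_ring Z' C'" "submodule mpoly_ring B' C'" "B' \<subseteq> Z'"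
    and phi: "\<And>z. \<lbrakk>z \<in> Z; z \<in> hcomp C b\<rbrakk> \<Longrightarrow> \<phi> z \<in> Z' \<inter> hcomp C' b'"
    and phi_add: "\<And>z w. \<lbrakk>z \<in> Z; z \<in> hcomp C b; w \<in> Z; w \<in> hcomp C b\<rbrakk> \<Longrightarrow>
        \<phi> (z \<oplus>\<^bsub>C\<^esub> w) = \<phi> z \<oplus>\<^bsub>C'\<^esub> \<phi> w"
    and phi_const: "\<And>z c. \<lbrakk>z \<in> Z; z \<in> hcomp C b\<rbrakk> \<Longrightarrow>
        \<phi> (const c \<odot>\<^bsub>C\<^esub> z) = const c \<odot>\<^bsub>C'\<^esub> \<phi> z"
    and phi_B: "\<And>z. \<lbrakk>z \<in> B; z \<in> hcomp C b\<rbrakk> \<Longrightarrow> \<phi> z \<in> B'"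
    and psi: "\<And>z. \<lbrakk>z \<in> Z'; z \<in> hcomp C' b'\<rbrakk> \<Longrightarrow> \<psi> z \<in> Z \<inter> hcomp C b"
    and psi_B: "\<And>z. \<lbrakk>z \<in> B'; z \<in> hcomp C' b'\<rbrakk> \<Longrightarrow> \<psi> z \<in> B"
    and psi_phi: "\<And>z. \<lbrakk>z \<in> Z; z \<in> hcomp C b\<rbrakk> \<Longrightarrow> \<psi> (\<phi> z) \<ominus>\<^bsub>C\<^esub> z \<in> B"
    and phi_psi: "\<And>z. \<lbrakk>z \<in> Z'; z \<in> hcomp C' b'\<rbrakk> \<Longrightarrow> \<phi> (\<psi> z) \<ominus>\<^bsub>C'\<^esub> z \<in> B'"
  shows "hcomp_dim (quot_module (sub_module C Z) B) b = hcomp_dim (quot_module (sub_module C' Z') B') b'"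
proof -
  interpret C: degreewise_module C by (rule C(1))
  interpret C': degreewise_module C' by (rule C'(1))
  let ?Q = "quot_module (sub_module C Z) B" and ?Q' = "quot_module (sub_module C' Z') B'"
  note sub = submodule_sub_module[OF C.mpoly_module C(2-4)]
  note sub' = submodule_sub_module[OF C'.mpoly_module C'(2-4)]
  note mod = sub_module_module[OF C.mpoly_module C(2)]
  note mod' = sub_module_module[OF C'.mpoly_module C'(2)]
  note D = quot_degreewise[OF sub_degreewise[OF C(1,2)] sub]
  note D' = quot_degreewise[OF sub_degreewise[OF C'(1,2)] sub']
  let ?V = "hcomp_space ?Q b" and ?W = "hcomp_space ?Q' b'"
  let ?Zb = "Z \<inter> hcomp C b" and ?Zb' = "Z' \<inter> hcomp C' b'"
  have carV: "carrier ?V = (\<lambda>z. B +>\<^bsub>C\<^esub> z) ` ?Zb"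
    using quot_module_hcomp[OF mod sub]
    by (simp add: hcomp_space_def coset_sub_module) (simp add: sub_module_def Int_commute)
  have carW: "carrier ?W = (\<lambda>z. B' +>\<^bsub>C'\<^esub> z) ` ?Zb'"
    using quot_module_hcomp[OF mod' sub']
    by (simp add: hcomp_space_def coset_sub_module) (simp add: sub_module_def Int_commute)
  have eq: "B +>\<^bsub>C\<^esub> z = B +>\<^bsub>C\<^esub> w \<longleftrightarrow> z \<ominus>\<^bsub>C\<^esub> w \<in> B" if "z \<in> ?Zb" "w \<in> ?Zb" for z w
    using that coset_eq_iff[OF C.mpoly_module C(3)] by (auto dest: C.hcomp_carrier)
  have eq': "B' +>\<^bsub>C'\<^esub> z = B' +>\<^bsub>C'\<^esub> w \<longleftrightarrow> z \<ominus>\<^bsub>C'\<^esub> w \<in> B'" if "z \<in> ?Zb'" "w \<in> ?Zb'" for z w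
    using that coset_eq_iff[OF C'.mpoly_module C'(3)] by (auto dest: C'.hcomp_carrier)
  have addZ: "z \<oplus>\<^bsub>C\<^esub> w \<in> ?Zb" if "z \<in> ?Zb" "w \<in> ?Zb" for z w
    using that submodule.m_closed[OF C(2)] by (auto intro: C.hcomp_add)
  have smultZ: "const c \<odot>\<^bsub>C\<^esub> z \<in> ?Zb" if "z \<in> ?Zb" for z c
    using that submodule.smult_closed[OF C(2)] by (auto intro: C.hcomp_const)
  have minZ: "z \<ominus>\<^bsub>C\<^esub> w \<in> ?Zb" if "z \<in> ?Zb" "w \<in> ?Zb" for z w
    using that submodule_minus[OF C.mpoly_module C(2)] by (auto intro: C.hcomp_minus)
  have minB: "z \<ominus>\<^bsub>C\<^esub> w \<in> B" if "z \<in> B" "w \<in> B" for z w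
    using that submodule_minus[OF C.mpoly_module C(3)] by auto
  have phi_minus: "\<phi> (z \<ominus>\<^bsub>C\<^esub> w) = \<phi> z \<ominus>\<^bsub>C'\<^esub> \<phi> w" if z: "z \<in> ?Zb" "w \<in> ?Zb" for z w
  proof -
    have "z \<ominus>\<^bsub>C\<^esub> w = z \<oplus>\<^bsub>C\<^esub> const (- 1) \<odot>\<^bsub>C\<^esub> w"
      using z C.hcomp_carrier[of w b] by (simp add: a_minus_def C.minus_smult single_uminus)
    then have "\<phi> (z \<ominus>\<^bsub>C\<^esub> w) = \<phi> z \<oplus>\<^bsub>C'\<^esub> const (- 1) \<odot>\<^bsub>C'\<^esub> \<phi> w"
      using z smultZ[of w "- 1"] by (simp add: phi_add phi_const)
    then show ?thesis
      using phi[of w] z C'.hcomp_carrier[of "\<phi> w" b'] by (simp add: a_minus_def C'.minus_smult single_uminus)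
  qed
  \<comment> \<open>The map on cosets is \<open>\<phi>\<close> of a representative; fact \<open>T\<close> makes it independent of the choice.\<close>
  define rep where "rep K = (SOME z. z \<in> ?Zb \<and> K = B +>\<^bsub>C\<^esub> z)" for K
  define T where "T K = B' +>\<^bsub>C'\<^esub> \<phi> (rep K)" for K
  have T: "T (B +>\<^bsub>C\<^esub> z) = B' +>\<^bsub>C'\<^esub> \<phi> z" if z: "z \<in> ?Zb" for z
  proof -
    define w where "w = rep (B +>\<^bsub>C\<^esub> z)"
    have w: "w \<in> ?Zb \<and> B +>\<^bsub>C\<^esub> z = B +>\<^bsub>C\<^esub> w"
      unfolding w_def rep_def by (rule someI[of _ z]) (use z in simp)
    have "w \<ominus>\<^bsub>C\<^esub> z \<in> B" using w z eq by metis
    then have "\<phi> w \<ominus>\<^bsub>C'\<^esub> \<phi> z \<in> B'"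
      using phi_B[of "w \<ominus>\<^bsub>C\<^esub> z"] minZ w z phi_minus by auto
    then have "B' +>\<^bsub>C'\<^esub> \<phi> w = B' +>\<^bsub>C'\<^esub> \<phi> z"
      using eq' phi w z by blast
    then show ?thesis unfolding T_def w_def .
  qed
  have inj: "inj_on T (carrier ?V)"
  proof (rule inj_onI)
    fix K L assume "K \<in> carrier ?V" "L \<in> carrier ?V" and e: "T K = T L"
    then obtain z w where zw: "z \<in> ?Zb" "w \<in> ?Zb" "K = B +>\<^bsub>C\<^esub> z" "L = B +>\<^bsub>C\<^esub> w"
      unfolding carV by auto
    have "\<phi> z \<ominus>\<^bsub>C'\<^esub> \<phi> w \<in> B'"
      using e zw T eq' phi by (metis IntD1 IntD2)
    then have d: "\<phi> (z \<ominus>\<^bsub>C\<^esub> w) \<in> B'" using zw phi_minus by simp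
    have zw': "z \<ominus>\<^bsub>C\<^esub> w \<in> ?Zb" using zw minZ by blast
    have "\<psi> (\<phi> (z \<ominus>\<^bsub>C\<^esub> w)) \<in> B" using d phi zw' psi_B by blast
    moreover have "\<psi> (\<phi> (z \<ominus>\<^bsub>C\<^esub> w)) \<ominus>\<^bsub>C\<^esub> (z \<ominus>\<^bsub>C\<^esub> w) \<in> B" using psi_phi zw' by blast
    \<comment> \<open>With \<open>u = z - w\<close>, both \<open>\<psi> (\<phi> u)\<close> and \<open>\<psi> (\<phi> u) - u\<close> are boundaries, hence so is \<open>u\<close>.\<close>
    ultimately have "\<psi> (\<phi> (z \<ominus>\<^bsub>C\<^esub> w)) \<ominus>\<^bsub>C\<^esub> (\<psi> (\<phi> (z \<ominus>\<^bsub>C\<^esub> w)) \<ominus>\<^bsub>C\<^esub> (z \<ominus>\<^bsub>C\<^esub> w)) \<in> B"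
      using minB by blast
    moreover have "u \<ominus>\<^bsub>C\<^esub> (u \<ominus>\<^bsub>C\<^esub> v) = v" if "u \<in> carrier C" "v \<in> carrier C" for u v
      using that C.a_lcomm[of u v "\<ominus>\<^bsub>C\<^esub> u"]
      by (simp add: a_minus_def C.minus_add C.r_neg C.a_comm[of "\<ominus>\<^bsub>C\<^esub> u" v])
    ultimately have "z \<ominus>\<^bsub>C\<^esub> w \<in> B"
      using phi psi zw' C.hcomp_carrier by (metis IntD1 IntD2)
    then show "K = L" using zw eq by blast
  qed
  have surj: "T ` carrier ?V = carrier ?W"
  proof
    show "T ` carrier ?V \<subseteq> carrier ?W"
      unfolding carV carW using T phi by auto
    show "carrier ?W \<subseteq> T ` carrier ?V"
    proof
      fix L assume "L \<in> carrier ?W"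
      then obtain z where z: "z \<in> ?Zb'" "L = B' +>\<^bsub>C'\<^esub> z" unfolding carW by auto
      have pz: "\<psi> z \<in> ?Zb" using psi z by blast
      have "B' +>\<^bsub>C'\<^esub> \<phi> (\<psi> z) = B' +>\<^bsub>C'\<^esub> z"
        using phi_psi[of z] phi pz z eq' by blast
      then have "L = T (B +>\<^bsub>C\<^esub> \<psi> z)" using T pz z by simp
      then show "L \<in> T ` carrier ?V" unfolding carV using pz by blast
    qed
  qed
  interpret V: vectorspace "ring_of_type_algebra :: 'k ring" ?V
    using degreewise_module.hcomp_space_vectorspace[OF D] .
  interpret W: vectorspace "ring_of_type_algebra :: 'k ring" ?W
    using degreewise_module.hcomp_space_vectorspace[OF D'] .
  have ZC: "z \<in> carrier C" if "z \<in> ?Zb" for z using that C.hcomp_carrier by auto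
  have ZC': "z \<in> carrier C'" if "z \<in> ?Zb'" for z using that C'.hcomp_carrier by auto
  have opV: "(B +>\<^bsub>C\<^esub> z) \<oplus>\<^bsub>?V\<^esub> (B +>\<^bsub>C\<^esub> w) = B +>\<^bsub>C\<^esub> (z \<oplus>\<^bsub>C\<^esub> w)"
    "c \<odot>\<^bsub>?V\<^esub> (B +>\<^bsub>C\<^esub> z) = B +>\<^bsub>C\<^esub> (const c \<odot>\<^bsub>C\<^esub> z)" if "z \<in> ?Zb" "w \<in> ?Zb" for z w c
    using that quot_module_add[OF mod sub, of z w] quot_module_smult[OF mod sub, of z "const c"]
    by (simp_all add: hcomp_space_def coset_sub_module) (simp_all add: sub_module_def)
  have opW: "(B' +>\<^bsub>C'\<^esub> z) \<oplus>\<^bsub>?W\<^esub> (B' +>\<^bsub>C'\<^esub> w) = B' +>\<^bsub>C'\<^esub> (z \<oplus>\<^bsub>C'\<^esub> w)"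
    "c \<odot>\<^bsub>?W\<^esub> (B' +>\<^bsub>C'\<^esub> z) = B' +>\<^bsub>C'\<^esub> (const c \<odot>\<^bsub>C'\<^esub> z)" if "z \<in> ?Zb'" "w \<in> ?Zb'" for z w c
    using that quot_module_add[OF mod' sub', of z w] quot_module_smult[OF mod' sub', of z "const c"]
    by (simp_all add: hcomp_space_def coset_sub_module) (simp_all add: sub_module_def)
  have hom: "T \<in> module_hom (ring_of_type_algebra :: 'k ring) ?V ?W"
    unfolding module_hom_def
  proof (intro CollectI conjI allI impI)
    show "T \<in> carrier ?V \<rightarrow> carrier ?W" using surj by auto
    fix K L assume "K \<in> carrier ?V \<and> L \<in> carrier ?V"
    then obtain z w where zw: "z \<in> ?Zb" "w \<in> ?Zb" "K = B +>\<^bsub>C\<^esub> z" "L = B +>\<^bsub>C\<^esub> w"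
      unfolding carV by auto
    show "T (K \<oplus>\<^bsub>?V\<^esub> L) = T K \<oplus>\<^bsub>?W\<^esub> T L"
      using zw addZ phi by (simp only: opV T) (simp add: opW phi_add)
  next
    fix c K assume "c \<in> carrier (ring_of_type_algebra :: 'k ring) \<and> K \<in> carrier ?V"
    then obtain z where z: "z \<in> ?Zb" "K = B +>\<^bsub>C\<^esub> z" unfolding carV by auto
    have e: "c \<odot>\<^bsub>?V\<^esub> K = B +>\<^bsub>C\<^esub> (const c \<odot>\<^bsub>C\<^esub> z)"
      using opV(2)[OF z(1) z(1)] z(2) by simp
    have e': "c \<odot>\<^bsub>?W\<^esub> (B' +>\<^bsub>C'\<^esub> \<phi> z) = B' +>\<^bsub>C'\<^esub> (const c \<odot>\<^bsub>C'\<^esub> \<phi> z)"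
      using opW(2) phi z(1) by blast
    show "T (c \<odot>\<^bsub>?V\<^esub> K) = c \<odot>\<^bsub>?W\<^esub> T K"
      using e e' T[OF z(1)] T[OF smultZ[OF z(1)]] phi_const z by simp
  qed
  interpret T: linear_map "ring_of_type_algebra :: 'k ring" ?V ?W T
    by (intro linear_map.intro mod_hom.intro mod_hom_axioms.intro V.vectorspace_axioms
        W.vectorspace_axioms V.module_axioms W.module_axioms hom)
  show ?thesis
    unfolding hcomp_dim_def by (rule T.dim_eq_of_bij[OF inj surj])
qed

lemma hcomp_dim_eq_0:
  fixes M :: "('n::finite, 'k::field, 'm) gr_mod"
  assumes "degreewise_module M" and "\<And>m. m \<in> hcomp M b \<Longrightarrow> m = \<zero>\<^bsub>M\<^esub>"
  shows "hcomp_dim M b = 0"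
proof -
  interpret degreewise_module M by (rule assms(1))
  interpret V: vectorspace "ring_of_type_algebra :: 'k ring" "hcomp_space M b"
    by (rule hcomp_space_vectorspace)
  have "carrier (hcomp_space M b) = {\<zero>\<^bsub>hcomp_space M b\<^esub>}"
    using assms(2) hcomp_zero by (auto simp: hcomp_space_def)
  then have "V.gen_set {}" using V.span_empty by simp
  then show ?thesis
    unfolding hcomp_dim_def V.dim_def by (intro Least_eq_0 exI[of _ "{}"]) simp
qed

section \<open>Sums of homogeneous elements\<close>

text \<open>
  Finite sums of elements of \<open>T\<close> as an inductive set, which makes statements about sums of homogeneous
  elements amenable to rule induction, with no bookkeeping of index sets.
\<close>

inductive_set sums_of :: "('a, 'm, 'x) module_scheme \<Rightarrow> 'm set \<Rightarrow> 'm set"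
  for M :: "('a, 'm, 'x) module_scheme" and T where
  zero: "\<zero>\<^bsub>M\<^esub> \<in> sums_of M T"
| base: "x \<in> T \<Longrightarrow> x \<in> sums_of M T"
| add: "\<lbrakk>x \<in> sums_of M T; y \<in> sums_of M T\<rbrakk> \<Longrightarrow> x \<oplus>\<^bsub>M\<^esub> y \<in> sums_of M T"

text \<open>
  Modules spanned by homogeneous elements on which homogeneous scalars shift degrees. This is what makes
  a scalar multiple of a homogeneous homomorphism again a sum of homogeneous homomorphisms. In
  contrast to \<open>graded_module\<close>, an element may have several homogeneous decompositions.
\<close>

locale multigraded_module = degreewise_module M
  for M :: "('n::finite, 'k::field, 'm) gr_mod" (structure) +
  assumes smult_hcomp: "\<lbrakk>s \<in> poly_comp a; m \<in> hcomp M b\<rbrakk> \<Longrightarrow> s \<odot> m \<in> hcomp M (a + b)"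
    and carrier_sums: "m \<in> carrier M \<Longrightarrow> m \<in> sums_of M (\<Union>b. hcomp M b)"
begin

lemma sums_carrier: "m \<in> sums_of M (\<Union>b. hcomp M b) \<Longrightarrow> m \<in> carrier M"
  by (induction rule: sums_of.induct) (auto intro: hcomp_carrier)

lemma homogeneous_induct [consumes 1, case_names zero homogeneous add]:
  assumes "m \<in> carrier M" and "P \<zero>"
    and "\<And>m b. m \<in> hcomp M b \<Longrightarrow> P m"
    and "\<And>m m'. \<lbrakk>m \<in> carrier M; m' \<in> carrier M; P m; P m'\<rbrakk> \<Longrightarrow> P (m \<oplus> m')"
  shows "P m"
  using carrier_sums[OF assms(1)]
  by (induction rule: sums_of.induct) (auto intro: assms sums_carrier)

end

lemma const_poly_comp: "const c \<in> poly_comp 0"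
  by (auto simp: poly_comp_def fun_eq_iff split: if_splits)

lemma poly_induct [case_names zero single add]:
  assumes "P 0" and "\<And>a c. P (Poly_Mapping.single a c)"
    and "\<And>s t :: 'a \<Rightarrow>\<^sub>0 'b::comm_monoid_add. P s \<Longrightarrow> P t \<Longrightarrow> P (s + t)"
  shows "P s"
proof (induction s rule: update_induct)
  case const
  show ?case using assms(1) by simp
next
  case (update f a b)
  have "Poly_Mapping.update a b f = f + Poly_Mapping.single a b"
    using update by (intro poly_mapping_eqI)
      (auto simp: lookup_update lookup_add lookup_single when_def in_keys_iff)
  then show ?case using assms update by simp
qed

lemma single_poly_comp: "Poly_Mapping.single a c \<in> poly_comp (\<lambda>i. int (Poly_Mapping.lookup a i))"
  by (auto simp: poly_comp_def)

lemma (in abelian_monoid) finsum_support: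
  assumes "finite A" "{i. f i \<noteq> \<zero>} \<subseteq> A" "\<And>i. f i \<in> carrier G"
  shows "(\<Oplus>i\<in>{i. f i \<noteq> \<zero>}. f i) = (\<Oplus>i\<in>A. f i)"
  using assms by (intro add.finprod_mono_neutral_cong_left) auto


lemma sums_decompose:
  fixes M :: "('a, 'm, 'x) module_scheme" (structure)
  assumes M: "abelian_monoid M"
    and T: "\<And>b. T b \<subseteq> carrier M" "\<And>b. \<zero> \<in> T b" "\<And>b x y. x \<in> T b \<Longrightarrow> y \<in> T b \<Longrightarrow> x \<oplus> y \<in> T b"
    and x: "x \<in> sums_of M (\<Union>b. T b)"
  shows "\<exists>f. (\<forall>b. f b \<in> T b) \<and> finite {b. f b \<noteq> \<zero>} \<and> x = (\<Oplus>b\<in>{b. f b \<noteq> \<zero>}. f b)"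
  using x
proof (induction rule: sums_of.induct)
  interpret abelian_monoid M by (rule M)
  case zero
  then show ?case using T by (intro exI[of _ "\<lambda>_. \<zero>"]) auto
next
  interpret abelian_monoid M by (rule M)
  case (base x)
  then obtain c where c: "x \<in> T c" by auto
  have eq: "{b. (if b = c then x else \<zero>) \<noteq> \<zero>} \<subseteq> {c}" by auto
  have car: "(if b = c then x else \<zero>) \<in> carrier M" for b using c T by auto
  show ?case
    using c T finsum_support[OF _ eq car] finite_subset[OF eq] car[of c]
    by (intro exI[of _ "\<lambda>b. if b = c then x else \<zero>"]) (auto simp del: subset_singleton_iff)
next
  interpret abelian_monoid M by (rule M)
  case (add x y)
  then obtain f g where f: "\<And>b. f b \<in> T b" "finite {b. f b \<noteq> \<zero>}" "x = (\<Oplus>b\<in>{b. f b \<noteq> \<zero>}. f b)"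
    and g: "\<And>b. g b \<in> T b" "finite {b. g b \<noteq> \<zero>}" "y = (\<Oplus>b\<in>{b. g b \<noteq> \<zero>}. g b)"
    by blast
  let ?A = "{b. f b \<noteq> \<zero>} \<union> {b. g b \<noteq> \<zero>}"
  have car: "f b \<in> carrier M" "g b \<in> carrier M" "f b \<oplus> g b \<in> carrier M" for b using f g T by blast+
  have sub: "{b. f b \<oplus> g b \<noteq> \<zero>} \<subseteq> ?A" using car by auto
  have "x = (\<Oplus>b\<in>?A. f b)"
    unfolding f(3) by (rule finsum_support) (use f g car in auto)
  moreover have "y = (\<Oplus>b\<in>?A. g b)"
    unfolding g(3) by (rule finsum_support) (use f g car in auto)
  moreover have "(\<Oplus>b\<in>{b. f b \<oplus> g b \<noteq> \<zero>}. f b \<oplus> g b) = (\<Oplus>b\<in>?A. f b \<oplus> g b)"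
    by (rule finsum_support[OF _ sub car(3)]) (use f g in auto)
  moreover have "(\<Oplus>b\<in>?A. f b \<oplus> g b) = (\<Oplus>b\<in>?A. f b) \<oplus> (\<Oplus>b\<in>?A. g b)"
    using car by (intro finsum_addf) auto
  ultimately show ?case
    using f(1,2) g(1,2) T(3) finite_subset[OF sub]
    by (intro exI[of _ "\<lambda>b. f b \<oplus> g b"]) (simp del: finsum_addf)
qed

lemma graded_multigraded: "graded_module M \<Longrightarrow> multigraded_module M"
proof -
  assume "graded_module M"
  then interpret graded_module M .
  interpret m: mpoly_module M by (rule mpoly_moduleI) (rule module_axioms)
  have sub: "subgroup (hcomp M b) (add_monoid M)" for b
    using hcomp_subgroup unfolding additive_subgroup_def .
  have car: "m \<in> hcomp M b \<Longrightarrow> m \<in> carrier M" for m b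
    using subgroup.subset[OF sub] by auto
  show ?thesis
  proof unfold_locales
    show "m \<in> hcomp M b \<Longrightarrow> m \<in> carrier M" for m b by (rule car)
    show "\<zero>\<^bsub>M\<^esub> \<in> hcomp M b" for b using subgroup.one_closed[OF sub] by simp
    show "\<lbrakk>m \<in> hcomp M b; m' \<in> hcomp M b\<rbrakk> \<Longrightarrow> m \<oplus>\<^bsub>M\<^esub> m' \<in> hcomp M b" for m m' b
      using subgroup.m_closed[OF sub] by simp
    show "m \<in> hcomp M b \<Longrightarrow> const c \<odot>\<^bsub>M\<^esub> m \<in> hcomp M b" for m b c
      using smult_hcomp[OF const_poly_comp, of m b c] by simp
    show "\<lbrakk>s \<in> poly_comp a; m \<in> hcomp M b\<rbrakk> \<Longrightarrow> s \<odot>\<^bsub>M\<^esub> m \<in> hcomp M (a + b)" for s a m b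
      by (rule smult_hcomp)
    show "m \<in> sums_of M (\<Union>b. hcomp M b)" if m: "m \<in> carrier M" for m
    proof -
      obtain f where f: "\<And>b. f b \<in> hcomp M b" "finite {b. f b \<noteq> \<zero>\<^bsub>M\<^esub>}"
        "m = (\<Oplus>\<^bsub>M\<^esub>b\<in>{b. f b \<noteq> \<zero>\<^bsub>M\<^esub>}. f b)"
        using direct_sum[OF m] by blast
      have fM: "f b \<in> carrier M" for b using f(1) car by blast
      have fs: "f b \<in> sums_of M (\<Union>b. hcomp M b)" for b using f(1) by (intro sums_of.base) blast
      have "finite A \<Longrightarrow> (\<Oplus>\<^bsub>M\<^esub>b\<in>A. f b) \<in> sums_of M (\<Union>b. hcomp M b)" for A
        by (induction rule: finite_induct) (simp_all add: sums_of.zero sums_of.add fs fM Pi_def)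
      then show ?thesis using f by simp
    qed
  qed
qed

text \<open>
  The quantified predicate is a variable here, so that this instance of uniqueness is available by
  first-order matching.
\<close>

lemma ex1_unique: "\<And>D f g. \<lbrakk>\<exists>!k. D k; D f; D g\<rbrakk> \<Longrightarrow> f = g"
  by blast

text \<open>
  By uniqueness of the decomposition, a homogeneous element that is a sum of elements of subgroups
  of the components lies in the subgroup of its own component.
\<close>

lemma (in graded_module) homogeneous_sum:
  assumes T: "\<And>b. T b \<subseteq> hcomp M b" "\<And>b. \<zero> \<in> T b" "\<And>b x y. x \<in> T b \<Longrightarrow> y \<in> T b \<Longrightarrow> x \<oplus> y \<in> T b"
    and x: "x \<in> hcomp M c" "x \<in> sums_of M (\<Union>b. T b)"
  shows "x \<in> T c"
proof -
  interpret m: multigraded_module M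
    by (rule graded_multigraded) (rule graded_module_axioms)
  have T': "T b \<subseteq> carrier M" for b using T(1) m.hcomp_carrier by blast
  obtain f where f: "\<And>b. f b \<in> T b" "finite {b. f b \<noteq> \<zero>}" "x = (\<Oplus>b\<in>{b. f b \<noteq> \<zero>}. f b)"
    using sums_decompose[OF M.abelian_monoid_axioms, of T, OF T' T(2,3) x(2)] by blast
  let ?g = "\<lambda>b. if b = c then x else \<zero>"
  have sub: "{b. ?g b \<noteq> \<zero>} \<subseteq> {c}" by auto
  have car: "?g b \<in> carrier M" for b using x m.hcomp_carrier by auto
  define D where "D k \<longleftrightarrow> (\<forall>b. k b \<in> hcomp M b) \<and> finite {b. k b \<noteq> \<zero>} \<and> x = (\<Oplus>b\<in>{b. k b \<noteq> \<zero>}. k b)" for k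
  have Dg: "D ?g"
    unfolding D_def
    using x(1) m.hcomp_zero finite_subset[OF sub] M.finsum_support[OF _ sub car] car[of c] by auto
  have Df: "D f" unfolding D_def using f T(1) by blast
  have "x \<in> carrier M" using x(1) m.hcomp_carrier by blast
  then have "\<exists>!k. D k" unfolding D_def by (rule direct_sum)
  then have "f = ?g" by (rule ex1_unique[of D, OF _ Df Dg])
  then have "f c = x" by simp
  then show ?thesis using f(1)[of c] by simp
qed

section \<open>Graded homomorphisms\<close>

lemma module_homI:
  fixes M :: "(('n::finite, 'k::field) mpoly, 'm, 'x) module_scheme"
  assumes "\<And>x. x \<in> carrier M \<Longrightarrow> f x \<in> carrier N"
    and "\<And>x y. \<lbrakk>x \<in> carrier M; y \<in> carrier M\<rbrakk> \<Longrightarrow> f (x \<oplus>\<^bsub>M\<^esub> y) = f x \<oplus>\<^bsub>N\<^esub> f y"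
    and "\<And>s x. x \<in> carrier M \<Longrightarrow> f (s \<odot>\<^bsub>M\<^esub> x) = s \<odot>\<^bsub>N\<^esub> f x"
  shows "f \<in> module_hom mpoly_ring M N"
  using assms by (auto simp: module_hom_def)

lemma module_homD:
  fixes M :: "(('n::finite, 'k::field) mpoly, 'm, 'x) module_scheme"
  assumes "f \<in> module_hom mpoly_ring M N"
  shows "x \<in> carrier M \<Longrightarrow> f x \<in> carrier N"
    and "\<lbrakk>x \<in> carrier M; y \<in> carrier M\<rbrakk> \<Longrightarrow> f (x \<oplus>\<^bsub>M\<^esub> y) = f x \<oplus>\<^bsub>N\<^esub> f y"
    and "x \<in> carrier M \<Longrightarrow> f (s \<odot>\<^bsub>M\<^esub> x) = s \<odot>\<^bsub>N\<^esub> f x"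
  using assms by (auto simp: module_hom_def)

lemma module_hom_zero_minus:
  fixes M :: "(('n::finite, 'k::field) mpoly, 'm, 'x) module_scheme"
    and N :: "(('n::finite, 'k::field) mpoly, 'p, 'y) module_scheme"
  assumes "mpoly_module M" "mpoly_module N" "f \<in> module_hom mpoly_ring M N"
  shows "f \<zero>\<^bsub>M\<^esub> = \<zero>\<^bsub>N\<^esub>"
    and "\<lbrakk>x \<in> carrier M; y \<in> carrier M\<rbrakk> \<Longrightarrow> f (x \<ominus>\<^bsub>M\<^esub> y) = f x \<ominus>\<^bsub>N\<^esub> f y"
proof -
  interpret M: mpoly_module M by fact
  interpret N: mpoly_module N by fact
  note f = module_homD[OF assms(3)]
  show "f \<zero>\<^bsub>M\<^esub> = \<zero>\<^bsub>N\<^esub>"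
    using f(3)[of "\<zero>\<^bsub>M\<^esub>" 0] f(1)[of "\<zero>\<^bsub>M\<^esub>"] by simp
  show "f (x \<ominus>\<^bsub>M\<^esub> y) = f x \<ominus>\<^bsub>N\<^esub> f y" if "x \<in> carrier M" "y \<in> carrier M"
    using that f by (simp add: a_minus_def M.minus_smult N.minus_smult)
qed

lemma module_hom_kernel:
  fixes M :: "(('n::finite, 'k::field) mpoly, 'm, 'x) module_scheme"
  assumes "mpoly_module M" "mpoly_module N" "f \<in> module_hom mpoly_ring M N"
  shows "submodule mpoly_ring {x \<in> carrier M. f x = \<zero>\<^bsub>N\<^esub>} M"
proof -
  interpret M: mpoly_module M by fact
  interpret N: mpoly_module N by fact
  show ?thesis
    using module_homD[OF assms(3)] module_hom_zero_minus(1)[OF assms]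
    by (intro submodule.intro M.mpoly_module) auto
qed

lemma module_hom_image:
  fixes M :: "(('n::finite, 'k::field) mpoly, 'm, 'x) module_scheme"
  assumes "mpoly_module M" "mpoly_module N" "f \<in> module_hom mpoly_ring M N"
  shows "submodule mpoly_ring (f ` carrier M) N"
proof -
  interpret M: mpoly_module M by fact
  interpret N: mpoly_module N by fact
  note f = module_homD[OF assms(3)]
  have z: "\<zero>\<^bsub>N\<^esub> \<in> f ` carrier M" using module_hom_zero_minus(1)[OF assms] by (metis M.zero_closed imageI)
  show ?thesis
    using z by (intro submodule.intro N.mpoly_module) (auto simp: f simp flip: f(2,3))
qed

lemma module_hom_eq_span:
  fixes M :: "(('n::finite, 'k::field) mpoly, 'm, 'x) module_scheme"
  assumes M: "mpoly_module M" and N: "mpoly_module N"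
    and f: "f \<in> module_hom mpoly_ring M N" and g: "g \<in> module_hom mpoly_ring M N"
    and B: "B \<subseteq> carrier M" "\<And>x. x \<in> B \<Longrightarrow> f x = g x" and x: "x \<in> module.span mpoly_ring M B"
  shows "f x = g x"
proof -
  interpret M: mpoly_module M by fact
  interpret N: mpoly_module N by fact
  have "submodule mpoly_ring {x \<in> carrier M. f x = g x} M"
    using module_homD[OF f] module_homD[OF g] module_hom_zero_minus(1)[OF M N f] module_hom_zero_minus(1)[OF M N g]
    by (intro submodule.intro M.mpoly_module) auto
  then have "M.span B \<subseteq> {x \<in> carrier M. f x = g x}"
    using B by (intro M.span_is_subset) auto
  then show ?thesis using x by blast
qed

lemma gr_homsI:
  "\<lbrakk>f \<in> module_hom mpoly_ring M N; \<And>c x. x \<in> hcomp M c \<Longrightarrow> f x \<in> hcomp N (c + b)\<rbrakk> \<Longrightarrow> f \<in> gr_homs M N b"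
  by (auto simp: gr_homs_def)

lemma gr_homsD:
  assumes "f \<in> gr_homs M N b"
  shows "f \<in> module_hom mpoly_ring M N"
    and "x \<in> hcomp M c \<Longrightarrow> f x \<in> hcomp N (c + b)"
  using assms by (auto simp: gr_homs_def)

lemma gr_homs_0D: "\<lbrakk>f \<in> gr_homs M N 0; x \<in> hcomp M c\<rbrakk> \<Longrightarrow> f x \<in> hcomp N c"
  using gr_homsD(2)[of f M N 0 x c] by simp

lemma gr_homs_comp:
  assumes "f \<in> gr_homs L M a" "g \<in> gr_homs M N b"
  shows "(\<lambda>x. g (f x)) \<in> gr_homs L N (a + b)"
proof (rule gr_homsI)
  note f = module_homD[OF gr_homsD(1)[OF assms(1)]] and g = module_homD[OF gr_homsD(1)[OF assms(2)]]
  show "(\<lambda>x. g (f x)) \<in> module_hom mpoly_ring L N"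
    by (rule module_homI) (simp_all add: f g)
  show "g (f x) \<in> hcomp N (c + (a + b))" if "x \<in> hcomp L c" for c x
    using gr_homsD(2)[OF assms(2) gr_homsD(2)[OF assms(1) that]] by (simp add: add.assoc)
qed

lemma gr_homs_minus:
  assumes M: "degreewise_module M" and N: "degreewise_module N"
    and "f \<in> gr_homs M N b" "g \<in> gr_homs M N b"
  shows "(\<lambda>x. f x \<ominus>\<^bsub>N\<^esub> g x) \<in> gr_homs M N b"
proof (rule gr_homsI)
  interpret N: degreewise_module N by fact
  note f = module_homD[OF gr_homsD(1)[OF assms(3)]] and g = module_homD[OF gr_homsD(1)[OF assms(4)]]
  show "(\<lambda>x. f x \<ominus>\<^bsub>N\<^esub> g x) \<in> module_hom mpoly_ring M N"
    by (rule module_homI) (simp_all add: f g N.a_ac N.minus_add a_minus_def N.smult_add N.smult_neg)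
  show "f x \<ominus>\<^bsub>N\<^esub> g x \<in> hcomp N (c + b)" if "x \<in> hcomp M c" for c x
    using gr_homsD(2)[OF assms(3) that] gr_homsD(2)[OF assms(4) that] by (rule N.hcomp_minus)
qed

lemma gr_homs_id: "(\<lambda>x. x) \<in> gr_homs M M 0"
  by (auto intro!: gr_homsI module_homI)

lemma sums_of_image:
  assumes "mpoly_module L" "mpoly_module M" "g \<in> module_hom mpoly_ring L M" "T \<subseteq> carrier L"
    and "y \<in> sums_of L T"
  shows "g y \<in> sums_of M (g ` T)"
proof -
  interpret L: mpoly_module L by fact
  have "y \<in> carrier L \<and> g y \<in> sums_of M (g ` T)"
    using assms(5)
    by (induction rule: sums_of.induct)
      (use assms(4) in \<open>auto simp: module_hom_zero_minus[OF assms(1-3)] module_homD[OF assms(3)]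
        intro: sums_of.intros\<close>)
  then show ?thesis ..
qed

text \<open>
  The images of the components of \<open>L\<close> are subgroups of the components of \<open>M\<close> that span the image of
  \<open>g\<close>, so a homogeneous element of the image lies in the image of the component of its own degree. One
  cannot just take a homogeneous part of \<open>y\<close>, as decompositions in \<open>L\<close> may be ambiguous.
\<close>

lemma homogeneous_preimage:
  assumes L: "multigraded_module L" and M: "graded_module M" and g: "g \<in> gr_homs L M 0"
    and x: "x \<in> hcomp M c" and y: "y \<in> carrier L" "g y = x"
  shows "\<exists>y' \<in> hcomp L c. g y' = x"
proof -
  interpret L: multigraded_module L by fact
  interpret M: graded_module M by fact
  interpret M': multigraded_module M using M by (rule graded_multigraded)
  note hom = gr_homsD(1)[OF g]
  have "x \<in> sums_of M (g ` (\<Union>b. hcomp L b))"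
    using sums_of_image[OF L.mpoly_module_axioms M'.mpoly_module_axioms hom _ L.carrier_sums] y
      L.hcomp_carrier by blast
  then have "x \<in> sums_of M (\<Union>b. g ` hcomp L b)" by (simp add: image_UN)
  moreover have "g ` hcomp L b \<subseteq> hcomp M b" for b
    using gr_homs_0D[OF g] by auto
  moreover have "\<zero>\<^bsub>M\<^esub> \<in> g ` hcomp L b" for b
    using module_hom_zero_minus(1)[OF L.mpoly_module_axioms M'.mpoly_module_axioms hom] L.hcomp_zero
    by (metis imageI)
  moreover have "u \<oplus>\<^bsub>M\<^esub> v \<in> g ` hcomp L b" if "u \<in> g ` hcomp L b" "v \<in> g ` hcomp L b" for u v b
  proof -
    from that obtain u' v' where "u' \<in> hcomp L b" "v' \<in> hcomp L b" "u = g u'" "v = g v'" by blast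
    then show ?thesis
      using module_homD(2)[OF hom, of u' v'] L.hcomp_carrier[of _ b] L.hcomp_add
      by (intro image_eqI[of _ _ "u' \<oplus>\<^bsub>L\<^esub> v'"]) simp_all
  qed
  ultimately have "x \<in> g ` hcomp L c"
    using x by (rule_tac M.homogeneous_sum[of "\<lambda>b. g ` hcomp L b"]) assumption+
  then show ?thesis by auto
qed

text \<open>
  The homogeneous elements whose images have the right degree form subgroups \<open>T b\<close> of the components,
  and the sums of such elements form a submodule. Containing the generators, it is everything, so
  \<open>T b\<close> is the whole component by \<open>homogeneous_sum\<close>.
\<close>

lemma gr_hom_of_generators:
  assumes F: "graded_module F" and L: "multigraded_module L" and h: "h \<in> module_hom mpoly_ring F L"
    and B: "B \<subseteq> carrier F" "module.span mpoly_ring F B = carrier F"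
    and deg: "\<And>e. e \<in> B \<Longrightarrow> \<exists>c. e \<in> hcomp F c \<and> h e \<in> hcomp L c"
  shows "h \<in> gr_homs F L 0"
proof (rule gr_homsI[OF h])
  interpret F: graded_module F by fact
  interpret F': multigraded_module F using F by (rule graded_multigraded)
  interpret L: multigraded_module L by fact
  note hD = module_homD[OF h] module_hom_zero_minus[OF F'.mpoly_module_axioms L.mpoly_module_axioms h]
  define T where "T b = {x \<in> hcomp F b. h x \<in> hcomp L b}" for b
  let ?D = "sums_of F (\<Union>b. T b)"
  have TD: "x \<in> T b \<Longrightarrow> x \<in> ?D" for x b by (auto intro: sums_of.base)
  have Dcar: "x \<in> carrier F" if "x \<in> ?D" for x
    using that by (induction rule: sums_of.induct) (auto simp: T_def intro: F'.hcomp_carrier)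
  have single_D: "Poly_Mapping.single a k \<odot>\<^bsub>F\<^esub> x \<in> ?D" if "x \<in> T b" for a k x b
    using that single_poly_comp[of a k] hD(3)[of x] F'.hcomp_carrier[of x b]
    by (intro TD[of _ "_ + b"]) (auto simp: T_def intro: F'.smult_hcomp L.smult_hcomp)
  have smultT: "s \<odot>\<^bsub>F\<^esub> x \<in> ?D" if x: "x \<in> T b" for s x b
  proof (induction s rule: poly_induct)
    have xF: "x \<in> carrier F" using x F'.hcomp_carrier by (auto simp: T_def)
    { case zero show ?case using xF by (auto intro: sums_of.zero) next
      case (single a c) show ?case by (rule single_D[OF x]) next
      case (add s t) then show ?case using xF by (auto simp: F'.smult_plus intro: sums_of.add) }
  qed
  have smultD: "s \<odot>\<^bsub>F\<^esub> x \<in> ?D" if "x \<in> ?D" for s x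
    using that
  proof (induction rule: sums_of.induct)
    case zero then show ?case by (auto intro: sums_of.zero)
  next
    case (base x) then show ?case using smultT by blast
  next
    case (add x y)
    then show ?case using Dcar by (auto simp: F'.smult_add intro: sums_of.add)
  qed
  have "submodule mpoly_ring ?D F"
    using Dcar smultD by (intro submodule.intro F'.mpoly_module) (auto intro: sums_of.zero sums_of.add)
  moreover have "B \<subseteq> ?D" using deg TD by (fastforce simp: T_def)
  ultimately have D: "carrier F \<subseteq> ?D" using F.span_is_subset B(2) by metis
  show "h x \<in> hcomp L (c + 0)" if "x \<in> hcomp F c" for c x
  proof -
    have "x \<in> ?D" using that D F'.hcomp_carrier by blast
    then have "x \<in> T c"
      using that F'.hcomp_carrier
      by (rule_tac F.homogeneous_sum[of T])
        (auto simp: T_def hD F'.hcomp_zero L.hcomp_zero intro: F'.hcomp_add L.hcomp_add)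
    then show ?thesis by (simp add: T_def)
  qed
qed

section \<open>Free modules are projective\<close>

text \<open>
  The universal property of a free module, by way of the graph of the extension: the pairs
  of linear combinations of \<open>B\<close> and of \<open>l ` B\<close> with equal coefficients form a submodule, and linear
  independence says that \<open>0\<close> is related to \<open>0\<close> only, so this relation is a function.
\<close>

lemma free_module_extend:
  fixes F :: "(('n::finite, 'k::field) mpoly, 'm, 'x) module_scheme"
    and L :: "(('n::finite, 'k::field) mpoly, 'p, 'y) module_scheme"
  assumes F: "mpoly_module F" and L: "mpoly_module L"
    and B: "B \<subseteq> carrier F" "module.span mpoly_ring F B = carrier F" "\<not> module.lin_dep mpoly_ring F B"
    and l: "\<And>e. e \<in> B \<Longrightarrow> l e \<in> carrier L"
  shows "\<exists>h \<in> module_hom mpoly_ring F L. \<forall>e\<in>B. h e = l e"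
proof -
  interpret F: mpoly_module F by fact
  interpret L: mpoly_module L by fact
  define R where "R x y \<longleftrightarrow> (\<exists>A a. finite A \<and> A \<subseteq> B \<and> x = (\<Oplus>\<^bsub>F\<^esub>e\<in>A. a e \<odot>\<^bsub>F\<^esub> e)
      \<and> y = (\<Oplus>\<^bsub>L\<^esub>e\<in>A. a e \<odot>\<^bsub>L\<^esub> l e))" for x y
  have inF: "a e \<odot>\<^bsub>F\<^esub> e \<in> carrier F" and inL: "a e \<odot>\<^bsub>L\<^esub> l e \<in> carrier L"
    if "e \<in> B" for e and a :: "'m \<Rightarrow> ('n, 'k) mpoly"
    using that B l by auto
  have R_car: "x \<in> carrier F" "y \<in> carrier L" if "R x y" for x y
    using that inF inL unfolding R_def by (auto intro!: F.finsum_closed L.finsum_closed simp: subset_iff)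
  have ext: "(\<Oplus>\<^bsub>F\<^esub>e\<in>A. a e \<odot>\<^bsub>F\<^esub> e) = (\<Oplus>\<^bsub>F\<^esub>e\<in>A'. (if e \<in> A then a e else 0) \<odot>\<^bsub>F\<^esub> e)"
    "(\<Oplus>\<^bsub>L\<^esub>e\<in>A. a e \<odot>\<^bsub>L\<^esub> l e) = (\<Oplus>\<^bsub>L\<^esub>e\<in>A'. (if e \<in> A then a e else 0) \<odot>\<^bsub>L\<^esub> l e)"
    if "A \<subseteq> A'" "finite A'" "A' \<subseteq> B" for A A' a
    using that B(1) l
    by (intro F.add.finprod_mono_neutral_cong_left L.add.finprod_mono_neutral_cong_left; auto)+
  have R_add: "R (x \<oplus>\<^bsub>F\<^esub> x') (y \<oplus>\<^bsub>L\<^esub> y')" if xy: "R x y" "R x' y'" for x x' y y'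
  proof -
    obtain A a where A: "finite A" "A \<subseteq> B" "x = (\<Oplus>\<^bsub>F\<^esub>e\<in>A. a e \<odot>\<^bsub>F\<^esub> e)" "y = (\<Oplus>\<^bsub>L\<^esub>e\<in>A. a e \<odot>\<^bsub>L\<^esub> l e)"
      using xy(1) unfolding R_def by blast
    obtain A' a' where A': "finite A'" "A' \<subseteq> B" "x' = (\<Oplus>\<^bsub>F\<^esub>e\<in>A'. a' e \<odot>\<^bsub>F\<^esub> e)"
      "y' = (\<Oplus>\<^bsub>L\<^esub>e\<in>A'. a' e \<odot>\<^bsub>L\<^esub> l e)"
      using xy(2) unfolding R_def by blast
    define U where "U = A \<union> A'"
    have U: "A \<subseteq> U" "A' \<subseteq> U" "finite U" "U \<subseteq> B" using A A' by (auto simp: U_def)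
    define c where "c e = (if e \<in> A then a e else 0) + (if e \<in> A' then a' e else 0)" for e
    have UF: "e \<in> U \<Longrightarrow> e \<in> carrier F" "e \<in> U \<Longrightarrow> l e \<in> carrier L" for e using U(4) B(1) l by auto
    have "x \<oplus>\<^bsub>F\<^esub> x' = (\<Oplus>\<^bsub>F\<^esub>e\<in>U. (if e \<in> A then a e else 0) \<odot>\<^bsub>F\<^esub> e \<oplus>\<^bsub>F\<^esub> (if e \<in> A' then a' e else 0) \<odot>\<^bsub>F\<^esub> e)"
      unfolding A A' ext(1)[OF U(1,3,4)] ext(1)[OF U(2,3,4)] using UF by (intro F.finsum_addf[symmetric]) auto
    also have "\<dots> = (\<Oplus>\<^bsub>F\<^esub>e\<in>U. c e \<odot>\<^bsub>F\<^esub> e)"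
      using UF by (intro F.finsum_cong') (auto simp: c_def F.smult_plus)
    finally have 1: "x \<oplus>\<^bsub>F\<^esub> x' = (\<Oplus>\<^bsub>F\<^esub>e\<in>U. c e \<odot>\<^bsub>F\<^esub> e)" .
    have "y \<oplus>\<^bsub>L\<^esub> y' = (\<Oplus>\<^bsub>L\<^esub>e\<in>U. (if e \<in> A then a e else 0) \<odot>\<^bsub>L\<^esub> l e \<oplus>\<^bsub>L\<^esub> (if e \<in> A' then a' e else 0) \<odot>\<^bsub>L\<^esub> l e)"
      unfolding A A' ext(2)[OF U(1,3,4)] ext(2)[OF U(2,3,4)] using UF by (intro L.finsum_addf[symmetric]) auto
    also have "\<dots> = (\<Oplus>\<^bsub>L\<^esub>e\<in>U. c e \<odot>\<^bsub>L\<^esub> l e)"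
      using UF by (intro L.finsum_cong') (auto simp: c_def L.smult_plus)
    finally show ?thesis using 1 U unfolding R_def by blast
  qed
  have R_smult: "R (s \<odot>\<^bsub>F\<^esub> x) (s \<odot>\<^bsub>L\<^esub> y)" if xy: "R x y" for s x y
  proof -
    obtain A a where A: "finite A" "A \<subseteq> B" "x = (\<Oplus>\<^bsub>F\<^esub>e\<in>A. a e \<odot>\<^bsub>F\<^esub> e)" "y = (\<Oplus>\<^bsub>L\<^esub>e\<in>A. a e \<odot>\<^bsub>L\<^esub> l e)"
      using xy unfolding R_def by blast
    have AF: "e \<in> A \<Longrightarrow> e \<in> carrier F" "e \<in> A \<Longrightarrow> l e \<in> carrier L" for e using A(2) B(1) l by auto
    have "s \<odot>\<^bsub>F\<^esub> x = (\<Oplus>\<^bsub>F\<^esub>e\<in>A. (s * a e) \<odot>\<^bsub>F\<^esub> e)" "s \<odot>\<^bsub>L\<^esub> y = (\<Oplus>\<^bsub>L\<^esub>e\<in>A. (s * a e) \<odot>\<^bsub>L\<^esub> l e)"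
      unfolding A using AF A(1)
      by (auto simp: F.finsum_smult_ldistr L.finsum_smult_ldistr F.smult_mult L.smult_mult Pi_def
          intro!: F.finsum_cong' L.finsum_cong')
    then show ?thesis
      using A(1,2) unfolding R_def by (intro exI[of _ A] exI[of _ "\<lambda>e. s * a e"] conjI)
  qed
  have R_0: "y = \<zero>\<^bsub>L\<^esub>" if xy: "R \<zero>\<^bsub>F\<^esub> y" for y
  proof -
    obtain A a where A: "finite A" "A \<subseteq> B" "\<zero>\<^bsub>F\<^esub> = (\<Oplus>\<^bsub>F\<^esub>e\<in>A. a e \<odot>\<^bsub>F\<^esub> e)" "y = (\<Oplus>\<^bsub>L\<^esub>e\<in>A. a e \<odot>\<^bsub>L\<^esub> l e)"
      using xy unfolding R_def by blast
    have "F.lincomb a A = \<zero>\<^bsub>F\<^esub>" unfolding F.lincomb_def using A(3) by simp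
    then have "\<forall>e\<in>A. a e = 0" using B(3) A(1,2) unfolding F.lin_dep_def by auto
    moreover have "\<forall>e\<in>A. l e \<in> carrier L" using A(2) l by auto
    ultimately show ?thesis unfolding A(4) by (intro L.add.finprod_one_eqI) auto
  qed
  have R_ex: "\<exists>y. R x y" if "x \<in> carrier F" for x
  proof -
    from that obtain a A where "finite A" "A \<subseteq> B" "x = F.lincomb a A"
      unfolding B(2)[symmetric] F.span_def by blast
    then show ?thesis
      unfolding R_def F.lincomb_def by (intro exI[of _ "\<Oplus>\<^bsub>L\<^esub>e\<in>A. a e \<odot>\<^bsub>L\<^esub> l e"] exI[of _ A] exI[of _ a]) simp
  qed
  have R_unique: "y = y'" if "R x y" "R x y'" for x y y'
  proof -
    have c: "x \<in> carrier F" "y \<in> carrier L" "y' \<in> carrier L" using that R_car by blast+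
    have "R (x \<oplus>\<^bsub>F\<^esub> (- 1) \<odot>\<^bsub>F\<^esub> x) (y \<oplus>\<^bsub>L\<^esub> (- 1) \<odot>\<^bsub>L\<^esub> y')" using that R_add R_smult by blast
    then have "R \<zero>\<^bsub>F\<^esub> (y \<ominus>\<^bsub>L\<^esub> y')"
      using c by (simp add: F.minus_smult[symmetric] L.minus_smult[symmetric] F.r_neg a_minus_def)
    then show ?thesis using R_0 L.minus_zero_iff c by blast
  qed
  define h where "h x = (THE y. R x y)" for x
  have Rh: "R x (h x)" if "x \<in> carrier F" for x
    unfolding h_def using R_ex[OF that] R_unique by (metis theI)
  have h_eq: "R x y \<Longrightarrow> h x = y" for x y using Rh R_unique R_car by blast
  have "h \<in> module_hom mpoly_ring F L"
    by (rule module_homI) (erule Rh[THEN R_car(2)], (rule h_eq[OF R_add[OF Rh Rh]]; assumption),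
      rule h_eq[OF R_smult[OF Rh]])
  moreover have "h e = l e" if "e \<in> B" for e
  proof (rule h_eq)
    show "R e (l e)"
      unfolding R_def using that B(1) l[OF that]
      by (intro exI[of _ "{e}"] exI[of _ "\<lambda>_. 1"]) (auto simp: subset_iff)
  qed
  ultimately show ?thesis by blast
qed

text \<open>
  Lift the images of the homogeneous basis elements, keeping their degrees. The preimages are required
  for homogeneous elements only, which is what exactness of a graded complex provides.
\<close>

lemma gr_free_lift:
  assumes F: "gr_free F" and L: "multigraded_module L" and M: "mpoly_module M"
    and f: "f \<in> module_hom mpoly_ring F M" and g: "g \<in> module_hom mpoly_ring L M"
    and ex: "\<And>c x. x \<in> hcomp F c \<Longrightarrow> \<exists>y \<in> hcomp L c. g y = f x"
  shows "\<exists>h \<in> gr_homs F L 0. \<forall>x \<in> carrier F. g (h x) = f x"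
proof -
  interpret F: graded_module F using F unfolding gr_free_def by blast
  interpret F': multigraded_module F using F.graded_module_axioms by (rule graded_multigraded)
  interpret L: multigraded_module L by fact
  obtain B where B: "B \<subseteq> (\<Union>b. hcomp F b)" "F.span B = carrier F" "\<not> F.lin_dep B"
    using F unfolding gr_free_def by blast
  have "\<forall>e\<in>B. \<exists>y. \<exists>c. e \<in> hcomp F c \<and> y \<in> hcomp L c \<and> g y = f e" using B(1) ex by blast
  then obtain l where l: "\<And>e. e \<in> B \<Longrightarrow> \<exists>c. e \<in> hcomp F c \<and> l e \<in> hcomp L c \<and> g (l e) = f e" by metis
  have BF: "B \<subseteq> carrier F" using B(1) F'.hcomp_carrier by blast
  obtain h where h: "h \<in> module_hom mpoly_ring F L" "\<forall>e\<in>B. h e = l e"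
    using free_module_extend[OF F'.mpoly_module_axioms L.mpoly_module_axioms BF B(2,3), of l] l L.hcomp_carrier
    by blast
  have "h \<in> gr_homs F L 0"
    using gr_hom_of_generators[OF F.graded_module_axioms L h(1) BF B(2)] l h(2) by metis
  moreover have "g (h x) = f x" if "x \<in> carrier F" for x
  proof (rule module_hom_eq_span[OF F'.mpoly_module_axioms M _ f BF])
    show "(\<lambda>x. g (h x)) \<in> module_hom mpoly_ring F M"
      by (rule module_homI) (simp_all add: module_homD[OF h(1)] module_homD[OF g])
  qed (use l h(2) that B(2) in auto)
  ultimately show ?thesis by blast
qed

section \<open>Comparison of free resolutions\<close>

text \<open>
  Cycles of the augmented complex: in homological degree \<open>0\<close> the augmentation takes the part of the
  differential, so that exactness of a resolution is the single statement \<open>d_image\<close>.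
\<close>

definition cycle_at :: "(nat \<Rightarrow> ('n::finite, 'k::field, 'p) gr_mod) \<Rightarrow> (nat \<Rightarrow> 'p \<Rightarrow> 'p) \<Rightarrow>
    ('n, 'k, 'm) gr_mod \<Rightarrow> ('p \<Rightarrow> 'm) \<Rightarrow> nat \<Rightarrow> 'p \<Rightarrow> bool" where
  "cycle_at P d M \<epsilon> i x \<longleftrightarrow> (case i of 0 \<Rightarrow> \<epsilon> x = \<zero>\<^bsub>M\<^esub> | Suc j \<Rightarrow> d j x = \<zero>\<^bsub>P j\<^esub>)"

locale resolution =
  fixes M :: "('n::finite, 'k::field, 'm) gr_mod" and P :: "nat \<Rightarrow> ('n, 'k, 'p) gr_mod"
    and d :: "nat \<Rightarrow> 'p \<Rightarrow> 'p" and \<epsilon> :: "'p \<Rightarrow> 'm"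
  assumes res: "gr_free_resolution M P d \<epsilon>" and target: "graded_module M"
begin

lemma free: "gr_free (P i)"
  using res by (simp add: gr_free_resolution_def)

lemma graded: "graded_module (P i)"
  using free by (simp add: gr_free_def)

lemma multigraded: "multigraded_module (P i)"
  using graded by (rule graded_multigraded)

lemma degreewise: "degreewise_module (P i)"
  using multigraded by (rule multigraded_module.axioms)

lemma mpoly: "mpoly_module (P i)"
  using degreewise by (rule degreewise_module.axioms)

lemma mpoly_target: "mpoly_module M"
  using graded_multigraded[OF target] by (intro degreewise_module.axioms(1) multigraded_module.axioms(1))

lemma d_hom: "d i \<in> gr_homs (P (Suc i)) (P i) 0"
  using res by (simp add: gr_free_resolution_def)

lemma augmentation_hom: "\<epsilon> \<in> gr_homs (P 0) M 0"
  using res by (simp add: gr_free_resolution_def)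

lemmas d_simps = module_homD[OF gr_homsD(1)[OF d_hom]]

lemmas augmentation_simps = module_homD[OF gr_homsD(1)[OF augmentation_hom]]

lemma augmentation_onto: "\<epsilon> ` carrier (P 0) = carrier M"
  using res by (simp add: gr_free_resolution_def)

lemma d_image: "d i ` carrier (P (Suc i)) = {x \<in> carrier (P i). cycle_at P d M \<epsilon> i x}"
  using res by (cases i) (simp_all add: gr_free_resolution_def cycle_at_def)

lemma cycle_d: "x \<in> carrier (P (Suc i)) \<Longrightarrow> cycle_at P d M \<epsilon> i (d i x)"
  using d_image[of i] by blast

lemma d_d: "x \<in> carrier (P (Suc (Suc i))) \<Longrightarrow> d i (d (Suc i) x) = \<zero>\<^bsub>P i\<^esub>"
  using cycle_d[of x "Suc i"] by (simp add: cycle_at_def)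

lemma cycle_preimage:
  assumes "x \<in> hcomp (P i) c" "cycle_at P d M \<epsilon> i x"
  shows "\<exists>y \<in> hcomp (P (Suc i)) c. d i y = x"
proof -
  have "x \<in> carrier (P i)"
    using degreewise_module.hcomp_carrier[OF degreewise assms(1)] .
  then have "x \<in> d i ` carrier (P (Suc i))" using assms(2) d_image by blast
  then obtain y where "y \<in> carrier (P (Suc i))" "d i y = x" by blast
  then show ?thesis
    by (rule homogeneous_preimage[OF multigraded graded d_hom assms(1)])
qed

end

text \<open>Two resolutions of the same module, possibly realized in different types.\<close>

locale two_resolutions =
  P: resolution M P d \<epsilon> + Q: resolution M Q d' \<epsilon>'
  for M :: "('n::finite, 'k::field, 'm) gr_mod"
    and P :: "nat \<Rightarrow> ('n, 'k, 'p) gr_mod" and d \<epsilon>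
    and Q :: "nat \<Rightarrow> ('n, 'k, 'q) gr_mod" and d' \<epsilon>'
begin

text \<open>
  The maps are built one homological degree at a time, each by lifting along the exact complex \<open>Q\<close> out
  of a free module. The choice in degree \<open>i + 1\<close> depends on the one in degree \<open>i\<close>; the
  recursion carries along that cycles go to cycles, since this makes the next lifting possible.
\<close>

lemma comparison_map:
  "\<exists>\<phi>. (\<forall>i. \<phi> i \<in> gr_homs (P i) (Q i) 0) \<and> (\<forall>x \<in> carrier (P 0). \<epsilon>' (\<phi> 0 x) = \<epsilon> x) \<and>
    (\<forall>i. \<forall>x \<in> carrier (P (Suc i)). d' i (\<phi> (Suc i) x) = \<phi> i (d i x))"
proof -
  define ok where "ok i f \<longleftrightarrow> f \<in> gr_homs (P i) (Q i) 0 \<and> (i = 0 \<longrightarrow> (\<forall>x \<in> carrier (P 0). \<epsilon>' (f x) = \<epsilon> x)) \<and>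
    (\<forall>x \<in> carrier (P i). cycle_at P d M \<epsilon> i x \<longrightarrow> cycle_at Q d' M \<epsilon>' i (f x))" for i f
  have "\<exists>\<phi>. \<forall>i. ok i (\<phi> i) \<and> (\<forall>x \<in> carrier (P (Suc i)). d' i (\<phi> (Suc i) x) = \<phi> i (d i x))"
  proof (rule dependent_nat_choice)
    have "\<exists>y \<in> hcomp (Q 0) c. \<epsilon>' y = \<epsilon> x" if "x \<in> hcomp (P 0) c" for x c
    proof -
      have x: "\<epsilon> x \<in> hcomp M c" using gr_homs_0D[OF P.augmentation_hom that] .
      have "x \<in> carrier (P 0)" using degreewise_module.hcomp_carrier[OF P.degreewise that] .
      then have "\<epsilon> x \<in> \<epsilon>' ` carrier (Q 0)" using P.augmentation_simps Q.augmentation_onto by blast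
      then obtain y where "y \<in> carrier (Q 0)" "\<epsilon>' y = \<epsilon> x" by force
      then show ?thesis
        by (rule homogeneous_preimage[OF Q.multigraded P.target Q.augmentation_hom x])
    qed
    then obtain f where "f \<in> gr_homs (P 0) (Q 0) 0" "\<forall>x \<in> carrier (P 0). \<epsilon>' (f x) = \<epsilon> x"
      using gr_free_lift[OF P.free Q.multigraded P.mpoly_target gr_homsD(1)[OF P.augmentation_hom]
          gr_homsD(1)[OF Q.augmentation_hom]] by blast
    then show "\<exists>f. ok 0 f" by (auto simp: ok_def cycle_at_def)
  next
    fix f i assume f: "ok i f"
    have fh: "f \<in> gr_homs (P i) (Q i) 0" using f by (simp add: ok_def)
    have fd: "(\<lambda>x. f (d i x)) \<in> gr_homs (P (Suc i)) (Q i) 0"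
      using gr_homs_comp[OF P.d_hom fh] by simp
    have "\<exists>y \<in> hcomp (Q (Suc i)) c. d' i y = f (d i x)" if "x \<in> hcomp (P (Suc i)) c" for x c
    proof (rule Q.cycle_preimage)
      show "f (d i x) \<in> hcomp (Q i) c" using gr_homs_0D[OF fd that] .
      have "x \<in> carrier (P (Suc i))" using degreewise_module.hcomp_carrier[OF P.degreewise that] .
      then show "cycle_at Q d' M \<epsilon>' i (f (d i x))"
        using f P.cycle_d P.d_simps unfolding ok_def by blast
    qed
    then obtain g where g: "g \<in> gr_homs (P (Suc i)) (Q (Suc i)) 0"
      "\<forall>x \<in> carrier (P (Suc i)). d' i (g x) = f (d i x)"
      using gr_free_lift[OF P.free Q.multigraded Q.mpoly gr_homsD(1)[OF fd] gr_homsD(1)[OF Q.d_hom]]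
      by blast
    have "ok (Suc i) g"
      using g module_hom_zero_minus(1)[OF P.mpoly Q.mpoly gr_homsD(1)[OF fh]]
      by (auto simp: ok_def cycle_at_def)
    then show "\<exists>g. ok (Suc i) g \<and> (\<forall>x \<in> carrier (P (Suc i)). d' i (g x) = f (d i x))"
      using g(2) by blast
  qed
  then obtain \<phi> where phi: "\<And>i. ok i (\<phi> i)"
    "\<And>i x. x \<in> carrier (P (Suc i)) \<Longrightarrow> d' i (\<phi> (Suc i) x) = \<phi> i (d i x)" by blast
  then show ?thesis unfolding ok_def by blast
qed

text \<open>
  Again by recursion: if \<open>h i\<close> satisfies \<open>d' h = \<alpha> - h d\<close>, then \<open>\<alpha> (i + 1) - h i d\<close> takes values
  in the cycles and lifts along \<open>d'\<close>.
\<close>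

lemma null_homotopy:
  assumes a: "\<And>i. \<alpha> i \<in> gr_homs (P i) (Q i) 0"
    and a0: "\<And>x. x \<in> carrier (P 0) \<Longrightarrow> \<epsilon>' (\<alpha> 0 x) = \<zero>\<^bsub>M\<^esub>"
    and ad: "\<And>i x. x \<in> carrier (P (Suc i)) \<Longrightarrow> d' i (\<alpha> (Suc i) x) = \<alpha> i (d i x)"
  shows "\<exists>h. (\<forall>i. h i \<in> gr_homs (P i) (Q (Suc i)) 0) \<and> (\<forall>x \<in> carrier (P 0). d' 0 (h 0 x) = \<alpha> 0 x) \<and>
    (\<forall>i. \<forall>x \<in> carrier (P (Suc i)). d' (Suc i) (h (Suc i) x) = \<alpha> (Suc i) x \<ominus>\<^bsub>Q (Suc i)\<^esub> h i (d i x))"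
proof -
  define ok where "ok i f \<longleftrightarrow> f \<in> gr_homs (P i) (Q (Suc i)) 0 \<and>
    (i = 0 \<longrightarrow> (\<forall>x \<in> carrier (P 0). d' 0 (f x) = \<alpha> 0 x)) \<and>
    (\<forall>x \<in> carrier (P i). cycle_at P d M \<epsilon> i x \<longrightarrow> d' i (f x) = \<alpha> i x)" for i f
  note aD = module_homD[OF gr_homsD(1)[OF a]]
  have "\<exists>h. \<forall>i. ok i (h i) \<and>
    (\<forall>x \<in> carrier (P (Suc i)). d' (Suc i) (h (Suc i) x) = \<alpha> (Suc i) x \<ominus>\<^bsub>Q (Suc i)\<^esub> h i (d i x))"
  proof (rule dependent_nat_choice)
    have "\<exists>y \<in> hcomp (Q (Suc 0)) c. d' 0 y = \<alpha> 0 x" if "x \<in> hcomp (P 0) c" for x c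
      using gr_homs_0D[OF a that] a0 degreewise_module.hcomp_carrier[OF P.degreewise that]
      by (intro Q.cycle_preimage) (auto simp: cycle_at_def)
    then obtain f where "f \<in> gr_homs (P 0) (Q (Suc 0)) 0" "\<forall>x \<in> carrier (P 0). d' 0 (f x) = \<alpha> 0 x"
      using gr_free_lift[OF P.free Q.multigraded Q.mpoly gr_homsD(1)[OF a] gr_homsD(1)[OF Q.d_hom]]
      by blast
    then show "\<exists>f. ok 0 f" by (auto simp: ok_def)
  next
    fix f i assume f: "ok i f"
    interpret Q': mpoly_module "Q i" by (rule Q.mpoly)
    have fh: "f \<in> gr_homs (P i) (Q (Suc i)) 0" using f by (simp add: ok_def)
    have fd: "(\<lambda>x. f (d i x)) \<in> gr_homs (P (Suc i)) (Q (Suc i)) 0"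
      using gr_homs_comp[OF P.d_hom fh] by simp
    define \<beta> where "\<beta> x = \<alpha> (Suc i) x \<ominus>\<^bsub>Q (Suc i)\<^esub> f (d i x)" for x
    have bh: "\<beta> \<in> gr_homs (P (Suc i)) (Q (Suc i)) 0"
      using gr_homs_minus[OF P.degreewise Q.degreewise a fd] by (simp add: \<beta>_def[abs_def])
    have db: "d' i (\<beta> x) = \<zero>\<^bsub>Q i\<^esub>" if x: "x \<in> carrier (P (Suc i))" for x
    proof -
      have "d' i (\<beta> x) = d' i (\<alpha> (Suc i) x) \<ominus>\<^bsub>Q i\<^esub> d' i (f (d i x))"
        unfolding \<beta>_def using x aD(1) module_homD(1)[OF gr_homsD(1)[OF fd]]
        by (intro module_hom_zero_minus(2)[OF Q.mpoly Q.mpoly gr_homsD(1)[OF Q.d_hom]])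
      also have "d' i (f (d i x)) = \<alpha> i (d i x)"
        using f x P.cycle_d P.d_simps(1) unfolding ok_def by blast
      finally show ?thesis using ad[OF x] aD(1) P.d_simps(1)[OF x] by (simp add: Q'.minus_self)
    qed
    have "\<exists>y \<in> hcomp (Q (Suc (Suc i))) c. d' (Suc i) y = \<beta> x" if "x \<in> hcomp (P (Suc i)) c" for x c
      using gr_homs_0D[OF bh that] db degreewise_module.hcomp_carrier[OF P.degreewise that]
      by (intro Q.cycle_preimage) (auto simp: cycle_at_def)
    then obtain g where g: "g \<in> gr_homs (P (Suc i)) (Q (Suc (Suc i))) 0"
      "\<forall>x \<in> carrier (P (Suc i)). d' (Suc i) (g x) = \<beta> x"
      using gr_free_lift[OF P.free Q.multigraded Q.mpoly gr_homsD(1)[OF bh] gr_homsD(1)[OF Q.d_hom]]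
      by blast
    interpret Q'': mpoly_module "Q (Suc i)" by (rule Q.mpoly)
    have "\<beta> x = \<alpha> (Suc i) x" if "x \<in> carrier (P (Suc i))" "d i x = \<zero>\<^bsub>P i\<^esub>" for x
      using that aD(1) module_hom_zero_minus(1)[OF P.mpoly Q.mpoly gr_homsD(1)[OF fh]]
      by (simp add: \<beta>_def a_minus_def)
    then have "ok (Suc i) g" using g by (auto simp: ok_def cycle_at_def)
    then show "\<exists>g. ok (Suc i) g \<and>
      (\<forall>x \<in> carrier (P (Suc i)). d' (Suc i) (g x) = \<alpha> (Suc i) x \<ominus>\<^bsub>Q (Suc i)\<^esub> f (d i x))"
      using g(2) unfolding \<beta>_def by blast
  qed
  then obtain h where h: "\<And>i. ok i (h i)"
    "\<And>i x. x \<in> carrier (P (Suc i)) \<Longrightarrow> d' (Suc i) (h (Suc i) x) = \<alpha> (Suc i) x \<ominus>\<^bsub>Q (Suc i)\<^esub> h i (d i x)"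
    by blast
  then show ?thesis unfolding ok_def by blast
qed

end

text \<open>
  A homotopy from \<open>\<psi> \<circ> \<phi>\<close> to the identity, where \<open>\<phi>: P \<rightarrow> Q\<close> and \<open>\<psi>: Q \<rightarrow> P\<close>.
\<close>

definition retraction_up_to_homotopy ::
    "(nat \<Rightarrow> ('n::finite, 'k::field, 'p) gr_mod) \<Rightarrow> (nat \<Rightarrow> 'p \<Rightarrow> 'p) \<Rightarrow>
     (nat \<Rightarrow> ('n, 'k, 'q) gr_mod) \<Rightarrow> (nat \<Rightarrow> 'q \<Rightarrow> 'q) \<Rightarrow> (nat \<Rightarrow> 'p \<Rightarrow> 'q) \<Rightarrow> (nat \<Rightarrow> 'q \<Rightarrow> 'p) \<Rightarrow>
     (nat \<Rightarrow> 'p \<Rightarrow> 'p) \<Rightarrow> bool" where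
  "retraction_up_to_homotopy P d Q d' \<phi> \<psi> h \<longleftrightarrow>
     (\<forall>i. h i \<in> gr_homs (P i) (P (Suc i)) 0) \<and>
     (\<forall>x \<in> carrier (P 0). d 0 (h 0 x) = \<psi> 0 (\<phi> 0 x) \<ominus>\<^bsub>P 0\<^esub> x) \<and>
     (\<forall>i. \<forall>x \<in> carrier (P (Suc i)).
        d (Suc i) (h (Suc i) x) \<oplus>\<^bsub>P (Suc i)\<^esub> h i (d i x) = \<psi> (Suc i) (\<phi> (Suc i) x) \<ominus>\<^bsub>P (Suc i)\<^esub> x)"

definition chain_map ::
    "(nat \<Rightarrow> ('n::finite, 'k::field, 'p) gr_mod) \<Rightarrow> (nat \<Rightarrow> 'p \<Rightarrow> 'p) \<Rightarrow>
     (nat \<Rightarrow> ('n, 'k, 'q) gr_mod) \<Rightarrow> (nat \<Rightarrow> 'q \<Rightarrow> 'q) \<Rightarrow> (nat \<Rightarrow> 'p \<Rightarrow> 'q) \<Rightarrow> bool" where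
  "chain_map P d Q d' \<phi> \<longleftrightarrow> (\<forall>i. \<phi> i \<in> gr_homs (P i) (Q i) 0) \<and>
     (\<forall>i. \<forall>x \<in> carrier (P (Suc i)). d' i (\<phi> (Suc i) x) = \<phi> i (d i x))"

text \<open>
  The difference of \<open>\<psi> \<circ> \<phi>\<close> and the identity is a map of \<open>P\<close> to itself over the zero map of \<open>M\<close>, so
  \<open>null_homotopy\<close> applies with both resolutions equal to \<open>P\<close>.
\<close>

lemma homotopic_to_id:
  assumes P: "resolution M P d \<epsilon>"
    and "chain_map P d Q d' \<phi>" "chain_map Q d' P d \<psi>"
    and aug: "\<And>x. x \<in> carrier (P 0) \<Longrightarrow> \<epsilon>' (\<phi> 0 x) = \<epsilon> x" "\<And>y. y \<in> carrier (Q 0) \<Longrightarrow> \<epsilon> (\<psi> 0 y) = \<epsilon>' y"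
  shows "\<exists>h. retraction_up_to_homotopy P d Q d' \<phi> \<psi> h"
proof -
  interpret P: resolution M P d \<epsilon> by fact
  interpret PP: two_resolutions M P d \<epsilon> P d \<epsilon> ..
  interpret M: mpoly_module M by (rule P.mpoly_target)
  have phi: "\<phi> i \<in> gr_homs (P i) (Q i) 0" and psi: "\<psi> i \<in> gr_homs (Q i) (P i) 0" for i
    using assms(2,3) by (auto simp: chain_map_def)
  note phiD = module_homD[OF gr_homsD(1)[OF phi]] and psiD = module_homD[OF gr_homsD(1)[OF psi]]
  have psiphi: "(\<lambda>x. \<psi> i (\<phi> i x)) \<in> gr_homs (P i) (P i) 0" for i
    using gr_homs_comp[OF phi psi] by simp
  define \<alpha> where "\<alpha> i x = \<psi> i (\<phi> i x) \<ominus>\<^bsub>P i\<^esub> x" for i x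
  have ah: "\<alpha> i \<in> gr_homs (P i) (P i) 0" for i
    using gr_homs_minus[OF P.degreewise P.degreewise psiphi gr_homs_id] by (simp add: \<alpha>_def[abs_def])
  have "\<epsilon> (\<alpha> 0 x) = \<zero>\<^bsub>M\<^esub>" if x: "x \<in> carrier (P 0)" for x
    using module_hom_zero_minus(2)[OF P.mpoly P.mpoly_target gr_homsD(1)[OF P.augmentation_hom], of "\<psi> 0 (\<phi> 0 x)" x]
      x phiD psiD aug P.augmentation_simps by (simp add: \<alpha>_def M.minus_self)
  moreover have "d i (\<alpha> (Suc i) x) = \<alpha> i (d i x)" if x: "x \<in> carrier (P (Suc i))" for i x
    using module_hom_zero_minus(2)[OF P.mpoly P.mpoly gr_homsD(1)[OF P.d_hom], of "\<psi> (Suc i) (\<phi> (Suc i) x)" i x]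
      x phiD psiD assms(2,3) by (simp add: \<alpha>_def chain_map_def)
  ultimately obtain h where h: "\<And>i. h i \<in> gr_homs (P i) (P (Suc i)) 0"
    "\<And>x. x \<in> carrier (P 0) \<Longrightarrow> d 0 (h 0 x) = \<alpha> 0 x"
    "\<And>i x. x \<in> carrier (P (Suc i)) \<Longrightarrow> d (Suc i) (h (Suc i) x) = \<alpha> (Suc i) x \<ominus>\<^bsub>P (Suc i)\<^esub> h i (d i x)"
    using PP.null_homotopy[OF ah] by blast
  have "d (Suc i) (h (Suc i) x) \<oplus>\<^bsub>P (Suc i)\<^esub> h i (d i x) = \<alpha> (Suc i) x" if x: "x \<in> carrier (P (Suc i))" for i x
  proof -
    interpret P': mpoly_module "P (Suc i)" by (rule P.mpoly)
    show ?thesis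
      using h(3)[OF x] module_homD(1)[OF gr_homsD(1)[OF ah] x]
        module_homD(1)[OF gr_homsD(1)[OF h(1)] P.d_simps(1)[OF x]]
      by (simp add: a_minus_def P'.a_assoc P'.l_neg)
  qed
  then show ?thesis
    using h(1,2) unfolding retraction_up_to_homotopy_def \<alpha>_def by blast
qed

theorem resolutions_homotopy_equivalent:
  assumes P: "resolution M P d \<epsilon>" and Q: "resolution M Q d' \<epsilon>'"
  shows "\<exists>\<phi> \<psi> h h'. chain_map P d Q d' \<phi> \<and> chain_map Q d' P d \<psi> \<and>
    retraction_up_to_homotopy P d Q d' \<phi> \<psi> h \<and> retraction_up_to_homotopy Q d' P d \<psi> \<phi> h'"
proof -
  interpret P: resolution M P d \<epsilon> by fact
  interpret Q: resolution M Q d' \<epsilon>' by fact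
  interpret PQ: two_resolutions M P d \<epsilon> Q d' \<epsilon>' ..
  interpret QP: two_resolutions M Q d' \<epsilon>' P d \<epsilon> ..
  obtain \<phi> where phi: "chain_map P d Q d' \<phi>" "\<And>x. x \<in> carrier (P 0) \<Longrightarrow> \<epsilon>' (\<phi> 0 x) = \<epsilon> x"
    using PQ.comparison_map unfolding chain_map_def by blast
  obtain \<psi> where psi: "chain_map Q d' P d \<psi>" "\<And>x. x \<in> carrier (Q 0) \<Longrightarrow> \<epsilon> (\<psi> 0 x) = \<epsilon>' x"
    using QP.comparison_map unfolding chain_map_def by blast
  show ?thesis
    using homotopic_to_id[OF P phi(1) psi(1) phi(2) psi(2)]
      homotopic_to_id[OF Q psi(1) phi(1) psi(2) phi(2)] phi(1) psi(1) by blast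
qed

section \<open>Signs and the simplex\<close>

text \<open>The variables are ordered by an arbitrary enumeration; signs of the Koszul complex refer to it.\<close>

abbreviation idx :: "'n::finite \<Rightarrow> nat" where
  "idx \<equiv> to_nat"

lemma idx_inj: "idx i = idx j \<longleftrightarrow> i = j"
  by simp

lemma idx_linear: "i \<noteq> j \<Longrightarrow> idx i < idx j \<or> idx j < idx i"
  using idx_inj nat_neq_iff by metis

text \<open>
  The sign for moving \<open>e\<^sub>j\<close> to its place among the factors of \<open>e\<^sub>A\<close> in the exterior algebra.
\<close>

definition ksign :: "'n::finite \<Rightarrow> 'n set \<Rightarrow> 'a::comm_ring_1" where
  "ksign j A = (- 1) ^ card {i \<in> A. idx i < idx j}"

lemma ksign_square: "ksign j A * ksign j A = (1 :: 'a::comm_ring_1)"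
  by (simp add: ksign_def flip: power_add mult_2 power_mult)

lemma ksign_cases: "ksign j A = (1 :: 'a::comm_ring_1) \<or> ksign j A = (- 1 :: 'a)"
  unfolding ksign_def by (cases "even (card {i \<in> A. idx i < idx j})") auto

lemma ksign_insert_self: "ksign j (insert j A) = ksign j A"
  unfolding ksign_def by (rule arg_cong[of _ _ "\<lambda>A. (- 1) ^ card A"]) auto

lemma ksign_remove_self: "ksign j (A - {j}) = ksign j A"
  unfolding ksign_def by (rule arg_cong[of _ _ "\<lambda>A. (- 1) ^ card A"]) auto

lemma ksign_insert:
  assumes "i \<notin> A"
  shows "ksign j (insert i A) = (if idx i < idx j then - ksign j A else (ksign j A :: 'a::comm_ring_1))"
proof (cases "idx i < idx j")
  case True
  have "{k \<in> insert i A. idx k < idx j} = insert i {k \<in> A. idx k < idx j}" using True by auto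
  then show ?thesis using True assms by (simp add: ksign_def)
next
  case False
  have "{k \<in> insert i A. idx k < idx j} = {k \<in> A. idx k < idx j}" using False by auto
  then show ?thesis using False by (simp add: ksign_def)
qed

lemma ksign_anticommute:
  assumes "i \<noteq> j" "i \<notin> A" "j \<notin> A"
  shows "ksign i A * ksign j (insert i A) = - (ksign j A * ksign i (insert j A) :: 'a::comm_ring_1)"
proof -
  have "idx i \<noteq> idx j" using assms idx_inj by metis
  then consider "idx i < idx j" | "idx j < idx i" by linarith
  then show ?thesis using assms by cases (auto simp: ksign_insert)
qed

text \<open>
  The augmented simplicial boundary on chains of the full simplex, a chain being given by its
  coefficients: the face \<open>A\<close> receives the coefficients of all faces with one more vertex. The empty face
  is included.
\<close>

definition simplex_d :: "('n::finite set \<Rightarrow> 'a::comm_ring_1) \<Rightarrow> 'n set \<Rightarrow> 'a" where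
  "simplex_d w A = (\<Sum>i\<in>- A. ksign i A * w (insert i A))"

definition cone :: "'n::finite \<Rightarrow> ('n set \<Rightarrow> 'a::comm_ring_1) \<Rightarrow> 'n set \<Rightarrow> 'a" where
  "cone j w A = (if j \<in> A then ksign j A * w (A - {j}) else 0)"

lemma sum_antisymmetric:
  fixes F :: "'n::finite \<Rightarrow> 'n \<Rightarrow> 'a::comm_ring_1"
  assumes "\<And>i j. \<lbrakk>i \<in> U; j \<in> U; i \<noteq> j\<rbrakk> \<Longrightarrow> F i j = - F j i"
  shows "(\<Sum>j\<in>U. \<Sum>i\<in>U - {j}. F i j) = 0"
proof -
  let ?L = "{(j, i). j \<in> U \<and> i \<in> U \<and> idx i < idx j}" and ?R = "{(j, i). j \<in> U \<and> i \<in> U \<and> idx j < idx i}"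
  have "(\<Sum>j\<in>U. \<Sum>i\<in>U - {j}. F i j) = (\<Sum>(j, i)\<in>Sigma U (\<lambda>j. U - {j}). F i j)"
    by (rule sum.Sigma) auto
  also have "Sigma U (\<lambda>j. U - {j}) = ?L \<union> ?R"
    by (auto dest: idx_linear)
  also have "(\<Sum>(j, i)\<in>?L \<union> ?R. F i j) = (\<Sum>(j, i)\<in>?L. F i j) + (\<Sum>(j, i)\<in>?R. F i j)"
    by (intro sum.union_disjoint) auto
  also have "(\<Sum>(j, i)\<in>?R. F i j) = (\<Sum>(j, i)\<in>?L. F j i)"
    by (rule sum.reindex_bij_witness[of _ prod.swap prod.swap]) auto
  also have "\<dots> = (\<Sum>(j, i)\<in>?L. - F i j)"
    using assms by (intro sum.cong) (auto simp: idx_inj)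
  also have "(\<Sum>(j, i)\<in>?L. F i j) + \<dots> = 0"
    by (simp add: sum_negf case_prod_unfold)
  finally show ?thesis .
qed

lemma simplex_d_simplex_d:
  fixes w :: "'n::finite set \<Rightarrow> 'a::comm_ring_1"
  shows "simplex_d (simplex_d w) A = 0"
proof -
  have "simplex_d (simplex_d w) A =
      (\<Sum>j\<in>- A. \<Sum>i\<in>- A - {j}. ksign j A * ksign i (insert j A) * w (insert i (insert j A)))"
    unfolding simplex_d_def sum_distrib_left
    by (intro sum.cong) (auto simp: mult.assoc)
  also have "\<dots> = 0"
  proof (rule sum_antisymmetric)
    fix i j assume "i \<in> - A" "j \<in> - A" "i \<noteq> j"
    then show "ksign j A * ksign i (insert j A) * w (insert i (insert j A)) =
        - (ksign i A * ksign j (insert i A) * w (insert j (insert i A)))"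
      using ksign_anticommute[of i j A, where 'a = 'a] by (simp add: insert_commute)
  qed
  finally show ?thesis .
qed

text \<open>
  The cone over a vertex contracts a simplex: the faces \<open>A\<close> with \<open>j \<in> A\<close> and those without \<open>j\<close> are
  matched by adding \<open>j\<close>.
\<close>

lemma cone_homotopy:
  fixes w :: "'n::finite set \<Rightarrow> 'a::comm_ring_1"
  shows "simplex_d (cone j w) A + cone j (simplex_d w) A = w A"
proof (cases "j \<in> A")
  case False
  have "simplex_d (cone j w) A = (\<Sum>i\<in>- A. if i = j then w A else 0)"
    unfolding simplex_d_def using False
    by (intro sum.cong) (auto simp: cone_def ksign_insert_self ksign_square simp flip: mult.assoc)
  then show ?thesis using False by (simp add: cone_def)
next
  case True
  define C where "C = A - {j}"
  have A: "A = insert j C" "j \<notin> C" using True by (auto simp: C_def)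
  have D: "- C = insert j (- A)" "j \<notin> - A" using A by auto
  have d: "simplex_d (cone j w) A = (\<Sum>i\<in>- A. ksign i A * (ksign j (insert i C) * w (insert i C)))"
    unfolding simplex_d_def
  proof (intro sum.cong refl)
    fix i assume i: "i \<in> - A"
    then have "insert i A - {j} = insert i C" using A by auto
    moreover have "ksign j (insert i A) = (ksign j (insert i C) :: 'a)"
      using A by (simp add: insert_commute[of i j] ksign_insert_self)
    ultimately show "ksign i A * cone j w (insert i A) = ksign i A * (ksign j (insert i C) * w (insert i C))"
      using True by (simp add: cone_def)
  qed
  have c: "cone j (simplex_d w) A = w A + (\<Sum>i\<in>- A. ksign j C * ksign i C * w (insert i C))"
  proof -
    have "cone j (simplex_d w) A = ksign j C * (\<Sum>i\<in>- C. ksign i C * w (insert i C))"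
      using True by (simp add: cone_def simplex_d_def C_def ksign_remove_self)
    also have "\<dots> = ksign j C * (ksign j C * w A) + ksign j C * (\<Sum>i\<in>- A. ksign i C * w (insert i C))"
      unfolding D(1) using D(2) A(1) by (simp add: distrib_left)
    finally show ?thesis by (simp add: ksign_square sum_distrib_left mult.assoc flip: mult.assoc[of "ksign j C" "ksign j C"])
  qed
  have "ksign i A * ksign j (insert i C) = - (ksign j C * ksign i C :: 'a)" if "i \<in> - A" for i
  proof -
    have i: "i \<noteq> j" "i \<notin> C" using that A by auto
    have "ksign j C * (ksign i (insert j C) * ksign j (insert i C)) =
        - (ksign i C * ksign j (insert i C) * ksign j (insert i C) :: 'a)"
      using ksign_anticommute[of j i C, where 'a = 'a] i A by (simp add: mult.assoc[symmetric])
    also have "\<dots> = - ksign i C" by (simp add: mult.assoc ksign_square)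
    finally have "ksign j C * (ksign j C * (ksign i (insert j C) * ksign j (insert i C))) = - (ksign j C * ksign i C :: 'a)"
      by simp
    then show ?thesis by (simp add: A(1) ksign_square flip: mult.assoc)
  qed
  then have "(\<Sum>i\<in>- A. ksign i A * (ksign j (insert i C) * w (insert i C)))
      = - (\<Sum>i\<in>- A. ksign j C * ksign i C * w (insert i C))"
    by (simp add: sum_negf flip: mult.assoc)
  then show ?thesis unfolding d c by simp
qed

section \<open>Modules of finitely supported functions\<close>

lemma lookup_map_times: "Poly_Mapping.lookup (Poly_Mapping.map ((*) s) p) a = s * (Poly_Mapping.lookup p a :: 'a::comm_ring_1)"
  by (simp add: Poly_Mapping.map.rep_eq when_def)

lemma keys_map_times: "Poly_Mapping.keys (Poly_Mapping.map ((*) s) p) \<subseteq> Poly_Mapping.keys (p :: _ \<Rightarrow>\<^sub>0 'a::comm_ring_1)"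
  by (auto simp: in_keys_iff lookup_map_times)

text \<open>
  The free modules on a set \<open>S\<close> of labels occur twice with different records, as Koszul modules and as the
  modules of pairs behind tensor products. The locale fixes the operations only and leaves the grading
  open.
\<close>

locale support_module =
  fixes M :: "(('n::finite, 'k::field) mpoly, 'm \<Rightarrow>\<^sub>0 ('n, 'k) mpoly, 'x) module_scheme" (structure)
    and S :: "'m set"
  assumes carrier_eq: "carrier M = {u. Poly_Mapping.keys u \<subseteq> S}" and zero_eq: "\<zero> = 0"
    and add_eq: "(\<oplus>) = (+)" and smult_eq: "(\<odot>) = (\<lambda>s. Poly_Mapping.map ((*) s))"
begin

lemma carrier_iff: "u \<in> carrier M \<longleftrightarrow> (\<forall>a. a \<notin> S \<longrightarrow> Poly_Mapping.lookup u a = 0)"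
  by (auto simp: carrier_eq in_keys_iff)

lemma is_module: "module mpoly_ring M"
  by (rule mpoly_module_criteria; (intro poly_mapping_eqI)?)
    (simp_all add: carrier_iff zero_eq add_eq smult_eq lookup_add lookup_map_times algebra_simps)

sublocale mpoly_module M
  by (rule mpoly_moduleI) (rule is_module)

lemma uminus_eq: "u \<in> carrier M \<Longrightarrow> \<ominus> u = - u"
  by (subst minus_smult) (auto simp: smult_eq lookup_map_times intro: poly_mapping_eqI)

lemma minus_eq_diff: "v \<in> carrier M \<Longrightarrow> u \<ominus> v = u - v"
  by (simp add: a_minus_def uminus_eq add_eq)

lemma finsum_eq_sum: "(\<And>i. i \<in> A \<Longrightarrow> f i \<in> carrier M) \<Longrightarrow> (\<Oplus>i\<in>A. f i) = (\<Sum>i\<in>A. f i)"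
proof (induction A rule: infinite_finite_induct)
  case (insert x F)
  then show ?case by (simp add: Pi_def add_eq)
qed (simp_all add: zero_eq)

lemma sum_carrier: "(\<And>i. i \<in> A \<Longrightarrow> f i \<in> carrier M) \<Longrightarrow> (\<Sum>i\<in>A. f i) \<in> carrier M"
  by (auto simp: carrier_iff lookup_sum)

lemma free_basis:
  assumes "finite S"
  defines "B \<equiv> (\<lambda>a. Poly_Mapping.single a 1) ` S"
  shows "span B = carrier M" and "lin_indpt B"
proof -
  have BM: "B \<subseteq> carrier M" and fin: "finite B" using assms by (auto simp: carrier_eq)
  have lc: "Poly_Mapping.lookup (lincomb c B) a = c (Poly_Mapping.single a 1)" if a: "a \<in> S" for c a
  proof -
    have "lincomb c B = (\<Sum>e\<in>B. c e \<odot> e)"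
      unfolding lincomb_def using BM by (intro finsum_eq_sum) auto
    also have "Poly_Mapping.lookup \<dots> a = (\<Sum>e\<in>B. c e * Poly_Mapping.lookup e a)"
      by (simp add: lookup_sum smult_eq lookup_map_times)
    also have "\<dots> = (\<Sum>e\<in>B. if e = Poly_Mapping.single a 1 then c e else 0)"
      by (intro sum.cong) (auto simp: B_def lookup_single when_def)
    also have "\<dots> = c (Poly_Mapping.single a 1)" using a fin by (auto simp: B_def)
    finally show ?thesis .
  qed
  have lcM: "lincomb c B \<in> carrier M" for c using BM by (intro lincomb_closed) auto
  show "span B = carrier M"
  proof
    show "span B \<subseteq> carrier M" using BM by (rule span_is_subset2)
    show "carrier M \<subseteq> span B"
    proof
      fix u assume u: "u \<in> carrier M"
      \<comment> \<open>Linear combinations are indexed by the basis elements themselves; the single key of \<open>e\<close> is its label.\<close>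
      define c where "c e = Poly_Mapping.lookup u (the_elem (Poly_Mapping.keys e))"
        for e :: "'m \<Rightarrow>\<^sub>0 ('n, 'k) mpoly"
      have "lincomb c B = u"
      proof (rule poly_mapping_eqI)
        fix a show "Poly_Mapping.lookup (lincomb c B) a = Poly_Mapping.lookup u a"
          using lc[of a c] lcM[of c] u by (cases "a \<in> S") (auto simp: c_def carrier_iff)
      qed
      then show "u \<in> span B" unfolding span_def using fin by fastforce
    qed
  qed
  show "lin_indpt B"
  proof (rule finite_lin_indpt2[OF fin BM], rule ballI)
    fix c v assume l: "lincomb c B = \<zero>" and "v \<in> B"
    then obtain a where "a \<in> S" "v = Poly_Mapping.single a 1" by (auto simp: B_def)
    then show "c v = \<zero>\<^bsub>mpoly_ring\<^esub>" using lc[of a c] l by (simp add: zero_eq)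
  qed
qed

end

section \<open>Homogeneous polynomials\<close>

lemma poly_comp_iff: "p \<in> poly_comp b \<longleftrightarrow>
    (\<forall>a. (\<lambda>i. int (Poly_Mapping.lookup a i)) \<noteq> b \<longrightarrow> Poly_Mapping.lookup p a = 0)"
  by (auto simp: poly_comp_def in_keys_iff)

lemma poly_comp_zero: "0 \<in> poly_comp b"
  by (simp add: poly_comp_iff)

lemma poly_comp_add: "\<lbrakk>p \<in> poly_comp b; q \<in> poly_comp b\<rbrakk> \<Longrightarrow> p + q \<in> poly_comp b"
  by (simp add: poly_comp_iff lookup_add)

lemma poly_comp_uminus: "p \<in> poly_comp b \<Longrightarrow> - p \<in> poly_comp b"
  by (simp add: poly_comp_iff)

lemma poly_comp_sum: "(\<And>i. i \<in> A \<Longrightarrow> f i \<in> poly_comp b) \<Longrightarrow> (\<Sum>i\<in>A. f i) \<in> poly_comp b"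
  by (induction A rule: infinite_finite_induct) (auto intro: poly_comp_zero poly_comp_add)

lemma poly_comp_mult:
  assumes "p \<in> poly_comp a" "q \<in> poly_comp b" shows "p * q \<in> poly_comp (a + b)"
proof -
  have "(\<lambda>i. int (Poly_Mapping.lookup c i)) = a + b" if c: "c \<in> Poly_Mapping.keys (p * q)" for c
  proof -
    obtain d e where "c = d + e" "d \<in> Poly_Mapping.keys p" "e \<in> Poly_Mapping.keys q"
      using keys_mult[of p q] c by blast
    moreover have "(\<lambda>i. int (Poly_Mapping.lookup d i)) = a" "(\<lambda>i. int (Poly_Mapping.lookup e i)) = b"
      using assms calculation by (auto simp: poly_comp_def)
    ultimately show ?thesis by (auto simp: lookup_add fun_eq_iff)
  qed
  then show ?thesis by (simp add: poly_comp_def)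
qed

lemma poly_comp_const_mult: "p \<in> poly_comp b \<Longrightarrow> const c * p \<in> poly_comp b"
  using poly_comp_mult[OF const_poly_comp, of p b c] by simp

lemma poly_comp_ksign: "p \<in> poly_comp b \<Longrightarrow> ksign j A * p \<in> poly_comp b"
  using ksign_cases[of j A, where 'a = "('a, 'b) mpoly"] by (auto intro: poly_comp_uminus)

abbreviation var :: "'n::finite \<Rightarrow> ('n, 'k::field) mpoly" where
  "var j \<equiv> monomial (Poly_Mapping.single j 1)"

text \<open>
  The degree of the squarefree monomial with support \<open>A\<close>, which is also the degree of the Koszul basis
  element \<open>e\<^sub>A\<close>.
\<close>

definition face_degree :: "'n::finite set \<Rightarrow> 'n \<Rightarrow> int" where
  "face_degree A = (\<lambda>i. if i \<in> A then 1 else 0)"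

lemma var_poly_comp: "var j \<in> poly_comp (face_degree {j})"
  by (auto simp: poly_comp_def monomial_def face_degree_def lookup_single when_def fun_eq_iff)

lemma lookup_var_mult:
  "Poly_Mapping.lookup (var j * p) a =
    (if Poly_Mapping.lookup a j = 0 then 0 else Poly_Mapping.lookup p (a - Poly_Mapping.single j 1))"
proof (induction p rule: poly_induct)
  case (single b c)
  have "Poly_Mapping.lookup (var j * Poly_Mapping.single b c) a =
      (c when Poly_Mapping.single j 1 + b = a)"
    by (simp add: monomial_def mult_single lookup_single)
  also have "\<dots> = (if Poly_Mapping.lookup a j = 0 then 0
      else Poly_Mapping.lookup (Poly_Mapping.single b c) (a - Poly_Mapping.single j 1))"
  proof (cases "Poly_Mapping.lookup a j = 0")
    case True
    then have "Poly_Mapping.single j 1 + b \<noteq> a" by (auto simp: lookup_add)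
    then show ?thesis using True by simp
  next
    case False
    then have "Poly_Mapping.single j 1 + (a - Poly_Mapping.single j 1) = a"
      by (intro poly_mapping_eqI) (auto simp: lookup_add lookup_minus lookup_single when_def)
    then have "Poly_Mapping.single j 1 + b = a \<longleftrightarrow> b = a - Poly_Mapping.single j 1"
      by (metis add_diff_cancel_left')
    then show ?thesis using False by (simp add: lookup_single)
  qed
  finally show ?case .
qed (simp_all add: distrib_left lookup_add)

section \<open>The Koszul complex\<close>

text \<open>
  A chosen resolution of \<open>k\<close> has carriers in \<open>S set \<Rightarrow>\<^sub>0 S\<close>, the type of elements of \<open>k\<close> determining the
  type of labels. The Koszul complex is realized in this type, so that it witnesses that a resolution of
  the required type exists. To this end the basis element \<open>e\<^sub>A\<close> gets a set of variables as its label.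
\<close>

definition label :: "'n::finite set \<Rightarrow> ('n, 'k::field) mpoly set" where
  "label A = var ` A"

lemma label_inj: "label A = label B \<longleftrightarrow> A = B"
proof -
  have "inj (var :: 'a \<Rightarrow> ('a, 'b) mpoly)"
    by (rule injI) (auto simp: monomial_def dest!: arg_cong[of _ _ Poly_Mapping.keys])
  then show ?thesis unfolding label_def by (rule inj_image_eq_iff)
qed

text \<open>
  The coefficient of \<open>e\<^sub>A\<close>.
\<close>

definition coord :: "(('n::finite, 'k::field) mpoly set \<Rightarrow>\<^sub>0 ('n, 'k) mpoly) \<Rightarrow> 'n set \<Rightarrow> ('n, 'k) mpoly" where
  "coord u A = Poly_Mapping.lookup u (label A)"

definition of_coord :: "('n::finite set \<Rightarrow> ('n, 'k::field) mpoly) \<Rightarrow> (('n, 'k) mpoly set \<Rightarrow>\<^sub>0 ('n, 'k) mpoly)" where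
  "of_coord f = (\<Sum>A\<in>UNIV. Poly_Mapping.single (label A) (f A))"

definition koszul :: "nat \<Rightarrow> ('n::finite, 'k::field, ('n, 'k) mpoly set \<Rightarrow>\<^sub>0 ('n, 'k) mpoly) gr_mod" where
  "koszul i = \<lparr>carrier = {u. Poly_Mapping.keys u \<subseteq> label ` {A. card A = i}},
     mult = undefined, one = undefined, zero = 0, add = (+),
     smult = (\<lambda>s. Poly_Mapping.map ((*) s)),
     hcomp = (\<lambda>b. {u. Poly_Mapping.keys u \<subseteq> label ` {A. card A = i} \<and>
       (\<forall>A. coord u A \<in> poly_comp (b - face_degree A))})\<rparr>"

definition koszul_d :: "(('n::finite, 'k::field) mpoly set \<Rightarrow>\<^sub>0 ('n, 'k) mpoly) \<Rightarrow>
    (('n, 'k) mpoly set \<Rightarrow>\<^sub>0 ('n, 'k) mpoly)" where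
  "koszul_d u = of_coord (\<lambda>A. \<Sum>j\<in>- A. ksign j A * (var j * coord u (insert j A)))"

lemma coord_of_coord [simp]: "coord (of_coord f) A = f A"
proof -
  have "coord (of_coord f) A = (\<Sum>B\<in>UNIV. if B = A then f B else 0)"
    unfolding coord_def of_coord_def lookup_sum
    by (intro sum.cong) (auto simp: lookup_single when_def label_inj)
  then show ?thesis by simp
qed

lemma lookup_of_coord: "a \<notin> range label \<Longrightarrow> Poly_Mapping.lookup (of_coord f) a = 0"
  by (auto simp: of_coord_def lookup_sum lookup_single when_def intro!: sum.neutral)

lemma coord_koszul_d: "coord (koszul_d u) A = (\<Sum>j\<in>- A. ksign j A * (var j * coord u (insert j A)))"
  by (simp add: koszul_d_def)

lemma coord_add [simp]: "coord (u + v) A = coord u A + coord v A"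
  by (simp add: coord_def lookup_add)

lemma coord_smult [simp]: "coord (Poly_Mapping.map ((*) s) u) A = s * coord u A"
  by (simp add: coord_def lookup_map_times)

lemma coord_zero [simp]: "coord 0 A = 0"
  by (simp add: coord_def)

lemma koszul_simps [simp]:
  "carrier (koszul i) = {u. Poly_Mapping.keys u \<subseteq> label ` {A. card A = i}}"
  "\<zero>\<^bsub>koszul i\<^esub> = 0" "u \<oplus>\<^bsub>koszul i\<^esub> v = u + v"
  "s \<odot>\<^bsub>koszul i\<^esub> u = Poly_Mapping.map ((*) s) u"
  by (simp_all add: koszul_def)

lemma koszul_carrier_iff:
  fixes u :: "('n::finite, 'k::field) mpoly set \<Rightarrow>\<^sub>0 ('n, 'k) mpoly"
  shows "u \<in> carrier (koszul i) \<longleftrightarrow>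
    (\<forall>a. a \<notin> range label \<longrightarrow> Poly_Mapping.lookup u a = 0) \<and> (\<forall>A. card A \<noteq> i \<longrightarrow> coord u A = 0)"
proof -
  have "u \<in> carrier (koszul i) \<longleftrightarrow> (\<forall>a. a \<notin> label ` {A. card A = i} \<longrightarrow> Poly_Mapping.lookup u a = 0)"
    by (auto simp: in_keys_iff)
  also have "\<dots> \<longleftrightarrow> (\<forall>a. a \<notin> range label \<longrightarrow> Poly_Mapping.lookup u a = 0) \<and> (\<forall>A. card A \<noteq> i \<longrightarrow> coord u A = 0)"
  proof (intro iffI conjI allI impI)
    fix A :: "'n set"
    assume l: "\<forall>a. a \<notin> label ` {A. card A = i} \<longrightarrow> Poly_Mapping.lookup u a = 0" and "card A \<noteq> i"
    then have "(label A :: ('n, 'k) mpoly set) \<notin> label ` {A. card A = i}" by (auto simp: label_inj)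
    then show "coord u A = 0" using l by (simp add: coord_def)
  next
    fix a :: "('n, 'k) mpoly set"
    assume l: "(\<forall>a. a \<notin> range label \<longrightarrow> Poly_Mapping.lookup u a = 0) \<and> (\<forall>A. card A \<noteq> i \<longrightarrow> coord u A = 0)"
      and a: "a \<notin> label ` {A. card A = i}"
    show "Poly_Mapping.lookup u a = 0"
    proof (cases "a \<in> range label")
      case True
      then obtain A where "a = label A" by blast
      then show ?thesis using l a by (auto simp: coord_def)
    qed (use l in blast)
  qed blast
  finally show ?thesis .
qed

lemma koszul_hcomp_iff:
  "u \<in> hcomp (koszul i) b \<longleftrightarrow> u \<in> carrier (koszul i) \<and> (\<forall>A. coord u A \<in> poly_comp (b - face_degree A))"
  by (simp add: koszul_def)

lemma coord_ext:
  assumes "u \<in> carrier (koszul i)" "v \<in> carrier (koszul j)" "\<And>A. coord u A = coord v A"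
  shows "u = v"
proof (rule poly_mapping_eqI)
  fix a show "Poly_Mapping.lookup u a = Poly_Mapping.lookup v a"
  proof (cases "a \<in> range label")
    case True
    then show ?thesis using assms(3) by (auto simp: coord_def)
  next
    case False
    then show ?thesis using assms(1,2) unfolding koszul_carrier_iff by metis
  qed
qed

lemma of_coord_carrier: "(\<And>A. card A \<noteq> i \<Longrightarrow> f A = 0) \<Longrightarrow> of_coord f \<in> carrier (koszul i)"
  by (simp add: koszul_carrier_iff lookup_of_coord del: koszul_simps)

interpretation koszul: support_module "koszul i" "label ` {A. card A = i}" for i
  by unfold_locales (auto simp: koszul_def)

lemma koszul_degreewise:
  "degreewise_module (koszul i :: ('n::finite, 'k::field, ('n, 'k) mpoly set \<Rightarrow>\<^sub>0 ('n, 'k) mpoly) gr_mod)"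
proof (intro degreewise_module.intro degreewise_module_axioms.intro)
  show "mpoly_module (koszul i)" by (rule koszul.mpoly_module_axioms)
  fix u v :: "('n, 'k) mpoly set \<Rightarrow>\<^sub>0 ('n, 'k) mpoly" and b c
  assume u: "u \<in> hcomp (koszul i) b"
  then show "u \<in> carrier (koszul i)" by (simp add: koszul_hcomp_iff)
  show "const c \<odot>\<^bsub>koszul i\<^esub> u \<in> hcomp (koszul i) b"
    using u koszul.smult_in[of u i "const c"] unfolding koszul_hcomp_iff
    by (auto intro: poly_comp_const_mult simp del: koszul_simps(1))
  assume "v \<in> hcomp (koszul i) b"
  then show "u \<oplus>\<^bsub>koszul i\<^esub> v \<in> hcomp (koszul i) b"
    using u koszul.a_closed[of u i v] unfolding koszul_hcomp_iff
    by (auto intro: poly_comp_add simp del: koszul_simps(1))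
qed (simp add: koszul_def poly_comp_zero)

interpretation koszul: degreewise_module "koszul i" for i
  by (rule koszul_degreewise)

lemma degreewise_additive_subgroup:
  assumes "degreewise_module M" shows "additive_subgroup (hcomp M b) M"
proof -
  interpret degreewise_module M by fact
  show ?thesis
    by (intro additive_subgroupI subgroup.intro)
      (auto simp: hcomp_zero intro: hcomp_carrier hcomp_add hcomp_neg[unfolded a_inv_def])
qed

lemma single_label_carrier: "Poly_Mapping.single (label A) p \<in> carrier (koszul (card A))"
  by auto

lemma coord_single: "coord (Poly_Mapping.single (label A) p) B = (if B = A then p else 0)"
  by (simp add: coord_def lookup_single when_def label_inj eq_commute)

lemma koszul_sums: "u \<in> carrier (koszul i) \<Longrightarrow> u \<in> sums_of (koszul i) (\<Union>b. hcomp (koszul i) b)"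
proof -
  let ?D = "sums_of (koszul i) (\<Union>b. hcomp (koszul i) b)"
  have add: "u + v \<in> ?D" if "u \<in> ?D" "v \<in> ?D" for u v using sums_of.add[OF that] by simp
  have zero: "0 \<in> ?D" using sums_of.zero[of "koszul i"] by simp
  have mono: "Poly_Mapping.single (label A) p \<in> ?D" if A: "card A = i" for A and p :: "('a, 'b) mpoly"
  proof (induction p rule: poly_induct)
    case (single a c)
    have "Poly_Mapping.single (label A) (Poly_Mapping.single a c) \<in>
        hcomp (koszul i) ((\<lambda>i. int (Poly_Mapping.lookup a i)) + face_degree A)"
      using A single_poly_comp[of a c] unfolding koszul_hcomp_iff
      by (auto simp: coord_single poly_comp_zero)
    then show ?case by (intro sums_of.base) blast
  qed (simp_all add: zero add single_add)
  assume u: "u \<in> carrier (koszul i)"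
  have "u = (\<Sum>A\<in>{A. card A = i}. Poly_Mapping.single (label A) (coord u A))"
  proof (rule coord_ext[OF u])
    show "(\<Sum>A\<in>{A. card A = i}. Poly_Mapping.single (label A) (coord u A)) \<in> carrier (koszul i)"
      by (rule koszul.sum_carrier) auto
    fix B
    have "coord (\<Sum>A\<in>{A. card A = i}. Poly_Mapping.single (label A) (coord u A)) B
        = (\<Sum>A\<in>{A. card A = i}. if A = B then coord u B else 0)"
      unfolding coord_def lookup_sum by (intro sum.cong) (auto simp: lookup_single when_def label_inj)
    then show "coord u B = coord (\<Sum>A\<in>{A. card A = i}. Poly_Mapping.single (label A) (coord u A)) B"
      using u unfolding koszul_carrier_iff by simp
  qed
  moreover have "finite U \<Longrightarrow> (\<And>A. A \<in> U \<Longrightarrow> card A = i) \<Longrightarrow>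
      (\<Sum>A\<in>U. Poly_Mapping.single (label A) (coord u A)) \<in> ?D" for U
    by (induction U rule: finite_induct) (auto intro: zero add mono)
  ultimately show "u \<in> ?D" by (metis (mono_tags, lifting) finite mem_Collect_eq)
qed

text \<open>
  In a homogeneous decomposition of \<open>u\<close>, the coefficient of \<open>x\<^sup>a e\<^sub>A\<close> can only come from the component of
  degree \<open>a\<close> plus the degree of \<open>e\<^sub>A\<close>, so the components are determined by the coefficients of \<open>u\<close>.
\<close>

lemma koszul_graded: "graded_module (koszul i)"
proof (intro graded_module.intro graded_module_axioms.intro)
  show "module mpoly_ring (koszul i)" by (rule koszul.mpoly_module)
  show "additive_subgroup (hcomp (koszul i) b) (koszul i)" for b
    by (rule degreewise_additive_subgroup[OF koszul_degreewise])
  show "s \<odot>\<^bsub>koszul i\<^esub> u \<in> hcomp (koszul i) (a + b)"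
    if "s \<in> poly_comp a" "u \<in> hcomp (koszul i) b" for s a u b
    using that koszul.smult_in[of u i s] poly_comp_mult[of s a] unfolding koszul_hcomp_iff
    by (auto simp del: koszul_simps(1) simp: add_diff_eq[symmetric])
  fix u assume u: "u \<in> carrier (koszul i)"
  have ex: "\<exists>f. (\<forall>b. f b \<in> hcomp (koszul i) b) \<and> finite {b. f b \<noteq> \<zero>\<^bsub>koszul i\<^esub>} \<and>
      u = (\<Oplus>\<^bsub>koszul i\<^esub>b\<in>{b. f b \<noteq> \<zero>\<^bsub>koszul i\<^esub>}. f b)"
    by (rule sums_decompose[OF koszul.M.abelian_monoid_axioms])
      (use koszul.hcomp_carrier koszul.hcomp_zero koszul.hcomp_add koszul_sums[OF u] in blast)+
  have det: "Poly_Mapping.lookup (coord (f b) A) a =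
      (if b = (\<lambda>i. int (Poly_Mapping.lookup a i)) + face_degree A then Poly_Mapping.lookup (coord u A) a else 0)"
    if f: "\<And>b. f b \<in> hcomp (koszul i) b" "finite {b. f b \<noteq> \<zero>\<^bsub>koszul i\<^esub>}"
      "u = (\<Oplus>\<^bsub>koszul i\<^esub>b\<in>{b. f b \<noteq> \<zero>\<^bsub>koszul i\<^esub>}. f b)" for f b A a
  proof -
    define e where "e = (\<lambda>i. int (Poly_Mapping.lookup a i)) + face_degree A"
    have off: "Poly_Mapping.lookup (coord (f b) A) a = 0" if "b \<noteq> e" for b
    proof -
      have "coord (f b) A \<in> poly_comp (b - face_degree A)" using f(1) by (simp add: koszul_hcomp_iff)
      then show ?thesis using that unfolding poly_comp_iff e_def by (metis diff_add_cancel)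
    qed
    have "u = (\<Sum>b\<in>{b. f b \<noteq> 0}. f b)"
      using f(3) koszul.finsum_eq_sum[of "{b. f b \<noteq> 0}" f i] koszul.hcomp_carrier[OF f(1)] by simp
    then have "Poly_Mapping.lookup (coord u A) a = (\<Sum>b\<in>{b. f b \<noteq> 0}. Poly_Mapping.lookup (coord (f b) A) a)"
      by (simp add: coord_def lookup_sum)
    also have "\<dots> = (\<Sum>b\<in>{b. f b \<noteq> 0}. if b = e then Poly_Mapping.lookup (coord (f e) A) a else 0)"
      using off by (intro sum.cong) auto
    also have "\<dots> = Poly_Mapping.lookup (coord (f e) A) a"
      using f(2) by auto
    finally show ?thesis using off[of b] unfolding e_def[symmetric] by auto
  qed
  show "\<exists>!f. (\<forall>b. f b \<in> hcomp (koszul i) b) \<and> finite {b. f b \<noteq> \<zero>\<^bsub>koszul i\<^esub>} \<and>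
      u = (\<Oplus>\<^bsub>koszul i\<^esub>b\<in>{b. f b \<noteq> \<zero>\<^bsub>koszul i\<^esub>}. f b)"
  proof (rule ex_ex1I[OF ex])
    fix f g
    assume f: "(\<forall>b. f b \<in> hcomp (koszul i) b) \<and> finite {b. f b \<noteq> \<zero>\<^bsub>koszul i\<^esub>} \<and>
        u = (\<Oplus>\<^bsub>koszul i\<^esub>b\<in>{b. f b \<noteq> \<zero>\<^bsub>koszul i\<^esub>}. f b)"
      and g: "(\<forall>b. g b \<in> hcomp (koszul i) b) \<and> finite {b. g b \<noteq> \<zero>\<^bsub>koszul i\<^esub>} \<and>
        u = (\<Oplus>\<^bsub>koszul i\<^esub>b\<in>{b. g b \<noteq> \<zero>\<^bsub>koszul i\<^esub>}. g b)"
    show "f = g"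
    proof
      fix b
      have c: "f b \<in> carrier (koszul i)" "g b \<in> carrier (koszul i)"
        using f g koszul.hcomp_carrier by blast+
      show "f b = g b"
      proof (rule coord_ext[OF c], rule poly_mapping_eqI)
        fix A a
        show "Poly_Mapping.lookup (coord (f b) A) a = Poly_Mapping.lookup (coord (g b) A) a"
          using det[of f b A a] det[of g b A a] f g by metis
      qed
    qed
  qed
qed

lemma basis_hcomp:
  "Poly_Mapping.single (label A) 1 \<in> hcomp (koszul (card A)) (face_degree (A :: 'n::finite set)
    :: 'n \<Rightarrow> int)"
  using const_poly_comp[of 1] by (auto simp: koszul_hcomp_iff coord_single poly_comp_zero)

lemma koszul_free:
  "gr_free (koszul i :: ('n::finite, 'k::field, ('n, 'k) mpoly set \<Rightarrow>\<^sub>0 ('n, 'k) mpoly) gr_mod)"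
  unfolding gr_free_def
proof (intro conjI exI)
  let ?B = "(\<lambda>a. Poly_Mapping.single a 1) ` (label ` {A. card A = i})
    :: (('n, 'k) mpoly set \<Rightarrow>\<^sub>0 ('n, 'k) mpoly) set"
  show "graded_module (koszul i)" by (rule koszul_graded)
  have fin: "finite (label ` {A. card A = i})" by simp
  show "koszul.span i ?B = carrier (koszul i)" "\<not> koszul.lin_dep i ?B"
    using koszul.free_basis[OF fin] by auto
  show "?B \<subseteq> (\<Union>b. hcomp (koszul i) b)"
  proof
    fix e :: "('n, 'k) mpoly set \<Rightarrow>\<^sub>0 ('n, 'k) mpoly"
    assume "e \<in> ?B"
    then obtain A where "card A = i" "e = Poly_Mapping.single (label A) 1" by auto
    then have "e \<in> hcomp (koszul i) (face_degree A)" using basis_hcomp[of A] by simp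
    then show "e \<in> (\<Union>b. hcomp (koszul i) b)" by auto
  qed
qed

subsection \<open>Exactness in each multidegree\<close>

definition face_monomial :: "'n::finite set \<Rightarrow> 'n \<Rightarrow>\<^sub>0 nat" where
  "face_monomial A = (\<Sum>i\<in>A. Poly_Mapping.single i 1)"

lemma lookup_face_monomial: "Poly_Mapping.lookup (face_monomial A) i = (if i \<in> A then 1 else 0)"
  by (simp add: face_monomial_def lookup_sum lookup_single when_def)

text \<open>
  The terms \<open>x\<^sup>c e\<^sub>A\<close> of multidegree \<open>b\<close> are those with \<open>c = b - A\<close>, one for each \<open>A\<close> contained in the support
  of \<open>b\<close>. Subtraction of exponents is truncated, hence the case distinction.
\<close>

definition strand :: "(('n::finite, 'k::field) mpoly set \<Rightarrow>\<^sub>0 ('n, 'k) mpoly) \<Rightarrow> ('n \<Rightarrow>\<^sub>0 nat) \<Rightarrow> 'n set \<Rightarrow> 'k" where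
  "strand u b A = (if A \<subseteq> Poly_Mapping.keys b then Poly_Mapping.lookup (coord u A) (b - face_monomial A) else 0)"

lemma lookup_ksign_mult: "Poly_Mapping.lookup (ksign j A * p) a = ksign j A * Poly_Mapping.lookup (p :: ('n::finite, 'k::field) mpoly) a"
proof -
  have "(ksign j A, ksign j A) \<in> {(1 :: ('n, 'k) mpoly, 1 :: 'k), (- 1, - 1)}"
    unfolding ksign_def by (cases "even (card {i \<in> A. idx i < idx j})") auto
  then show ?thesis by auto
qed

text \<open>
  The part of multidegree \<open>b\<close> of the Koszul complex is the chain complex of the simplex on the support of
  \<open>b\<close>: the factor \<open>x\<^sub>j\<close> in the differential only compensates for the shift of the exponents.
\<close>

lemma strand_d: "strand (koszul_d u) b = simplex_d (strand u b)"
proof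
  fix A
  show "strand (koszul_d u) b A = simplex_d (strand u b) A"
  proof (cases "A \<subseteq> Poly_Mapping.keys b")
    case True
    have "Poly_Mapping.lookup (ksign j A * (var j * coord u (insert j A))) (b - face_monomial A)
        = ksign j A * strand u b (insert j A)" if "j \<in> - A" for j
    proof -
      have "b - face_monomial A - Poly_Mapping.single j 1 = b - face_monomial (insert j A)"
        using that by (intro poly_mapping_eqI)
          (auto simp: lookup_minus lookup_face_monomial lookup_single when_def)
      then show ?thesis
        using that True
        by (auto simp: lookup_ksign_mult lookup_var_mult strand_def lookup_minus lookup_face_monomial in_keys_iff
            simp del: One_nat_def)
    qed
    then show ?thesis
      using True by (simp add: strand_def[of "koszul_d u"] coord_koszul_d lookup_sum simplex_d_def)
  next
    case False
    then show ?thesis by (auto simp: strand_def simplex_d_def intro!: sum.neutral[symmetric])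
  qed
qed

lemma strand_ext:
  assumes "\<And>b. strand u b = strand v b" shows "coord u A = coord v A"
proof (rule poly_mapping_eqI)
  fix c
  have "A \<subseteq> Poly_Mapping.keys (c + face_monomial A)"
    by (auto simp: in_keys_iff lookup_add lookup_face_monomial)
  then show "Poly_Mapping.lookup (coord u A) c = Poly_Mapping.lookup (coord v A) c"
    using fun_cong[OF assms[of "c + face_monomial A"], of A] by (simp add: strand_def)
qed

text \<open>
  The apex of the cone in multidegree \<open>b\<close>.
\<close>

definition pivot :: "('n::finite \<Rightarrow>\<^sub>0 nat) \<Rightarrow> 'n" where
  "pivot b = (SOME j. j \<in> Poly_Mapping.keys b)"

lemma pivot_mem: "b \<noteq> 0 \<Longrightarrow> pivot b \<in> Poly_Mapping.keys b"
  unfolding pivot_def by (rule someI_ex) (metis keys_eq_empty ex_in_conv)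

text \<open>
  The coefficient of \<open>x\<^sup>c e\<^sub>A\<close> in the image of \<open>u\<close> under the contracting homotopy that in each multidegree
  \<open>b\<close> is the cone over \<open>pivot b\<close>. The multidegree of \<open>x\<^sup>c e\<^sub>A\<close> is \<open>c + A\<close>, and removing the apex \<open>j\<close> from
  \<open>A\<close> raises the exponent of \<open>x\<^sub>j\<close> by one. As the apex varies with the multidegree, the homotopy is only
  \<open>k\<close>-linear.
\<close>

definition koszul_h_coeff :: "(('n::finite, 'k::field) mpoly set \<Rightarrow>\<^sub>0 ('n, 'k) mpoly) \<Rightarrow> 'n set \<Rightarrow> ('n \<Rightarrow>\<^sub>0 nat) \<Rightarrow> 'k" where
  "koszul_h_coeff u A c = (let j = pivot (c + face_monomial A) in
     if j \<in> A then ksign j A * Poly_Mapping.lookup (coord u (A - {j})) (c + Poly_Mapping.single j 1) else 0)"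

definition koszul_h :: "(('n::finite, 'k::field) mpoly set \<Rightarrow>\<^sub>0 ('n, 'k) mpoly) \<Rightarrow>
    (('n, 'k) mpoly set \<Rightarrow>\<^sub>0 ('n, 'k) mpoly)" where
  "koszul_h u = of_coord (\<lambda>A. Abs_poly_mapping (koszul_h_coeff u A))"

lemma lookup_koszul_h: "Poly_Mapping.lookup (coord (koszul_h u) A) c = koszul_h_coeff u A c"
proof -
  \<comment> \<open>Only the finitely many possible apices \<open>j \<in> A\<close> contribute, each with a shifted finite support.\<close>
  have "{c. koszul_h_coeff u A c \<noteq> 0} \<subseteq>
      (\<Union>j\<in>A. (\<lambda>c. c + Poly_Mapping.single j 1) -` Poly_Mapping.keys (coord u (A - {j})))"
    by (auto simp: koszul_h_coeff_def Let_def in_keys_iff split: if_splits)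
  moreover have "finite ((\<lambda>c. c + Poly_Mapping.single j 1) -` Poly_Mapping.keys (coord u (A - {j})))" for j
    by (rule finite_vimageI) (auto intro: injI)
  ultimately have "finite {c. koszul_h_coeff u A c \<noteq> 0}"
    by (meson finite_UN_I finite finite_subset)
  then show ?thesis by (simp add: koszul_h_def)
qed

lemma strand_h:
  assumes "b \<noteq> 0" shows "strand (koszul_h u) b = cone (pivot b) (strand u b)"
proof
  fix A
  let ?j = "pivot b"
  show "strand (koszul_h u) b A = cone ?j (strand u b) A"
  proof (cases "A \<subseteq> Poly_Mapping.keys b")
    case True
    have b: "b - face_monomial A + face_monomial A = b"
      using True by (intro poly_mapping_eqI)
        (auto simp: lookup_add lookup_minus lookup_face_monomial in_keys_iff subset_iff Suc_leI)
    have "b - face_monomial A + Poly_Mapping.single ?j 1 = b - face_monomial (A - {?j})" if "?j \<in> A"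
      using that True by (intro poly_mapping_eqI)
        (auto simp: lookup_add lookup_minus lookup_face_monomial lookup_single when_def in_keys_iff subset_iff)
    then show ?thesis
      using True b by (auto simp: strand_def lookup_koszul_h koszul_h_coeff_def cone_def Let_def)
  next
    case False
    then show ?thesis using pivot_mem[OF assms] by (auto simp: strand_def cone_def)
  qed
qed

lemma strand_h_0: "strand (koszul_h u) 0 A = 0"
  by (simp add: strand_def lookup_koszul_h koszul_h_coeff_def)

text \<open>
  The cone needs a vertex, so the homotopy works in the multidegrees \<open>b \<noteq> 0\<close>. In multidegree \<open>0\<close> the
  complex consists of the constants in homological degree \<open>0\<close>; this is where the kernel of the augmentation
  enters as the second hypothesis.
\<close>

lemma koszul_d_h:
  assumes "koszul_d u = 0" and 0: "Poly_Mapping.lookup (coord u {}) 0 = 0"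
  shows "coord (koszul_d (koszul_h u)) A = coord u A"
proof (rule strand_ext)
  fix b
  have z: "strand (0 :: ('a, 'b) mpoly set \<Rightarrow>\<^sub>0 ('a, 'b) mpoly) b = (\<lambda>_. 0)"
    by (simp add: strand_def fun_eq_iff)
  have d: "simplex_d (strand u b) = (\<lambda>_. 0)" using strand_d[of u b] assms(1) z by simp
  show "strand (koszul_d (koszul_h u)) b = strand u b"
  proof (cases "b = 0")
    case True
    have "strand u b A = 0" for A
      using 0 True by (auto simp: strand_def face_monomial_def)
    moreover have "strand (koszul_d (koszul_h u)) b A = 0" for A
      unfolding strand_d using True by (simp add: simplex_d_def strand_h_0)
    ultimately show ?thesis by (simp add: fun_eq_iff)
  next
    case False
    show ?thesis
    proof
      fix A
      have "strand (koszul_d (koszul_h u)) b A + cone (pivot b) (simplex_d (strand u b)) A = strand u b A"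
        unfolding strand_d strand_h[OF False] by (rule cone_homotopy)
      then show "strand (koszul_d (koszul_h u)) b A = strand u b A"
        unfolding d by (simp add: cone_def cong: if_cong)
    qed
  qed
qed

lemma koszul_d_carrier: "u \<in> carrier (koszul (Suc i)) \<Longrightarrow> koszul_d u \<in> carrier (koszul i)"
  unfolding koszul_d_def
  by (rule of_coord_carrier) (auto simp: koszul_carrier_iff simp del: koszul_simps intro!: sum.neutral)

lemma koszul_h_carrier:
  assumes "u \<in> carrier (koszul i)" shows "koszul_h u \<in> carrier (koszul (Suc i))"
  unfolding koszul_h_def
proof (rule of_coord_carrier)
  fix A :: "'a set" assume "card A \<noteq> Suc i"
  then have "coord u (A - {j}) = 0" if "j \<in> A" for j
    using assms that card_Suc_Diff1[of A j] unfolding koszul_carrier_iff by auto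
  then have "koszul_h_coeff u A = (\<lambda>_. 0)"
    by (auto simp: koszul_h_coeff_def Let_def fun_eq_iff)
  then show "Abs_poly_mapping (koszul_h_coeff u A) = 0" by simp
qed

lemma koszul_d_d: "u \<in> carrier (koszul (Suc (Suc i))) \<Longrightarrow> koszul_d (koszul_d u) = 0"
proof (rule coord_ext[of _ i])
  assume u: "u \<in> carrier (koszul (Suc (Suc i)))"
  show "koszul_d (koszul_d u) \<in> carrier (koszul i)" using u by (intro koszul_d_carrier)
  show "coord (koszul_d (koszul_d u)) A = coord 0 A" for A
    by (rule strand_ext) (simp add: strand_d simplex_d_simplex_d fun_eq_iff strand_def[of 0])
qed auto

lemma koszul_d_hom:
  "(koszul_d :: (('n::finite, 'k::field) mpoly set \<Rightarrow>\<^sub>0 ('n, 'k) mpoly) \<Rightarrow> _) \<in>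
    gr_homs (koszul (Suc i)) (koszul i) 0"
proof (rule gr_homsI)
  show "koszul_d \<in> module_hom mpoly_ring (koszul (Suc i)) (koszul i)"
  proof (rule module_homI)
    show c: "koszul_d u \<in> carrier (koszul i)" if "u \<in> carrier (koszul (Suc i))" for u
      using that by (rule koszul_d_carrier)
    show "koszul_d (u \<oplus>\<^bsub>koszul (Suc i)\<^esub> v) = koszul_d u \<oplus>\<^bsub>koszul i\<^esub> koszul_d v"
      if u: "u \<in> carrier (koszul (Suc i))" and v: "v \<in> carrier (koszul (Suc i))" for u v
    proof (rule coord_ext)
      show "koszul_d (u \<oplus>\<^bsub>koszul (Suc i)\<^esub> v) \<in> carrier (koszul i)" by (rule c[OF koszul.a_closed[OF u v]])
      show "koszul_d u \<oplus>\<^bsub>koszul i\<^esub> koszul_d v \<in> carrier (koszul i)" by (rule koszul.a_closed[OF c[OF u] c[OF v]])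
    qed (simp add: coord_koszul_d sum.distrib distrib_left)
    show "koszul_d (s \<odot>\<^bsub>koszul (Suc i)\<^esub> u) = s \<odot>\<^bsub>koszul i\<^esub> koszul_d u"
      if u: "u \<in> carrier (koszul (Suc i))" for s u
    proof (rule coord_ext)
      show "koszul_d (s \<odot>\<^bsub>koszul (Suc i)\<^esub> u) \<in> carrier (koszul i)" by (rule c[OF koszul.smult_in[OF u]])
      show "s \<odot>\<^bsub>koszul i\<^esub> koszul_d u \<in> carrier (koszul i)" by (rule koszul.smult_in[OF c[OF u]])
    qed (simp add: coord_koszul_d sum_distrib_left mult_ac)
  qed
  fix b and u :: "('n, 'k) mpoly set \<Rightarrow>\<^sub>0 ('n, 'k) mpoly" assume u: "u \<in> hcomp (koszul (Suc i)) b"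
  have "var j * coord u (insert j A) \<in> poly_comp (b - face_degree A)" if "j \<notin> A" for j A
  proof -
    have "coord u (insert j A) \<in> poly_comp (b - face_degree (insert j A))"
      using u by (simp add: koszul_hcomp_iff)
    then have "var j * coord u (insert j A) \<in> poly_comp (face_degree {j} + (b - face_degree (insert j A)))"
      by (rule poly_comp_mult[OF var_poly_comp])
    moreover have "face_degree {j} + (b - face_degree (insert j A)) = b - face_degree A"
      using that by (auto simp: face_degree_def fun_eq_iff)
    ultimately show ?thesis by simp
  qed
  then show "koszul_d u \<in> hcomp (koszul i) (b + 0)"
    using u koszul_d_carrier[of u i] unfolding koszul_hcomp_iff
    by (auto simp: coord_koszul_d simp del: koszul_simps intro!: poly_comp_sum poly_comp_ksign)
qed

section \<open>Quotients of the polynomial ring\<close>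

lemma poly_module_simps [simp]:
  "carrier poly_module = UNIV" "\<zero>\<^bsub>poly_module\<^esub> = 0" "p \<oplus>\<^bsub>poly_module\<^esub> q = p + q"
  "s \<odot>\<^bsub>poly_module\<^esub> p = s * p" "hcomp poly_module b = poly_comp b"
  by (simp_all add: poly_module_def)

lemma poly_module_degreewise: "degreewise_module poly_module"
proof (intro degreewise_module.intro degreewise_module_axioms.intro mpoly_moduleI)
  show "module mpoly_ring poly_module"
    by (rule mpoly_module_criteria) (simp_all add: algebra_simps)
qed (simp_all add: poly_comp_zero poly_comp_add poly_comp_const_mult)

interpretation poly: degreewise_module poly_module
  by (rule poly_module_degreewise)

lemma poly_minus: "p \<ominus>\<^bsub>poly_module\<^esub> q = p - q"
  by (simp add: a_minus_def poly.minus_smult)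

lemma ideal_submodule:
  assumes "ideal I mpoly_ring" shows "submodule mpoly_ring I poly_module"
proof -
  interpret ideal I mpoly_ring by fact
  have s: "subgroup I (add_monoid mpoly_ring)" by (rule a_subgroup)
  show ?thesis
    using I_l_closed subgroup.m_closed[OF s] subgroup.one_closed[OF s]
    by (intro submodule.intro poly.mpoly_module) auto
qed

lemma quot_multigraded:
  assumes U: "submodule mpoly_ring U poly_module"
  shows "multigraded_module (quot_module poly_module U)"
proof (intro multigraded_module.intro multigraded_module_axioms.intro)
  let ?Q = "quot_module poly_module U"
  note q = quot_module_ops[OF poly.mpoly_module U] quot_module_zero[OF poly.mpoly_module U]
    quot_module_carrier[OF poly.mpoly_module U] quot_module_hcomp[OF poly.mpoly_module U]
  show "degreewise_module ?Q" by (rule quot_degreewise[OF poly_module_degreewise U])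
  show "s \<odot>\<^bsub>?Q\<^esub> m \<in> hcomp ?Q (a + b)" if "s \<in> poly_comp a" "m \<in> hcomp ?Q b" for s m a b
    using that by (auto simp: q intro!: imageI poly_comp_mult)
  show "m \<in> sums_of ?Q (\<Union>b. hcomp ?Q b)" if "m \<in> carrier ?Q" for m
  proof -
    have "U +>\<^bsub>poly_module\<^esub> p \<in> sums_of ?Q (\<Union>b. hcomp ?Q b)" for p
    proof (induction p rule: poly_induct)
      case zero
      show ?case using sums_of.zero[of ?Q] by (simp add: q)
    next
      case (single a c)
      have "U +>\<^bsub>poly_module\<^esub> Poly_Mapping.single a c \<in> hcomp ?Q (\<lambda>i. int (Poly_Mapping.lookup a i))"
        using single_poly_comp[of a c] by (auto simp: q)
      then show ?case by (intro sums_of.base) auto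
    next
      case (add s t)
      then show ?case using sums_of.add[OF add] by (simp add: q)
    qed
    then show ?thesis using that by (auto simp: q)
  qed
qed

lemma graded_moduleI:
  assumes M: "multigraded_module M"
    and unique: "\<And>f g. \<lbrakk>\<And>b. f b \<in> hcomp M b; finite {b. f b \<noteq> \<zero>\<^bsub>M\<^esub>}; \<And>b. g b \<in> hcomp M b;
      finite {b. g b \<noteq> \<zero>\<^bsub>M\<^esub>};
      (\<Oplus>\<^bsub>M\<^esub>b\<in>{b. f b \<noteq> \<zero>\<^bsub>M\<^esub>}. f b) = (\<Oplus>\<^bsub>M\<^esub>b\<in>{b. g b \<noteq> \<zero>\<^bsub>M\<^esub>}. g b)\<rbrakk> \<Longrightarrow> f = g"
  shows "graded_module M"
proof (intro graded_module.intro graded_module_axioms.intro)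
  interpret M: multigraded_module M by fact
  show "module mpoly_ring M" by (rule M.mpoly_module)
  show "additive_subgroup (hcomp M b) M" for b
    by (rule degreewise_additive_subgroup) (rule M.degreewise_module_axioms)
  show "\<lbrakk>s \<in> poly_comp a; m \<in> hcomp M b\<rbrakk> \<Longrightarrow> s \<odot>\<^bsub>M\<^esub> m \<in> hcomp M (a + b)" for s a m b
    by (rule M.smult_hcomp)
  fix m assume m: "m \<in> carrier M"
  show "\<exists>!f. (\<forall>b. f b \<in> hcomp M b) \<and> finite {b. f b \<noteq> \<zero>\<^bsub>M\<^esub>} \<and> m = (\<Oplus>\<^bsub>M\<^esub>b\<in>{b. f b \<noteq> \<zero>\<^bsub>M\<^esub>}. f b)"
  proof (rule ex_ex1I)
    show "\<exists>f. (\<forall>b. f b \<in> hcomp M b) \<and> finite {b. f b \<noteq> \<zero>\<^bsub>M\<^esub>} \<and> m = (\<Oplus>\<^bsub>M\<^esub>b\<in>{b. f b \<noteq> \<zero>\<^bsub>M\<^esub>}. f b)"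
      by (rule sums_decompose[OF M.M.abelian_monoid_axioms])
        (use M.hcomp_carrier M.hcomp_zero M.hcomp_add M.carrier_sums[OF m] in blast)+
  next
    fix f g
    assume f: "(\<forall>b. f b \<in> hcomp M b) \<and> finite {b. f b \<noteq> \<zero>\<^bsub>M\<^esub>} \<and> m = (\<Oplus>\<^bsub>M\<^esub>b\<in>{b. f b \<noteq> \<zero>\<^bsub>M\<^esub>}. f b)"
      and g: "(\<forall>b. g b \<in> hcomp M b) \<and> finite {b. g b \<noteq> \<zero>\<^bsub>M\<^esub>} \<and> m = (\<Oplus>\<^bsub>M\<^esub>b\<in>{b. g b \<noteq> \<zero>\<^bsub>M\<^esub>}. g b)"
    show "f = g"
      by (rule unique) (simp_all add: f[THEN conjunct1] f[THEN conjunct2, THEN conjunct1]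
        g[THEN conjunct1] g[THEN conjunct2, THEN conjunct1]
        f[THEN conjunct2, THEN conjunct2, symmetric] g[THEN conjunct2, THEN conjunct2, symmetric])
  qed
qed

text \<open>
  The exponent of a variable and the index \<open>1\<close> of a complex are to keep their form, in which they occur
  in \<open>var\<close> and in the definition of a resolution.
\<close>

declare One_nat_def [simp del]

section \<open>The Koszul resolution of the residue field\<close>

abbreviation irrelevant_ideal :: "('n::finite, 'k::field) mpoly set" where
  "irrelevant_ideal \<equiv> Idl\<^bsub>mpoly_ring\<^esub> (range var)"

lemma irrelevant_ideal_ideal: "ideal irrelevant_ideal (mpoly_ring :: ('n::finite, 'k::field) mpoly ring)"
  by (rule ring.genideal_ideal[OF ring_from_type_algebra]) simp

lemmas irrelevant_submodule = ideal_submodule[OF irrelevant_ideal_ideal]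

text \<open>
  The polynomials without constant term form an ideal that contains the variables. Conversely every
  monomial other than \<open>1\<close> is a multiple of a variable.
\<close>

lemma in_irrelevant_ideal_iff: "p \<in> irrelevant_ideal \<longleftrightarrow> Poly_Mapping.lookup p 0 = 0"
  for p :: "('n::finite, 'k::field) mpoly"
proof
  note sub = irrelevant_submodule[where 'a = 'n and 'b = 'k]
  let ?Z = "{p :: ('n, 'k) mpoly. Poly_Mapping.lookup p 0 = 0}"
  have const_term: "Poly_Mapping.lookup (s * t) 0 = Poly_Mapping.lookup s 0 * Poly_Mapping.lookup t 0"
    for s t :: "('n, 'k) mpoly"
  proof (induction s rule: poly_induct)
    case (single a c)
    show ?case
    proof (induction t rule: poly_induct)
      case (single b e)
      have "a + b = 0 \<longleftrightarrow> a = 0 \<and> b = 0"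
        by (auto simp: poly_mapping_eq_iff fun_eq_iff lookup_add)
      then show ?case by (auto simp: mult_single lookup_single when_def)
    qed (simp_all add: distrib_left lookup_add)
  qed (simp_all add: distrib_right lookup_add)
  have "ideal ?Z mpoly_ring"
  proof (rule idealI)
    show "ring (mpoly_ring :: ('n, 'k) mpoly ring)" by (rule ring_from_type_algebra)
    have inv: "inv\<^bsub>add_monoid mpoly_ring\<^esub> p = - p" for p :: "('n, 'k) mpoly"
      using abelian_group.minus_equality[OF ring.is_abelian_group[OF ring_from_type_algebra], of "- p" p] by (simp add: a_inv_def)
    show "subgroup ?Z (add_monoid mpoly_ring)"
    proof (rule subgroup.intro)
      show "inv\<^bsub>add_monoid mpoly_ring\<^esub> p \<in> ?Z" if "p \<in> ?Z" for p
        using that unfolding inv by simp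
    qed (auto simp: lookup_add)
  qed (auto simp: const_term)
  moreover have "range var \<subseteq> ?Z"
    by (auto simp: monomial_def lookup_single when_def poly_mapping_eq_iff fun_eq_iff split: if_splits)
  ultimately have "irrelevant_ideal \<subseteq> ?Z"
    by (rule ring.genideal_minimal[OF ring_from_type_algebra])
  then show "p \<in> irrelevant_ideal \<Longrightarrow> Poly_Mapping.lookup p 0 = 0" by blast
  have "p - const (Poly_Mapping.lookup p 0) \<in> irrelevant_ideal"
  proof (induction p rule: poly_induct)
    case zero
    show ?case using submodule.zero_closed[OF sub] by simp
  next
    case (single a c)
    show ?case
    proof (cases "a = 0")
      case True
      then show ?thesis using submodule.zero_closed[OF sub] by simp
    next
      case False
      then obtain j where "Poly_Mapping.lookup a j \<noteq> 0" by (auto simp: poly_mapping_eq_iff fun_eq_iff)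
      then have "(a - Poly_Mapping.single j 1) + Poly_Mapping.single j 1 = a"
        by (intro poly_mapping_eqI) (auto simp: lookup_add lookup_minus lookup_single when_def)
      then have "Poly_Mapping.single a c = Poly_Mapping.single (a - Poly_Mapping.single j 1) c * var j"
        by (simp add: monomial_def mult_single del: One_nat_def)
      moreover have "var j \<in> irrelevant_ideal"
        using ring.genideal_self[OF ring_from_type_algebra, of "range var"] by auto
      ultimately have "Poly_Mapping.single a c \<in> irrelevant_ideal"
        using submodule.smult_closed[OF sub, of "Poly_Mapping.single (a - Poly_Mapping.single j 1) c" "var j"]
        by (simp del: One_nat_def)
      then show ?thesis using False by (simp add: lookup_single)
    qed
  next
    case (add s t)
    have "s + t - const (Poly_Mapping.lookup (s + t) 0) =
        (s - const (Poly_Mapping.lookup s 0)) + (t - const (Poly_Mapping.lookup t 0))"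
      by (simp add: lookup_add single_add)
    then show ?case using submodule.m_closed[OF sub add] by (simp only: poly_module_simps)
  qed
  then show "Poly_Mapping.lookup p 0 = 0 \<Longrightarrow> p \<in> irrelevant_ideal" by simp
qed

abbreviation residue_class :: "('n::finite, 'k::field) mpoly \<Rightarrow> ('n, 'k) mpoly set" where
  "residue_class p \<equiv> irrelevant_ideal +>\<^bsub>poly_module\<^esub> p"

lemma residue_class_eq: "residue_class p = residue_class q \<longleftrightarrow> Poly_Mapping.lookup p 0 = Poly_Mapping.lookup q 0"
  using coset_eq_iff[OF poly.mpoly_module irrelevant_submodule, of p q]
  by (simp add: poly_minus in_irrelevant_ideal_iff lookup_minus)

lemma residue_field_simps:
  "carrier residue_field_module = range residue_class"
  "\<zero>\<^bsub>residue_field_module\<^esub> = residue_class 0"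
  "residue_class p \<oplus>\<^bsub>residue_field_module\<^esub> residue_class q = residue_class (p + q)"
  "s \<odot>\<^bsub>residue_field_module\<^esub> residue_class p = residue_class (s * p)"
  "hcomp residue_field_module b = residue_class ` poly_comp b"
  unfolding residue_field_module_def
  using quot_module_ops[OF poly.mpoly_module irrelevant_submodule, of p]
    quot_module_zero[OF poly.mpoly_module irrelevant_submodule]
    quot_module_carrier[OF poly.mpoly_module irrelevant_submodule]
    quot_module_hcomp[OF poly.mpoly_module irrelevant_submodule]
  by simp_all

lemma residue_field_hcomp_nonzero:
  assumes "m \<in> hcomp residue_field_module b" "b \<noteq> 0" shows "m = \<zero>\<^bsub>residue_field_module\<^esub>"
proof -
  obtain p where p: "p \<in> poly_comp b" "m = residue_class p" using assms(1) by (auto simp: residue_field_simps)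
  have "Poly_Mapping.lookup p 0 = 0"
    using p(1) assms(2) by (auto simp: poly_comp_iff fun_eq_iff zero_fun_def)
  then show ?thesis using p by (simp add: residue_field_simps residue_class_eq)
qed

text \<open>
  As \<open>k\<close> is concentrated in degree \<open>0\<close>, a family of homogeneous elements is determined by its member in
  degree \<open>0\<close>, which is also its sum.
\<close>

lemma residue_field_graded:
  "graded_module (residue_field_module :: ('n::finite, 'k::field, ('n, 'k) mpoly set) gr_mod)"
proof (rule graded_moduleI)
  let ?k = "residue_field_module :: ('n, 'k, ('n, 'k) mpoly set) gr_mod"
  show k: "multigraded_module ?k"
    unfolding residue_field_module_def by (rule quot_multigraded[OF irrelevant_submodule])
  interpret k: multigraded_module ?k by (rule k)
  have sum: "(\<Oplus>\<^bsub>?k\<^esub>b\<in>{b. f b \<noteq> \<zero>\<^bsub>?k\<^esub>}. f b) = f 0" if f: "\<And>b. f b \<in> hcomp ?k b" for f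
  proof -
    have "(\<Oplus>\<^bsub>?k\<^esub>b\<in>{b. f b \<noteq> \<zero>\<^bsub>?k\<^esub>}. f b) = (\<Oplus>\<^bsub>?k\<^esub>b\<in>{0}. f b)"
      using f residue_field_hcomp_nonzero k.hcomp_carrier
      by (intro k.M.finsum_support) blast+
    then show ?thesis using k.hcomp_carrier[OF f] by simp
  qed
  show "f = g" if "\<And>b. f b \<in> hcomp ?k b" "\<And>b. g b \<in> hcomp ?k b"
    "(\<Oplus>\<^bsub>?k\<^esub>b\<in>{b. f b \<noteq> \<zero>\<^bsub>?k\<^esub>}. f b) = (\<Oplus>\<^bsub>?k\<^esub>b\<in>{b. g b \<noteq> \<zero>\<^bsub>?k\<^esub>}. g b)" for f g
  proof
    fix b
    have "f 0 = g 0" using that sum by metis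
    then show "f b = g b"
      using residue_field_hcomp_nonzero[OF that(1)[of b]] residue_field_hcomp_nonzero[OF that(2)[of b]]
      by (cases "b = 0") simp_all
  qed
qed

definition augmentation :: "(('n::finite, 'k::field) mpoly set \<Rightarrow>\<^sub>0 ('n, 'k) mpoly) \<Rightarrow> ('n, 'k) mpoly set" where
  "augmentation u = residue_class (coord u {})"

lemma augmentation_hom:
  "(augmentation :: _ \<Rightarrow> ('n::finite, 'k::field) mpoly set) \<in> gr_homs (koszul 0) residue_field_module 0"
proof (rule gr_homsI)
  show "(augmentation :: _ \<Rightarrow> ('n, 'k) mpoly set) \<in> module_hom mpoly_ring (koszul 0) residue_field_module"
    by (rule module_homI) (auto simp: augmentation_def residue_field_simps)
  fix b and u :: "('n, 'k) mpoly set \<Rightarrow>\<^sub>0 ('n, 'k) mpoly" assume "u \<in> hcomp (koszul 0) b"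
  then have "coord u {} \<in> poly_comp (b - face_degree {})" by (simp add: koszul_hcomp_iff)
  moreover have "b - face_degree {} = b" by (simp add: face_degree_def fun_eq_iff)
  ultimately show "augmentation u \<in> hcomp residue_field_module (b + 0)"
    by (simp add: augmentation_def residue_field_simps)
qed

lemma koszul_exact:
  assumes u: "u \<in> carrier (koszul i)" and "koszul_d u = 0" "Poly_Mapping.lookup (coord u {}) 0 = 0"
  shows "u \<in> koszul_d ` carrier (koszul (Suc i))"
proof
  show h: "koszul_h u \<in> carrier (koszul (Suc i))" by (rule koszul_h_carrier[OF u])
  show "u = koszul_d (koszul_h u)"
    by (rule coord_ext[OF u koszul_d_carrier[OF h]]) (simp add: koszul_d_h[OF assms(2,3)])
qed

text \<open>
  Exactness is \<open>koszul_exact\<close> in every homological degree: in positive degrees an element has no coordinate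
  at the empty face, so the condition on its constant term is void there.
\<close>

theorem koszul_resolution:
  "gr_free_resolution (residue_field_module :: ('n::finite, 'k::field, ('n, 'k) mpoly set) gr_mod)
    koszul (\<lambda>_. koszul_d) augmentation"
  unfolding gr_free_resolution_def
proof (intro conjI allI)
  show "gr_free (koszul i :: ('n, 'k, ('n, 'k) mpoly set \<Rightarrow>\<^sub>0 ('n, 'k) mpoly) gr_mod)" for i
    by (rule koszul_free)
  show "koszul_d \<in> gr_homs (koszul (Suc i)) (koszul i :: ('n, 'k, ('n, 'k) mpoly set \<Rightarrow>\<^sub>0 ('n, 'k) mpoly) gr_mod) 0" for i
    by (rule koszul_d_hom)
  show "augmentation \<in> gr_homs (koszul 0) (residue_field_module :: ('n, 'k, ('n, 'k) mpoly set) gr_mod) 0"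
    by (rule augmentation_hom)
  have "residue_class p = augmentation (Poly_Mapping.single (label {}) p)" for p :: "('n, 'k) mpoly"
    by (simp add: augmentation_def coord_single)
  moreover have "Poly_Mapping.single (label {}) p \<in> carrier (koszul 0)" for p :: "('n, 'k) mpoly"
    using single_label_carrier[of "{} :: 'n set" p] by simp
  ultimately have "residue_class p \<in> augmentation ` carrier (koszul 0)" for p :: "('n, 'k) mpoly" by blast
  then show "augmentation ` carrier (koszul 0) = carrier (residue_field_module :: ('n, 'k, ('n, 'k) mpoly set) gr_mod)"
    by (auto simp: residue_field_simps augmentation_def)
  have aug: "augmentation u = \<zero>\<^bsub>residue_field_module\<^esub> \<longleftrightarrow> Poly_Mapping.lookup (coord u {}) 0 = 0"
    for u :: "('n, 'k) mpoly set \<Rightarrow>\<^sub>0 ('n, 'k) mpoly"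
    by (simp add: augmentation_def residue_field_simps residue_class_eq)
  have "koszul_d u = 0" if "u \<in> carrier (koszul 0)" for u :: "('n, 'k) mpoly set \<Rightarrow>\<^sub>0 ('n, 'k) mpoly"
    using that unfolding koszul_carrier_iff by (simp add: koszul_d_def of_coord_def)
  moreover have "Poly_Mapping.lookup (coord (koszul_d u) {}) 0 = 0" for u :: "('n, 'k) mpoly set \<Rightarrow>\<^sub>0 ('n, 'k) mpoly"
    by (simp add: coord_koszul_d lookup_sum lookup_ksign_mult lookup_var_mult del: One_nat_def)
  ultimately show "koszul_d ` carrier (koszul 1) = {u \<in> carrier (koszul 0). augmentation u =
      \<zero>\<^bsub>residue_field_module :: ('n, 'k, ('n, 'k) mpoly set) gr_mod\<^esub>}"
    using koszul_exact[of _ 0] koszul_d_carrier[of _ 0] unfolding aug One_nat_def by blast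
  fix i
  have "coord u {} = 0" if "u \<in> carrier (koszul (Suc i))" for u :: "('n, 'k) mpoly set \<Rightarrow>\<^sub>0 ('n, 'k) mpoly"
    using that unfolding koszul_carrier_iff by simp
  then have "Poly_Mapping.lookup (coord u {}) 0 = 0" if "u \<in> carrier (koszul (Suc i))"
    for u :: "('n, 'k) mpoly set \<Rightarrow>\<^sub>0 ('n, 'k) mpoly" using that by simp
  then show "koszul_d ` carrier (koszul (Suc (Suc i))) = {u \<in> carrier (koszul (Suc i)). koszul_d u =
      \<zero>\<^bsub>koszul i :: ('n, 'k, ('n, 'k) mpoly set \<Rightarrow>\<^sub>0 ('n, 'k) mpoly) gr_mod\<^esub>}"
    using koszul_exact[of _ "Suc i"] koszul_d_carrier[of _ "Suc i"] koszul_d_d[of _ i]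
    unfolding koszul_simps(2) by blast
qed

text \<open>
  A resolution picked by the choice operator is one as soon as some resolution of the same type exists,
  and the Koszul complex is such a resolution.
\<close>

lemma chosen_resolution_residue_field:
  assumes "chosen_resolution (residue_field_module :: ('n::finite, 'k::field, ('n, 'k) mpoly set) gr_mod) = (P, d)"
  shows "\<exists>\<epsilon>. gr_free_resolution (residue_field_module :: ('n, 'k, ('n, 'k) mpoly set) gr_mod) P d \<epsilon>"
proof -
  let ?R = "\<lambda>(P :: nat \<Rightarrow> ('n, 'k, ('n, 'k) mpoly set \<Rightarrow>\<^sub>0 ('n, 'k) mpoly) gr_mod, d). \<exists>\<epsilon>. gr_free_resolution (residue_field_module :: ('n, 'k, ('n, 'k) mpoly set) gr_mod) P d \<epsilon>"
  have "?R (koszul, \<lambda>_. koszul_d)" using koszul_resolution by blast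
  then have "?R (Eps ?R)" by (rule someI[of ?R])
  moreover have "Eps ?R = (P, d)" using assms unfolding chosen_resolution_def .
  ultimately show ?thesis by simp
qed

section \<open>Homotopy invariance of homology\<close>

definition chain_complex :: "(nat \<Rightarrow> ('n::finite, 'k::field, 'm) gr_mod) \<Rightarrow> (nat \<Rightarrow> 'm \<Rightarrow> 'm) \<Rightarrow> bool" where
  "chain_complex C d \<longleftrightarrow> (\<forall>i. degreewise_module (C i)) \<and> (\<forall>i. d i \<in> gr_homs (C (Suc i)) (C i) 0) \<and>
     (\<forall>i. \<forall>x \<in> carrier (C (Suc (Suc i))). d i (d (Suc i) x) = \<zero>\<^bsub>C i\<^esub>)"

definition chain_cycles :: "(nat \<Rightarrow> ('n::finite, 'k::field, 'm) gr_mod) \<Rightarrow> (nat \<Rightarrow> 'm \<Rightarrow> 'm) \<Rightarrow> nat \<Rightarrow> 'm set" where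
  "chain_cycles C d i = (case i of 0 \<Rightarrow> carrier (C 0) | Suc j \<Rightarrow> {z \<in> carrier (C (Suc j)). d j z = \<zero>\<^bsub>C j\<^esub>})"

lemma chain_homology_eq:
  "chain_homology C d i = quot_module (sub_module (C i) (chain_cycles C d i)) (d i ` carrier (C (Suc i)))"
  by (simp add: chain_homology_def chain_cycles_def)

lemma chain_complexD:
  assumes "chain_complex C d"
  shows "degreewise_module (C i)" "mpoly_module (C i)" "d i \<in> gr_homs (C (Suc i)) (C i) 0"
    "d i \<in> module_hom mpoly_ring (C (Suc i)) (C i)"
    "x \<in> carrier (C (Suc (Suc i))) \<Longrightarrow> d i (d (Suc i) x) = \<zero>\<^bsub>C i\<^esub>"
  using assms degreewise_module.axioms(1) gr_homsD(1) unfolding chain_complex_def by blast+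

lemma chain_cycles_submodule:
  assumes C: "chain_complex C d"
  shows "submodule mpoly_ring (chain_cycles C d i) (C i)"
proof (cases i)
  case 0
  interpret mpoly_module "C 0" using chain_complexD(2)[OF C] .
  show ?thesis unfolding 0 chain_cycles_def by (auto intro!: submodule.intro mpoly_module)
next
  case (Suc j)
  show ?thesis
    unfolding Suc chain_cycles_def nat.case
    using module_hom_kernel[OF chain_complexD(2)[OF C] chain_complexD(2)[OF C] chain_complexD(4)[OF C]] .
qed

lemma chain_boundaries_submodule:
  assumes C: "chain_complex C d"
  shows "submodule mpoly_ring (d i ` carrier (C (Suc i))) (C i)"
  using module_hom_image[OF chain_complexD(2)[OF C] chain_complexD(2)[OF C] chain_complexD(4)[OF C]] .

lemma chain_boundaries_cycles:
  assumes C: "chain_complex C d"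
  shows "d i ` carrier (C (Suc i)) \<subseteq> chain_cycles C d i"
  using module_homD(1)[OF chain_complexD(4)[OF C]] chain_complexD(5)[OF C]
  by (cases i) (auto simp: chain_cycles_def)

lemma chain_homology_degreewise:
  assumes C: "chain_complex C d" shows "degreewise_module (chain_homology C d i)"
  unfolding chain_homology_eq
  by (intro quot_degreewise sub_degreewise submodule_sub_module chain_complexD(1)[OF C]
    degreewise_module.axioms(1)[OF chain_complexD(1)[OF C], THEN mpoly_module.mpoly_module]
    chain_cycles_submodule[OF C] chain_boundaries_submodule[OF C] chain_boundaries_cycles[OF C])

lemma chain_mapD:
  assumes "chain_map C d D e f"
  shows "f i \<in> gr_homs (C i) (D i) 0" "f i \<in> module_hom mpoly_ring (C i) (D i)"
    "x \<in> carrier (C (Suc i)) \<Longrightarrow> e i (f (Suc i) x) = f i (d i x)"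
  using assms gr_homsD(1) unfolding chain_map_def by blast+

lemma chain_map_cycles:
  assumes C: "chain_complex C d" and D: "chain_complex D e" and f: "chain_map C d D e f"
    and z: "z \<in> chain_cycles C d i"
  shows "f i z \<in> chain_cycles D e i"
  using z module_homD(1)[OF chain_mapD(2)[OF f]] chain_mapD(3)[OF f]
    module_hom_zero_minus(1)[OF chain_complexD(2)[OF C] chain_complexD(2)[OF D] chain_mapD(2)[OF f]]
  by (cases i) (auto simp: chain_cycles_def)

lemma chain_map_boundaries:
  assumes f: "chain_map C d D e f" and z: "z \<in> d i ` carrier (C (Suc i))"
  shows "f i z \<in> e i ` carrier (D (Suc i))"
  using z module_homD(1)[OF chain_mapD(2)[OF f]] chain_mapD(3)[OF f, symmetric] by auto

lemma retraction_on_cycles: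
  assumes C: "chain_complex C d" and h: "retraction_up_to_homotopy C d D e f g h"
    and z: "z \<in> chain_cycles C d i"
  shows "g i (f i z) \<ominus>\<^bsub>C i\<^esub> z \<in> d i ` carrier (C (Suc i))"
proof -
  have hh: "h j \<in> module_hom mpoly_ring (C j) (C (Suc j))" for j
    using h gr_homsD(1) unfolding retraction_up_to_homotopy_def by blast
  have zC: "z \<in> carrier (C i)" using z by (cases i) (auto simp: chain_cycles_def)
  then have "d i (h i z) = g i (f i z) \<ominus>\<^bsub>C i\<^esub> z"
  proof (cases i)
    case 0
    then show ?thesis using h zC unfolding retraction_up_to_homotopy_def by simp
  next
    case (Suc j)
    interpret Cj: mpoly_module "C (Suc j)" using chain_complexD(2)[OF C] .
    have "h j (d j z) = \<zero>\<^bsub>C (Suc j)\<^esub>"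
      using z Suc module_hom_zero_minus(1)[OF chain_complexD(2)[OF C] chain_complexD(2)[OF C] hh]
      by (simp add: chain_cycles_def)
    moreover have "d (Suc j) (h (Suc j) z) \<in> carrier (C (Suc j))"
      using zC Suc module_homD(1)[OF hh] module_homD(1)[OF chain_complexD(4)[OF C]] by blast
    moreover have "d (Suc j) (h (Suc j) z) \<oplus>\<^bsub>C (Suc j)\<^esub> h j (d j z) = g (Suc j) (f (Suc j) z) \<ominus>\<^bsub>C (Suc j)\<^esub> z"
      using h zC Suc unfolding retraction_up_to_homotopy_def by blast
    ultimately show ?thesis using Suc by simp
  qed
  then show ?thesis using module_homD(1)[OF hh zC] by (metis imageI)
qed

text \<open>
  The two chain maps are inverse to each other on cycles modulo boundaries.
\<close>

theorem chain_homology_dim_eq: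
  assumes C: "chain_complex C d" and D: "chain_complex D e"
    and f: "chain_map C d D e f" and g: "chain_map D e C d g"
    and h: "retraction_up_to_homotopy C d D e f g h" and h': "retraction_up_to_homotopy D e C d g f h'"
  shows "hcomp_dim (chain_homology C d i) b = hcomp_dim (chain_homology D e i) b"
  unfolding chain_homology_eq
proof (rule hcomp_dim_quot_eq[where \<phi> = "f i" and \<psi> = "g i"])
  note CD = chain_cycles_submodule chain_boundaries_submodule chain_boundaries_cycles
  note cycles_C = submodule.subset[OF chain_cycles_submodule[OF C], THEN subsetD]
  show "f i z \<in> chain_cycles D e i \<inter> hcomp (D i) b" if "z \<in> chain_cycles C d i" "z \<in> hcomp (C i) b" for z
    using chain_map_cycles[OF C D f that(1)] gr_homs_0D[OF chain_mapD(1)[OF f] that(2)] by blast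
  show "g i z \<in> chain_cycles C d i \<inter> hcomp (C i) b" if "z \<in> chain_cycles D e i" "z \<in> hcomp (D i) b" for z
    using chain_map_cycles[OF D C g that(1)] gr_homs_0D[OF chain_mapD(1)[OF g] that(2)] by blast
  show "f i (z \<oplus>\<^bsub>C i\<^esub> w) = f i z \<oplus>\<^bsub>D i\<^esub> f i w"
    if "z \<in> chain_cycles C d i" "w \<in> chain_cycles C d i" for z w
    using module_homD(2)[OF chain_mapD(2)[OF f]] that cycles_C by blast
  show "f i (const c \<odot>\<^bsub>C i\<^esub> z) = const c \<odot>\<^bsub>D i\<^esub> f i z" if "z \<in> chain_cycles C d i" for z c
    using module_homD(3)[OF chain_mapD(2)[OF f]] that cycles_C by blast
  show "f i z \<in> e i ` carrier (D (Suc i))" if "z \<in> d i ` carrier (C (Suc i))" for z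
    using chain_map_boundaries[OF f that] .
  show "g i z \<in> d i ` carrier (C (Suc i))" if "z \<in> e i ` carrier (D (Suc i))" for z
    using chain_map_boundaries[OF g that] .
  show "g i (f i z) \<ominus>\<^bsub>C i\<^esub> z \<in> d i ` carrier (C (Suc i))" if "z \<in> chain_cycles C d i" for z
    using retraction_on_cycles[OF C h that] .
  show "f i (g i z) \<ominus>\<^bsub>D i\<^esub> z \<in> e i ` carrier (D (Suc i))" if "z \<in> chain_cycles D e i" for z
    using retraction_on_cycles[OF D h' that] .
qed (use C D in \<open>auto intro: chain_complexD(1) chain_cycles_submodule chain_boundaries_submodule
    chain_boundaries_cycles[THEN subsetD]\<close>)

section \<open>Linear extension\<close>

text \<open>
  The homomorphism from the free module on a set to \<open>Q\<close> that is prescribed on the basis by \<open>\<phi>\<close>.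
\<close>

definition linear_extension ::
    "(('n::finite, 'k::field) mpoly, 'q, 'x) module_scheme \<Rightarrow> ('a \<Rightarrow> 'q) \<Rightarrow> ('a \<Rightarrow>\<^sub>0 ('n, 'k) mpoly) \<Rightarrow> 'q" where
  "linear_extension Q \<phi> u = (\<Oplus>\<^bsub>Q\<^esub>a\<in>Poly_Mapping.keys u. Poly_Mapping.lookup u a \<odot>\<^bsub>Q\<^esub> \<phi> a)"

lemma module_hom_finsum:
  fixes M :: "(('n::finite, 'k::field) mpoly, 'm, 'x) module_scheme"
    and N :: "(('n::finite, 'k::field) mpoly, 'p, 'y) module_scheme"
  assumes M: "mpoly_module M" and N: "mpoly_module N" and f: "f \<in> module_hom mpoly_ring M N"
    and g: "\<And>i. i \<in> A \<Longrightarrow> g i \<in> carrier M"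
  shows "f (\<Oplus>\<^bsub>M\<^esub>i\<in>A. g i) = (\<Oplus>\<^bsub>N\<^esub>i\<in>A. f (g i))"
proof -
  interpret M: mpoly_module M by fact
  interpret N: mpoly_module N by fact
  show ?thesis
    using g
  proof (induction A rule: infinite_finite_induct)
    case (insert i A)
    then show ?case by (simp add: Pi_def module_homD[OF f] M.finsum_closed)
  qed (simp_all add: module_hom_zero_minus(1)[OF M N f])
qed

context support_module
begin

lemma diff_in: "\<lbrakk>u \<in> carrier M; v \<in> carrier M\<rbrakk> \<Longrightarrow> u - v \<in> carrier M"
  by (auto simp: carrier_iff lookup_minus)

context
  fixes Q :: "(('n, 'k) mpoly, 'q, 'y) module_scheme" and \<phi> :: "'m \<Rightarrow> 'q"
  assumes Q: "mpoly_module Q" and phi: "\<And>a. a \<in> S \<Longrightarrow> \<phi> a \<in> carrier Q"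
begin

interpretation Q: mpoly_module Q by (rule Q)

lemma linear_extension_superset:
  assumes "finite U" "Poly_Mapping.keys u \<subseteq> U" "U \<subseteq> S"
  shows "linear_extension Q \<phi> u = (\<Oplus>\<^bsub>Q\<^esub>a\<in>U. Poly_Mapping.lookup u a \<odot>\<^bsub>Q\<^esub> \<phi> a)"
  unfolding linear_extension_def
  by (rule Q.add.finprod_mono_neutral_cong_left) (use assms phi in \<open>auto simp: in_keys_iff subset_iff\<close>)

lemma linear_extension_hom: "linear_extension Q \<phi> \<in> module_hom mpoly_ring M Q"
proof (rule module_homI)
  have in_S: "a \<in> S" if "u \<in> carrier M" "a \<in> Poly_Mapping.keys u" for u a
    using that by (auto simp: carrier_eq)
  show "linear_extension Q \<phi> u \<in> carrier Q" if "u \<in> carrier M" for u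
    unfolding linear_extension_def using in_S[OF that] phi by (intro Q.finsum_closed) auto
  show "linear_extension Q \<phi> (u \<oplus> v) = linear_extension Q \<phi> u \<oplus>\<^bsub>Q\<^esub> linear_extension Q \<phi> v"
    if u: "u \<in> carrier M" and v: "v \<in> carrier M" for u v
  proof -
    let ?U = "Poly_Mapping.keys u \<union> Poly_Mapping.keys v"
    have U: "finite ?U" "?U \<subseteq> S" "Poly_Mapping.keys (u + v) \<subseteq> ?U"
      using in_S[OF u] in_S[OF v] keys_add[of u v] by auto
    have P: "a \<in> ?U \<Longrightarrow> \<phi> a \<in> carrier Q" for a using U(2) phi by blast
    have "linear_extension Q \<phi> (u \<oplus> v) = (\<Oplus>\<^bsub>Q\<^esub>a\<in>?U. Poly_Mapping.lookup (u + v) a \<odot>\<^bsub>Q\<^esub> \<phi> a)"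
      unfolding add_eq by (rule linear_extension_superset[OF U(1,3,2)])
    also have "\<dots> = (\<Oplus>\<^bsub>Q\<^esub>a\<in>?U. Poly_Mapping.lookup u a \<odot>\<^bsub>Q\<^esub> \<phi> a \<oplus>\<^bsub>Q\<^esub> Poly_Mapping.lookup v a \<odot>\<^bsub>Q\<^esub> \<phi> a)"
      using P by (intro Q.finsum_cong') (auto simp: lookup_add Q.smult_plus)
    also have "\<dots> = linear_extension Q \<phi> u \<oplus>\<^bsub>Q\<^esub> linear_extension Q \<phi> v"
      using P linear_extension_superset[OF U(1) _ U(2), of u] linear_extension_superset[OF U(1) _ U(2), of v]
      by (subst Q.finsum_addf) auto
    finally show ?thesis .
  qed
  show "linear_extension Q \<phi> (s \<odot> u) = s \<odot>\<^bsub>Q\<^esub> linear_extension Q \<phi> u" if u: "u \<in> carrier M" for s u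
  proof -
    let ?U = "Poly_Mapping.keys u"
    have U: "finite ?U" "?U \<subseteq> S" using in_S[OF u] by auto
    have P: "a \<in> ?U \<Longrightarrow> \<phi> a \<in> carrier Q" for a using U(2) phi by blast
    have "linear_extension Q \<phi> (s \<odot> u) = (\<Oplus>\<^bsub>Q\<^esub>a\<in>?U. (s * Poly_Mapping.lookup u a) \<odot>\<^bsub>Q\<^esub> \<phi> a)"
      unfolding smult_eq using linear_extension_superset[OF U(1) keys_map_times U(2), of s]
      by (simp add: lookup_map_times)
    also have "\<dots> = (\<Oplus>\<^bsub>Q\<^esub>a\<in>?U. s \<odot>\<^bsub>Q\<^esub> (Poly_Mapping.lookup u a \<odot>\<^bsub>Q\<^esub> \<phi> a))"
      using P by (intro Q.finsum_cong') (auto simp: Q.smult_mult)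
    also have "\<dots> = s \<odot>\<^bsub>Q\<^esub> linear_extension Q \<phi> u"
      unfolding linear_extension_def using P by (intro Q.finsum_smult_ldistr[symmetric]) auto
    finally show ?thesis .
  qed
qed

lemma linear_extension_single: "a \<in> S \<Longrightarrow> linear_extension Q \<phi> (Poly_Mapping.single a s) = s \<odot>\<^bsub>Q\<^esub> \<phi> a"
  using linear_extension_superset[of "{a}" "Poly_Mapping.single a s"] phi[of a] by simp

end

lemma decompose: "u \<in> carrier M \<Longrightarrow> u = (\<Oplus>a\<in>Poly_Mapping.keys u. Poly_Mapping.lookup u a \<odot> Poly_Mapping.single a 1)"
proof -
  assume u: "u \<in> carrier M"
  have s: "Poly_Mapping.lookup u a \<odot> Poly_Mapping.single a 1 = Poly_Mapping.single a (Poly_Mapping.lookup u a)" for a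
    by (rule poly_mapping_eqI) (simp add: smult_eq lookup_map_times lookup_single when_def)
  have "(\<Oplus>a\<in>Poly_Mapping.keys u. Poly_Mapping.lookup u a \<odot> Poly_Mapping.single a 1) =
      (\<Sum>a\<in>Poly_Mapping.keys u. Poly_Mapping.single a (Poly_Mapping.lookup u a))"
    unfolding s using u by (intro finsum_eq_sum) (auto simp: carrier_eq split: if_splits)
  also have "\<dots> = u"
  proof (rule poly_mapping_eqI)
    fix b
    have "Poly_Mapping.lookup (\<Sum>a\<in>Poly_Mapping.keys u. Poly_Mapping.single a (Poly_Mapping.lookup u a)) b =
        (\<Sum>a\<in>Poly_Mapping.keys u. if a = b then Poly_Mapping.lookup u b else 0)"
      unfolding lookup_sum by (intro sum.cong) (auto simp: lookup_single when_def)
    also have "\<dots> = Poly_Mapping.lookup u b" by (auto simp: in_keys_iff)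
    finally show "Poly_Mapping.lookup (\<Sum>a\<in>Poly_Mapping.keys u. Poly_Mapping.single a (Poly_Mapping.lookup u a)) b =
        Poly_Mapping.lookup u b" .
  qed
  finally show ?thesis ..
qed

lemma hom_eqI:
  assumes "mpoly_module Q" and f: "f \<in> module_hom mpoly_ring M Q" and g: "g \<in> module_hom mpoly_ring M Q"
    and eq: "\<And>a. a \<in> S \<Longrightarrow> f (Poly_Mapping.single a 1) = g (Poly_Mapping.single a 1)"
    and u: "u \<in> carrier M"
  shows "f u = g u"
proof (rule module_hom_eq_span[OF mpoly_module_axioms assms(1) f g, of "(\<lambda>a. Poly_Mapping.single a 1) ` S"])
  show "(\<lambda>a. Poly_Mapping.single a 1) ` S \<subseteq> carrier M" by (auto simp: carrier_eq)
  let ?B = "(\<lambda>a. Poly_Mapping.single a (1 :: ('n, 'k) mpoly)) ` Poly_Mapping.keys u"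
  have inj: "inj_on (\<lambda>a. Poly_Mapping.single a (1 :: ('n, 'k) mpoly)) (Poly_Mapping.keys u)"
    by (rule inj_onI) (auto dest!: arg_cong[of _ _ Poly_Mapping.keys])
  define c where "c e = Poly_Mapping.lookup u (the_elem (Poly_Mapping.keys e))"
    for e :: "'m \<Rightarrow>\<^sub>0 ('n, 'k) mpoly"
  have car: "Poly_Mapping.single a 1 \<in> carrier M" if "a \<in> Poly_Mapping.keys u" for a
    using u that by (auto simp: carrier_eq)
  have "lincomb c ?B = (\<Oplus>a\<in>Poly_Mapping.keys u. c (Poly_Mapping.single a 1) \<odot> Poly_Mapping.single a 1)"
    unfolding lincomb_def using car inj by (intro M.add.finprod_reindex) auto
  then have "lincomb c ?B = u" using decompose[OF u] by (simp add: c_def)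
  moreover have "?B \<subseteq> (\<lambda>a. Poly_Mapping.single a 1) ` S" using u by (auto simp: carrier_eq)
  ultimately show "u \<in> span ((\<lambda>a. Poly_Mapping.single a 1) ` S)"
    unfolding span_def by (intro CollectI exI[of _ c] exI[of _ ?B]) auto
qed (use eq in auto)

end

section \<open>The tensor product\<close>

locale tensor_product = M: degreewise_module M + N: degreewise_module N
  for M :: "('n::finite, 'k::field, 'm) gr_mod" and N :: "('n, 'k, 'p) gr_mod"
begin

sublocale pairs: support_module "pair_module M N" "carrier M \<times> carrier N"
  by unfold_locales (auto simp: pair_module_def)

abbreviation tensor_class :: "(('m \<times> 'p) \<Rightarrow>\<^sub>0 ('n, 'k) mpoly) \<Rightarrow> (('m \<times> 'p) \<Rightarrow>\<^sub>0 ('n, 'k) mpoly) set" where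
  "tensor_class x \<equiv> tensor_null M N +>\<^bsub>pair_module M N\<^esub> x"

abbreviation pure_tensor :: "'m \<Rightarrow> 'p \<Rightarrow> (('m \<times> 'p) \<Rightarrow>\<^sub>0 ('n, 'k) mpoly) set" where
  "pure_tensor m n \<equiv> tensor_class (pair m n)"

lemma pair_carrier: "\<lbrakk>m \<in> carrier M; n \<in> carrier N\<rbrakk> \<Longrightarrow> pair m n \<in> carrier (pair_module M N)"
  by (simp add: pair_def pairs.carrier_eq)

lemma relations_carrier: "bilinear_relations M N \<subseteq> carrier (pair_module M N)"
  unfolding bilinear_relations_def by (auto intro!: pairs.diff_in pair_carrier pairs.smult_in)

lemma null_submodule: "submodule mpoly_ring (tensor_null M N) (pair_module M N)"
  unfolding tensor_null_def by (rule pairs.span_is_submodule[OF relations_carrier])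

lemma pair_module_hcomp_iff: "x \<in> hcomp (pair_module M N) b \<longleftrightarrow>
    (\<forall>m n. Poly_Mapping.lookup x (m, n) \<in> poly_comp 0 \<and>
      (Poly_Mapping.lookup x (m, n) \<noteq> 0 \<longrightarrow> (\<exists>c. m \<in> hcomp M c \<and> n \<in> hcomp N (b - c))))"
proof -
  have "x \<in> hcomp (pair_module M N) b \<longleftrightarrow> (\<forall>m n. Poly_Mapping.lookup x (m, n) \<noteq> 0 \<longrightarrow>
      (\<exists>c. m \<in> hcomp M c \<and> n \<in> hcomp N (b - c)) \<and> Poly_Mapping.lookup x (m, n) \<in> poly_comp 0)"
    by (simp add: pair_module_def in_keys_iff Ball_def)
  also have "\<dots> \<longleftrightarrow> (\<forall>m n. Poly_Mapping.lookup x (m, n) \<in> poly_comp 0 \<and>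
      (Poly_Mapping.lookup x (m, n) \<noteq> 0 \<longrightarrow> (\<exists>c. m \<in> hcomp M c \<and> n \<in> hcomp N (b - c))))"
  proof (intro iff_allI)
    fix m n
    show "(Poly_Mapping.lookup x (m, n) \<noteq> 0 \<longrightarrow>
        (\<exists>c. m \<in> hcomp M c \<and> n \<in> hcomp N (b - c)) \<and> Poly_Mapping.lookup x (m, n) \<in> poly_comp 0) \<longleftrightarrow>
      Poly_Mapping.lookup x (m, n) \<in> poly_comp 0 \<and>
      (Poly_Mapping.lookup x (m, n) \<noteq> 0 \<longrightarrow> (\<exists>c. m \<in> hcomp M c \<and> n \<in> hcomp N (b - c)))"
      by (cases "Poly_Mapping.lookup x (m, n) = 0") (simp_all add: poly_comp_zero conj_commute)
  qed
  finally show ?thesis .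
qed

lemma pair_module_degreewise: "degreewise_module (pair_module M N)"
proof (intro degreewise_module.intro degreewise_module_axioms.intro)
  show "mpoly_module (pair_module M N)" by (rule pairs.mpoly_module_axioms)
  show "x \<in> carrier (pair_module M N)" if "x \<in> hcomp (pair_module M N) b" for x b
    using that M.hcomp_carrier N.hcomp_carrier
    unfolding pair_module_hcomp_iff pairs.carrier_eq by (fastforce simp: in_keys_iff)
  show "x \<oplus>\<^bsub>pair_module M N\<^esub> y \<in> hcomp (pair_module M N) b"
    if "x \<in> hcomp (pair_module M N) b" "y \<in> hcomp (pair_module M N) b" for x y b
    using that unfolding pair_module_hcomp_iff pairs.add_eq lookup_add
    by (metis add_0 poly_comp_add)
  show "const c \<odot>\<^bsub>pair_module M N\<^esub> x \<in> hcomp (pair_module M N) b"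
    if "x \<in> hcomp (pair_module M N) b" for x c b
    using that unfolding pair_module_hcomp_iff pairs.smult_eq lookup_map_times
    by (metis mult_zero_right poly_comp_const_mult)
qed (simp add: pair_module_hcomp_iff pairs.zero_eq poly_comp_zero)

lemma tensor_degreewise: "degreewise_module (tensor_module M N)"
  unfolding tensor_module_def by (rule quot_degreewise[OF pair_module_degreewise null_submodule])

sublocale tensor: degreewise_module "tensor_module M N"
  by (rule tensor_degreewise)

lemma tensor_simps:
  "carrier (tensor_module M N) = tensor_class ` carrier (pair_module M N)"
  "\<zero>\<^bsub>tensor_module M N\<^esub> = tensor_class 0"
  "\<lbrakk>x \<in> carrier (pair_module M N); y \<in> carrier (pair_module M N)\<rbrakk> \<Longrightarrow>
    tensor_class x \<oplus>\<^bsub>tensor_module M N\<^esub> tensor_class y = tensor_class (x + y)"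
  "x \<in> carrier (pair_module M N) \<Longrightarrow>
    s \<odot>\<^bsub>tensor_module M N\<^esub> tensor_class x = tensor_class (s \<odot>\<^bsub>pair_module M N\<^esub> x)"
  "hcomp (tensor_module M N) b = tensor_class ` hcomp (pair_module M N) b"
  using quot_module_ops[OF pairs.is_module null_submodule, of x]
    quot_module_zero[OF pairs.is_module null_submodule]
    quot_module_carrier[OF pairs.is_module null_submodule]
    quot_module_hcomp[OF pairs.is_module null_submodule]
  by (simp_all add: tensor_module_def pairs.zero_eq pairs.add_eq)

lemma tensor_class_eq_iff:
  "\<lbrakk>x \<in> carrier (pair_module M N); y \<in> carrier (pair_module M N)\<rbrakk> \<Longrightarrow>
    tensor_class x = tensor_class y \<longleftrightarrow> x - y \<in> tensor_null M N"
  using coset_eq_iff[OF pairs.is_module null_submodule] by (simp add: pairs.minus_eq_diff)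

lemma tensor_class_hom: "tensor_class \<in> module_hom mpoly_ring (pair_module M N) (tensor_module M N)"
  by (rule module_homI) (auto simp: tensor_simps pairs.add_eq)

lemma relation_null: "x - y - z \<in> bilinear_relations M N \<Longrightarrow> x - y - z \<in> tensor_null M N"
  unfolding tensor_null_def using pairs.in_own_span[OF relations_carrier] by blast

lemma pure_tensor_carrier: "\<lbrakk>m \<in> carrier M; n \<in> carrier N\<rbrakk> \<Longrightarrow> pure_tensor m n \<in> carrier (tensor_module M N)"
  by (simp add: tensor_simps pair_carrier)

lemma pure_tensor_add_left:
  assumes "m \<in> carrier M" "m' \<in> carrier M" "n \<in> carrier N"
  shows "pure_tensor (m \<oplus>\<^bsub>M\<^esub> m') n = pure_tensor m n \<oplus>\<^bsub>tensor_module M N\<^esub> pure_tensor m' n"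
proof -
  have "pair (m \<oplus>\<^bsub>M\<^esub> m') n - pair m n - pair m' n \<in> tensor_null M N"
    by (rule relation_null) (use assms in \<open>auto simp: bilinear_relations_def\<close>)
  then show ?thesis
    using assms pair_carrier pairs.a_closed[of "pair m n" "pair m' n"]
    by (simp add: tensor_simps tensor_class_eq_iff pairs.add_eq diff_diff_eq)
qed

lemma pure_tensor_add_right:
  assumes "m \<in> carrier M" "n \<in> carrier N" "n' \<in> carrier N"
  shows "pure_tensor m (n \<oplus>\<^bsub>N\<^esub> n') = pure_tensor m n \<oplus>\<^bsub>tensor_module M N\<^esub> pure_tensor m n'"
proof -
  have "pair m (n \<oplus>\<^bsub>N\<^esub> n') - pair m n - pair m n' \<in> tensor_null M N"
    by (rule relation_null) (use assms in \<open>auto simp: bilinear_relations_def\<close>)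
  then show ?thesis
    using assms pair_carrier pairs.a_closed[of "pair m n" "pair m n'"]
    by (simp add: tensor_simps tensor_class_eq_iff pairs.add_eq diff_diff_eq)
qed

lemma pure_tensor_smult_left:
  assumes "m \<in> carrier M" "n \<in> carrier N"
  shows "pure_tensor (s \<odot>\<^bsub>M\<^esub> m) n = s \<odot>\<^bsub>tensor_module M N\<^esub> pure_tensor m n"
proof -
  have "pair (s \<odot>\<^bsub>M\<^esub> m) n - s \<odot>\<^bsub>pair_module M N\<^esub> pair m n \<in> bilinear_relations M N"
    using assms by (auto simp: bilinear_relations_def)
  then have "pair (s \<odot>\<^bsub>M\<^esub> m) n - s \<odot>\<^bsub>pair_module M N\<^esub> pair m n \<in> tensor_null M N"
    unfolding tensor_null_def using pairs.in_own_span[OF relations_carrier] by blast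
  then show ?thesis
    using assms pair_carrier by (simp add: tensor_simps tensor_class_eq_iff)
qed

lemma pure_tensor_smult_right:
  assumes "m \<in> carrier M" "n \<in> carrier N"
  shows "pure_tensor m (s \<odot>\<^bsub>N\<^esub> n) = s \<odot>\<^bsub>tensor_module M N\<^esub> pure_tensor m n"
proof -
  have "pair m (s \<odot>\<^bsub>N\<^esub> n) - s \<odot>\<^bsub>pair_module M N\<^esub> pair m n \<in> bilinear_relations M N"
    using assms by (auto simp: bilinear_relations_def)
  then have "pair m (s \<odot>\<^bsub>N\<^esub> n) - s \<odot>\<^bsub>pair_module M N\<^esub> pair m n \<in> tensor_null M N"
    unfolding tensor_null_def using pairs.in_own_span[OF relations_carrier] by blast
  then show ?thesis
    using assms pair_carrier by (simp add: tensor_simps tensor_class_eq_iff)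
qed

lemma pure_tensor_hom_left:
  "n \<in> carrier N \<Longrightarrow> (\<lambda>m. pure_tensor m n) \<in> module_hom mpoly_ring M (tensor_module M N)"
  by (rule module_homI) (simp_all add: pure_tensor_carrier pure_tensor_add_left pure_tensor_smult_left)

lemma pure_tensor_hom_right:
  "m \<in> carrier M \<Longrightarrow> (\<lambda>n. pure_tensor m n) \<in> module_hom mpoly_ring N (tensor_module M N)"
  by (rule module_homI) (simp_all add: pure_tensor_carrier pure_tensor_add_right pure_tensor_smult_right)

lemma pure_tensor_hcomp:
  assumes "m \<in> hcomp M a" "n \<in> hcomp N b"
  shows "pure_tensor m n \<in> hcomp (tensor_module M N) (a + b)"
proof -
  have "pair m n \<in> hcomp (pair_module M N) (a + b)"
    using assms const_poly_comp[of 1] unfolding pair_module_hcomp_iff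
    by (auto simp: pair_def lookup_single when_def poly_comp_zero intro!: exI[of _ a])
  then show ?thesis by (simp add: tensor_simps)
qed

text \<open>
  Pure tensors generate the tensor product. All identities between maps out of tensor products
  are verified in this way.
\<close>

lemma tensor_hom_eqI:
  assumes Q: "mpoly_module Q" and f: "f \<in> module_hom mpoly_ring (tensor_module M N) Q"
    and g: "g \<in> module_hom mpoly_ring (tensor_module M N) Q"
    and eq: "\<And>m n. \<lbrakk>m \<in> carrier M; n \<in> carrier N\<rbrakk> \<Longrightarrow> f (pure_tensor m n) = g (pure_tensor m n)"
    and z: "z \<in> carrier (tensor_module M N)"
  shows "f z = g z"
proof -
  obtain x where x: "x \<in> carrier (pair_module M N)" "z = tensor_class x" using z by (auto simp: tensor_simps)
  have comp: "(\<lambda>x. h (tensor_class x)) \<in> module_hom mpoly_ring (pair_module M N) Q"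
    if "h \<in> module_hom mpoly_ring (tensor_module M N) Q" for h
    using module_homD[OF that] module_homD[OF tensor_class_hom] by (intro module_homI) simp_all
  have "f (tensor_class x) = g (tensor_class x)"
    by (rule pairs.hom_eqI[OF Q comp[OF f] comp[OF g] _ x(1)]) (use eq in \<open>auto simp: pair_def\<close>)
  then show ?thesis using x by simp
qed

end

text \<open>The map \<open>lift\<close> constructed here gives the universal property of the tensor product.\<close>

locale bilinear_map = tensor_product M N + Q: mpoly_module Q
  for M :: "('n::finite, 'k::field, 'm) gr_mod" and N :: "('n, 'k, 'p) gr_mod"
    and Q :: "(('n, 'k) mpoly, 'q, 'x) module_scheme" +
  fixes \<phi> :: "'m \<Rightarrow> 'p \<Rightarrow> 'q"
  assumes left: "n \<in> carrier N \<Longrightarrow> (\<lambda>m. \<phi> m n) \<in> module_hom mpoly_ring M Q"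
    and right: "m \<in> carrier M \<Longrightarrow> (\<lambda>n. \<phi> m n) \<in> module_hom mpoly_ring N Q"
begin

lemma in_Q: "p \<in> carrier M \<times> carrier N \<Longrightarrow> case_prod \<phi> p \<in> carrier Q"
  using module_homD(1)[OF left] by auto

abbreviation ext :: "(('m \<times> 'p) \<Rightarrow>\<^sub>0 ('n, 'k) mpoly) \<Rightarrow> 'q" where
  "ext \<equiv> linear_extension Q (case_prod \<phi>)"

lemma ext_hom: "ext \<in> module_hom mpoly_ring (pair_module M N) Q"
  using Q.mpoly_module_axioms in_Q by (rule pairs.linear_extension_hom)

lemma ext_pair: "\<lbrakk>m \<in> carrier M; n \<in> carrier N\<rbrakk> \<Longrightarrow> ext (pair m n) = \<phi> m n"
  using pairs.linear_extension_single[OF Q.mpoly_module_axioms in_Q, where a = "(m, n)" and s = 1] in_Q[of "(m, n)"]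
  by (simp add: pair_def)

text \<open>
  The elements that the extension sends to zero form a submodule, so it suffices to check the generating
  relations, which express exactly that \<open>\<phi>\<close> is bilinear.
\<close>

lemma ext_null: "x \<in> tensor_null M N \<Longrightarrow> ext x = \<zero>\<^bsub>Q\<^esub>"
proof -
  note minus = module_hom_zero_minus(2)[OF pairs.mpoly_module_axioms Q.mpoly_module_axioms ext_hom]
  have ext_minus: "ext (x - y) = ext x \<ominus>\<^bsub>Q\<^esub> ext y"
    if "x \<in> carrier (pair_module M N)" "y \<in> carrier (pair_module M N)" for x y
    using minus[OF that] that by (simp add: pairs.minus_eq_diff)
  have cancel: "u \<oplus>\<^bsub>Q\<^esub> v \<ominus>\<^bsub>Q\<^esub> u \<ominus>\<^bsub>Q\<^esub> v = \<zero>\<^bsub>Q\<^esub>" if "u \<in> carrier Q" "v \<in> carrier Q" for u v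
    using that by (simp add: a_minus_def Q.a_assoc Q.a_comm[of v] Q.r_neg1 Q.r_neg2 Q.a_lcomm[of v] Q.r_neg)
  have L: "\<phi> m n \<in> carrier Q" if "m \<in> carrier M" "n \<in> carrier N" for m n
    using that in_Q[of "(m, n)"] by simp
  have "ext r = \<zero>\<^bsub>Q\<^esub>" if "r \<in> bilinear_relations M N" for r
    using that unfolding bilinear_relations_def
    by (auto simp: ext_minus pairs.diff_in pair_carrier ext_pair module_homD[OF left] module_homD[OF right]
        module_homD(3)[OF ext_hom] cancel L Q.minus_self)
  then have "bilinear_relations M N \<subseteq> {x \<in> carrier (pair_module M N). ext x = \<zero>\<^bsub>Q\<^esub>}"
    using relations_carrier by blast
  then have "tensor_null M N \<subseteq> {x \<in> carrier (pair_module M N). ext x = \<zero>\<^bsub>Q\<^esub>}"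
    unfolding tensor_null_def
    by (rule pairs.span_is_subset[OF _ module_hom_kernel[OF pairs.mpoly_module_axioms Q.mpoly_module_axioms ext_hom]])
  then show "x \<in> tensor_null M N \<Longrightarrow> ext x = \<zero>\<^bsub>Q\<^esub>" by blast
qed

definition lift :: "(('m \<times> 'p) \<Rightarrow>\<^sub>0 ('n, 'k) mpoly) set \<Rightarrow> 'q" where
  "lift C = (THE q. \<exists>x \<in> carrier (pair_module M N). C = tensor_class x \<and> q = ext x)"

lemma lift_class: "x \<in> carrier (pair_module M N) \<Longrightarrow> lift (tensor_class x) = ext x"
proof -
  assume x: "x \<in> carrier (pair_module M N)"
  have "ext y = ext x" if y: "y \<in> carrier (pair_module M N)" "tensor_class x = tensor_class y" for y
  proof -
    have "ext (y \<ominus>\<^bsub>pair_module M N\<^esub> x) = \<zero>\<^bsub>Q\<^esub>"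
      using tensor_class_eq_iff[OF y(1) x] y x ext_null by (simp add: pairs.minus_eq_diff)
    then show ?thesis
      using module_hom_zero_minus(2)[OF pairs.mpoly_module_axioms Q.mpoly_module_axioms ext_hom y(1) x]
        Q.minus_zero_iff module_homD(1)[OF ext_hom] x y by simp
  qed
  then show ?thesis unfolding lift_def using x by (intro the_equality) blast+
qed

lemma lift_hom: "lift \<in> module_hom mpoly_ring (tensor_module M N) Q"
  by (rule module_homI)
    (auto simp: tensor_simps(1,3,4) lift_class module_homD[OF ext_hom] simp flip: pairs.add_eq)

lemma lift_pure: "\<lbrakk>m \<in> carrier M; n \<in> carrier N\<rbrakk> \<Longrightarrow> lift (pure_tensor m n) = \<phi> m n"
  by (simp add: lift_class pair_carrier ext_pair)

end

section \<open>Functoriality of the tensor product\<close>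

locale tensor_functor = T: tensor_product M N + T': tensor_product M' N
  for M :: "('n::finite, 'k::field, 'm) gr_mod" and M' :: "('n, 'k, 'q) gr_mod" and N :: "('n, 'k, 'p) gr_mod" +
  fixes f
  assumes hom: "f \<in> module_hom mpoly_ring M M'"
begin

sublocale b: bilinear_map M N "tensor_module M' N" "\<lambda>m n. T'.pure_tensor (f m) n"
proof unfold_locales
  fix n assume "n \<in> carrier N"
  then show "(\<lambda>m. T'.pure_tensor (f m) n) \<in> module_hom mpoly_ring M (tensor_module M' N)"
    using module_homD[OF hom] module_homD[OF T'.pure_tensor_hom_left[of n]] by (intro module_homI) simp_all
next
  fix m assume "m \<in> carrier M"
  then show "(\<lambda>n. T'.pure_tensor (f m) n) \<in> module_hom mpoly_ring N (tensor_module M' N)"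
    using T'.pure_tensor_hom_right module_homD(1)[OF hom] by blast
qed

abbreviation push :: "(('m \<times> 'p) \<Rightarrow>\<^sub>0 ('n, 'k) mpoly) \<Rightarrow> (('q \<times> 'p) \<Rightarrow>\<^sub>0 ('n, 'k) mpoly)" where
  "push x \<equiv> \<Sum>(m, n)\<in>Poly_Mapping.keys x. Poly_Mapping.single (f m, n) (Poly_Mapping.lookup x (m, n))"

lemma push_carrier:
  assumes x: "x \<in> carrier (pair_module M N)"
  shows "push x \<in> carrier (pair_module M' N)" and "T'.tensor_class (push x) = b.ext x"
proof -
  have k: "\<And>m n. (m, n) \<in> Poly_Mapping.keys x \<Longrightarrow> f m \<in> carrier M' \<and> n \<in> carrier N"
    using x module_homD(1)[OF hom] unfolding T.pairs.carrier_eq by blast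
  have s: "Poly_Mapping.single (f m, n) (Poly_Mapping.lookup x (m, n)) =
      Poly_Mapping.lookup x (m, n) \<odot>\<^bsub>pair_module M' N\<^esub> pair (f m) n" for m n
    by (rule poly_mapping_eqI) (simp add: pair_def T'.pairs.smult_eq lookup_map_times lookup_single when_def)
  have car: "(case p of (m, n) \<Rightarrow> Poly_Mapping.single (f m, n) (Poly_Mapping.lookup x (m, n)))
      \<in> carrier (pair_module M' N)" if "p \<in> Poly_Mapping.keys x" for p
    using k that unfolding s by (cases p) (auto intro!: T'.pair_carrier)
  then show "push x \<in> carrier (pair_module M' N)" by (rule T'.pairs.sum_carrier)
  have "push x = (\<Oplus>\<^bsub>pair_module M' N\<^esub>p\<in>Poly_Mapping.keys x.
      case p of (m, n) \<Rightarrow> Poly_Mapping.single (f m, n) (Poly_Mapping.lookup x (m, n)))"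
    using car by (rule T'.pairs.finsum_eq_sum[symmetric])
  then have "T'.tensor_class (push x) = (\<Oplus>\<^bsub>tensor_module M' N\<^esub>p\<in>Poly_Mapping.keys x.
      T'.tensor_class (case p of (m, n) \<Rightarrow> Poly_Mapping.single (f m, n) (Poly_Mapping.lookup x (m, n))))"
    using module_hom_finsum[OF T'.pairs.mpoly_module_axioms T'.tensor.mpoly_module_axioms T'.tensor_class_hom car]
    by simp
  also have "\<dots> = b.ext x"
    unfolding linear_extension_def
    using k T'.pure_tensor_carrier by (intro T'.tensor.finsum_cong') (auto simp: s T'.tensor_simps(4) T'.pair_carrier)
  finally show "T'.tensor_class (push x) = b.ext x" .
qed

text \<open>
  The induced map is defined as a union over the representatives of a coset. All representatives contribute
  the same coset, the value at the coset of the bilinear map \<open>(m, n) \<mapsto> f m \<otimes> n\<close>.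
\<close>

lemma tensor_map_class:
  assumes x: "x \<in> carrier (pair_module M N)"
  shows "tensor_map M' N f (T.tensor_class x) = b.ext x"
proof -
  have "T'.tensor_class (push y) = b.ext x" if yx: "y \<in> T.tensor_class x" for y
  proof -
    obtain u where u: "u \<in> tensor_null M N" "y = u + x" using yx by (auto simp: a_r_coset_def' T.pairs.add_eq)
    have uc: "u \<in> carrier (pair_module M N)" using u(1) submodule.subset[OF T.null_submodule] by blast
    have y: "y \<in> carrier (pair_module M N)" using T.pairs.a_closed[OF uc x] u(2) by (simp add: T.pairs.add_eq)
    have "b.ext y = b.ext u \<oplus>\<^bsub>tensor_module M' N\<^esub> b.ext x"
      using module_homD(2)[OF b.ext_hom uc x] u(2) by (simp add: T.pairs.add_eq)
    then show ?thesis using push_carrier(2)[OF y] b.ext_null[OF u(1)] module_homD(1)[OF b.ext_hom x] by simp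
  qed
  moreover have "x \<in> T.tensor_class x"
    using submodule.zero_closed[OF T.null_submodule] by (force simp: a_r_coset_def' T.pairs.add_eq T.pairs.zero_eq)
  ultimately show ?thesis unfolding tensor_map_def by blast
qed

lemma tensor_map_eq_lift: "z \<in> carrier (tensor_module M N) \<Longrightarrow> tensor_map M' N f z = b.lift z"
  by (auto simp: T.tensor_simps(1) tensor_map_class b.lift_class)

lemma tensor_map_hom: "tensor_map M' N f \<in> module_hom mpoly_ring (tensor_module M N) (tensor_module M' N)"
  using module_homD[OF b.lift_hom] by (intro module_homI) (simp_all add: tensor_map_eq_lift)

lemma tensor_map_pure:
  "\<lbrakk>m \<in> carrier M; n \<in> carrier N\<rbrakk> \<Longrightarrow> tensor_map M' N f (T.pure_tensor m n) = T'.pure_tensor (f m) n"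
  by (simp add: tensor_map_eq_lift T.pure_tensor_carrier b.lift_pure)

end

lemma module_hom_comp:
  fixes L :: "(('n::finite, 'k::field) mpoly, 'l, 'x) module_scheme"
  assumes "f \<in> module_hom mpoly_ring L M" "g \<in> module_hom mpoly_ring M N"
  shows "(\<lambda>x. g (f x)) \<in> module_hom mpoly_ring L N"
  by (rule module_homI) (simp_all add: module_homD[OF assms(1)] module_homD[OF assms(2)])

lemma module_hom_sum:
  fixes M :: "(('n::finite, 'k::field) mpoly, 'l, 'x) module_scheme"
    and N :: "(('n, 'k) mpoly, 'p, 'y) module_scheme"
  assumes "mpoly_module N" "f \<in> module_hom mpoly_ring M N" "g \<in> module_hom mpoly_ring M N"
  shows "(\<lambda>x. f x \<oplus>\<^bsub>N\<^esub> g x) \<in> module_hom mpoly_ring M N"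
proof -
  interpret N: mpoly_module N by fact
  show ?thesis
    by (rule module_homI) (simp_all add: module_homD[OF assms(2)] module_homD[OF assms(3)] N.a_ac N.smult_add)
qed

lemma module_hom_diff:
  fixes M :: "(('n::finite, 'k::field) mpoly, 'l, 'x) module_scheme"
    and N :: "(('n, 'k) mpoly, 'p, 'y) module_scheme"
  assumes "mpoly_module N" "f \<in> module_hom mpoly_ring M N" "g \<in> module_hom mpoly_ring M N"
  shows "(\<lambda>x. f x \<ominus>\<^bsub>N\<^esub> g x) \<in> module_hom mpoly_ring M N"
proof -
  interpret N: mpoly_module N by fact
  show ?thesis
    by (rule module_homI)
      (simp_all add: module_homD[OF assms(2)] module_homD[OF assms(3)] a_minus_def N.a_ac N.minus_add N.smult_add N.smult_neg)
qed

lemma module_hom_id: "(\<lambda>x. x) \<in> module_hom mpoly_ring M (M :: (('n::finite, 'k::field) mpoly, 'm, 'x) module_scheme)"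
  by (rule module_homI) simp_all

lemma (in degreewise_module) hcomp_finsum:
  "(\<And>i. i \<in> A \<Longrightarrow> f i \<in> hcomp M b) \<Longrightarrow> (\<Oplus>i\<in>A. f i) \<in> hcomp M b"
proof (induction A rule: infinite_finite_induct)
  case (insert i A)
  then show ?case using hcomp_carrier[of _ b] by (simp add: Pi_def hcomp_add)
qed (simp_all add: hcomp_zero)

lemma poly_comp_0_const: "p \<in> poly_comp 0 \<Longrightarrow> p = const (Poly_Mapping.lookup p 0)"
proof (rule poly_mapping_eqI)
  fix a assume p: "p \<in> poly_comp 0"
  show "Poly_Mapping.lookup p a = Poly_Mapping.lookup (const (Poly_Mapping.lookup p 0)) a"
  proof (cases "a = 0")
    case False
    then have "(\<lambda>i. int (Poly_Mapping.lookup a i)) \<noteq> 0"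
      by (auto simp: poly_mapping_eq_iff fun_eq_iff)
    then show ?thesis using p False by (simp add: poly_comp_iff lookup_single)
  qed simp
qed

text \<open>
  The component of degree \<open>b\<close> of a tensor product is spanned over \<open>k\<close> by the pure tensors of homogeneous
  elements of total degree \<open>b\<close>, so degrees have to be compared for these only. The target degree \<open>b'\<close> is
  arbitrary, which admits bilinear maps that shift degrees.
\<close>

lemma lift_hcomp:
  fixes Q :: "('n::finite, 'k::field, 'q) gr_mod"
  assumes "bilinear_map M N Q \<phi>" and Q: "degreewise_module Q"
    and phi: "\<And>c m n. \<lbrakk>m \<in> hcomp M c; n \<in> hcomp N (b - c)\<rbrakk> \<Longrightarrow> \<phi> m n \<in> hcomp Q b'"
    and z: "z \<in> hcomp (tensor_module M N) b"
  shows "bilinear_map.lift M N Q \<phi> z \<in> hcomp Q b'"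
proof -
  interpret bilinear_map M N Q \<phi> by fact
  interpret Q: degreewise_module Q by fact
  obtain x where x: "x \<in> hcomp (pair_module M N) b" "z = tensor_class x" using z by (auto simp: tensor_simps)
  have xc: "x \<in> carrier (pair_module M N)"
    using x(1) degreewise_module.hcomp_carrier[OF pair_module_degreewise] by blast
  have "Poly_Mapping.lookup x p \<odot>\<^bsub>Q\<^esub> case_prod \<phi> p \<in> hcomp Q b'" if px: "p \<in> Poly_Mapping.keys x" for p
  proof -
    obtain m n where p: "p = (m, n)" by (cases p)
    then obtain c where c: "m \<in> hcomp M c" "n \<in> hcomp N (b - c)" "Poly_Mapping.lookup x p \<in> poly_comp 0"
      using x(1) px unfolding pair_module_hcomp_iff in_keys_iff by blast
    show ?thesis
      using Q.hcomp_const[OF phi[OF c(1,2)]] p by (subst poly_comp_0_const[OF c(3)]) simp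
  qed
  then have "ext x \<in> hcomp Q b'"
    unfolding linear_extension_def by (rule Q.hcomp_finsum)
  then show ?thesis using x(2) lift_class[OF xc] by simp
qed

lemma tensor_map_gr_hom:
  assumes M: "degreewise_module M" and M': "degreewise_module M'" and N: "degreewise_module N"
    and f: "f \<in> gr_homs M M' 0"
  shows "tensor_map M' N f \<in> gr_homs (tensor_module M N) (tensor_module M' N) 0"
proof -
  interpret tensor_functor M M' N f
    by (intro tensor_functor.intro tensor_product.intro tensor_functor_axioms.intro M M' N gr_homsD(1)[OF f])
  show ?thesis
  proof (rule gr_homsI[OF tensor_map_hom])
    fix b z assume z: "z \<in> hcomp (tensor_module M N) b"
    have "T'.pure_tensor (f m) n \<in> hcomp (tensor_module M' N) b" if "m \<in> hcomp M c" "n \<in> hcomp N (b - c)" for m n c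
      using T'.pure_tensor_hcomp[OF gr_homs_0D[OF f that(1)] that(2)] by simp
    then have "b.lift z \<in> hcomp (tensor_module M' N) b"
      by (rule lift_hcomp[OF b.bilinear_map_axioms T'.tensor_degreewise _ z])
    then show "tensor_map M' N f z \<in> hcomp (tensor_module M' N) (b + 0)"
      using tensor_map_eq_lift[OF T.tensor.hcomp_carrier[OF z]] by simp
  qed
qed

text \<open>Tensoring with a fixed module preserves all identities between homomorphisms: they only have to be
  compared on pure tensors.\<close>

locale tensor_complex = N: degreewise_module N
  for N :: "('n::finite, 'k::field, 'p) gr_mod"
begin

lemma productI: "degreewise_module M \<Longrightarrow> tensor_product M N"
  by (intro tensor_product.intro N.degreewise_module_axioms)

lemma functorI: "\<lbrakk>degreewise_module M; degreewise_module M'; f \<in> module_hom mpoly_ring M M'\<rbrakk> \<Longrightarrow> tensor_functor M M' N f"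
  by (intro tensor_functor.intro tensor_functor_axioms.intro productI)

lemma chain_complex_tensor:
  assumes P: "chain_complex P d"
  shows "chain_complex (\<lambda>i. tensor_module (P i) N) (\<lambda>i. tensor_map (P i) N (d i))"
  unfolding chain_complex_def
proof (intro conjI allI ballI)
  fix i
  note D = chain_complexD(1)[OF P] and h = chain_complexD(4)[OF P]
  show "degreewise_module (tensor_module (P i) N)"
    by (rule tensor_product.tensor_degreewise[OF productI[OF D]])
  show "tensor_map (P i) N (d i) \<in> gr_homs (tensor_module (P (Suc i)) N) (tensor_module (P i) N) 0"
    by (rule tensor_map_gr_hom[OF D D N.degreewise_module_axioms chain_complexD(3)[OF P]])
  interpret T: tensor_product "P i" N by (rule productI[OF D])
  interpret T2: tensor_product "P (Suc (Suc i))" N by (rule productI[OF D])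
  interpret f: tensor_functor "P (Suc i)" "P i" N "d i" by (rule functorI[OF D D h])
  interpret g: tensor_functor "P (Suc (Suc i))" "P (Suc i)" N "d (Suc i)" by (rule functorI[OF D D h])
  have z: "(\<lambda>_. \<zero>\<^bsub>tensor_module (P i) N\<^esub>) \<in> module_hom mpoly_ring (tensor_module (P (Suc (Suc i))) N) (tensor_module (P i) N)"
    by (rule module_homI) simp_all
  show "tensor_map (P i) N (d i) (tensor_map (P (Suc i)) N (d (Suc i)) z) = \<zero>\<^bsub>tensor_module (P i) N\<^esub>"
    if "z \<in> carrier (tensor_module (P (Suc (Suc i))) N)" for z
    by (rule T2.tensor_hom_eqI[OF T.tensor.mpoly_module_axioms module_hom_comp[OF g.tensor_map_hom f.tensor_map_hom] z _ that])
      (simp add: g.tensor_map_pure f.tensor_map_pure module_homD(1)[OF h] chain_complexD(5)[OF P]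
        module_hom_zero_minus(1)[OF chain_complexD(2)[OF P] T.tensor.mpoly_module_axioms T.pure_tensor_hom_left])
qed

lemma chain_map_tensor:
  assumes P: "chain_complex P d" and Q: "chain_complex Q e" and f: "chain_map P d Q e f"
  shows "chain_map (\<lambda>i. tensor_module (P i) N) (\<lambda>i. tensor_map (P i) N (d i))
    (\<lambda>i. tensor_module (Q i) N) (\<lambda>i. tensor_map (Q i) N (e i)) (\<lambda>i. tensor_map (Q i) N (f i))"
  unfolding chain_map_def
proof (intro conjI allI ballI)
  fix i
  note DP = chain_complexD(1)[OF P] and DQ = chain_complexD(1)[OF Q]
    and hP = chain_complexD(4)[OF P] and hQ = chain_complexD(4)[OF Q] and hf = chain_mapD(2)[OF f]
  show "tensor_map (Q i) N (f i) \<in> gr_homs (tensor_module (P i) N) (tensor_module (Q i) N) 0"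
    by (rule tensor_map_gr_hom[OF DP DQ N.degreewise_module_axioms chain_mapD(1)[OF f]])
  interpret T: tensor_product "Q i" N by (rule productI[OF DQ])
  interpret TP: tensor_product "P (Suc i)" N by (rule productI[OF DP])
  interpret f: tensor_functor "P i" "Q i" N "f i" by (rule functorI[OF DP DQ hf])
  interpret f1: tensor_functor "P (Suc i)" "Q (Suc i)" N "f (Suc i)" by (rule functorI[OF DP DQ hf])
  interpret d: tensor_functor "P (Suc i)" "P i" N "d i" by (rule functorI[OF DP DP hP])
  interpret e: tensor_functor "Q (Suc i)" "Q i" N "e i" by (rule functorI[OF DQ DQ hQ])
  show "tensor_map (Q i) N (e i) (tensor_map (Q (Suc i)) N (f (Suc i)) z) =
      tensor_map (Q i) N (f i) (tensor_map (P i) N (d i) z)"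
    if "z \<in> carrier (tensor_module (P (Suc i)) N)" for z
    by (rule TP.tensor_hom_eqI[OF T.tensor.mpoly_module_axioms module_hom_comp[OF f1.tensor_map_hom e.tensor_map_hom]
          module_hom_comp[OF d.tensor_map_hom f.tensor_map_hom] _ that])
      (simp add: f1.tensor_map_pure f.tensor_map_pure d.tensor_map_pure e.tensor_map_pure
        module_homD(1)[OF hP] module_homD(1)[OF hf] chain_mapD(3)[OF f])
qed

lemma retraction_tensor:
  assumes P: "chain_complex P d" and Q: "chain_complex Q e"
    and f: "chain_map P d Q e f" and g: "chain_map Q e P d g" and h: "retraction_up_to_homotopy P d Q e f g h"
  shows "retraction_up_to_homotopy (\<lambda>i. tensor_module (P i) N) (\<lambda>i. tensor_map (P i) N (d i))
    (\<lambda>i. tensor_module (Q i) N) (\<lambda>i. tensor_map (Q i) N (e i))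
    (\<lambda>i. tensor_map (Q i) N (f i)) (\<lambda>i. tensor_map (P i) N (g i)) (\<lambda>i. tensor_map (P (Suc i)) N (h i))"
  unfolding retraction_up_to_homotopy_def
proof (intro conjI allI ballI)
  note DP = chain_complexD(1)[OF P] and DQ = chain_complexD(1)[OF Q]
    and hP = chain_complexD(4)[OF P] and hf = chain_mapD(2)[OF f] and hg = chain_mapD(2)[OF g]
  have hh0: "h i \<in> gr_homs (P i) (P (Suc i)) 0" for i
    using h unfolding retraction_up_to_homotopy_def by blast
  note hh = gr_homsD(1)[OF hh0]
  show "tensor_map (P (Suc i)) N (h i) \<in> gr_homs (tensor_module (P i) N) (tensor_module (P (Suc i)) N) 0" for i
    by (rule tensor_map_gr_hom[OF DP DP N.degreewise_module_axioms hh0])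
  have gf: "(\<lambda>z. tensor_map (P i) N (g i) (tensor_map (Q i) N (f i) z) \<ominus>\<^bsub>tensor_module (P i) N\<^esub> z)
      \<in> module_hom mpoly_ring (tensor_module (P i) N) (tensor_module (P i) N)"
    and gf_pure: "\<lbrakk>m \<in> carrier (P i); n \<in> carrier N\<rbrakk> \<Longrightarrow>
      tensor_map (P i) N (g i) (tensor_map (Q i) N (f i) (tensor_product.pure_tensor (P i) N m n))
        \<ominus>\<^bsub>tensor_module (P i) N\<^esub> tensor_product.pure_tensor (P i) N m n =
      tensor_product.pure_tensor (P i) N (g i (f i m) \<ominus>\<^bsub>P i\<^esub> m) n" for i m n
  proof -
    interpret T: tensor_product "P i" N by (rule productI[OF DP])
    interpret f: tensor_functor "P i" "Q i" N "f i" by (rule functorI[OF DP DQ hf])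
    interpret g: tensor_functor "Q i" "P i" N "g i" by (rule functorI[OF DQ DP hg])
    show "(\<lambda>z. tensor_map (P i) N (g i) (tensor_map (Q i) N (f i) z) \<ominus>\<^bsub>tensor_module (P i) N\<^esub> z)
      \<in> module_hom mpoly_ring (tensor_module (P i) N) (tensor_module (P i) N)"
      by (rule module_hom_diff[OF T.tensor.mpoly_module_axioms module_hom_comp[OF f.tensor_map_hom g.tensor_map_hom] module_hom_id])
    show "tensor_map (P i) N (g i) (tensor_map (Q i) N (f i) (T.pure_tensor m n))
        \<ominus>\<^bsub>tensor_module (P i) N\<^esub> T.pure_tensor m n = T.pure_tensor (g i (f i m) \<ominus>\<^bsub>P i\<^esub> m) n"
      if "m \<in> carrier (P i)" "n \<in> carrier N"
      using that module_homD(1)[OF hf] module_homD(1)[OF hg]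
      by (simp add: f.tensor_map_pure g.tensor_map_pure
          module_hom_zero_minus(2)[OF chain_complexD(2)[OF P] T.tensor.mpoly_module_axioms T.pure_tensor_hom_left])
  qed
  show "tensor_map (P 0) N (d 0) (tensor_map (P (Suc 0)) N (h 0) z) =
      tensor_map (P 0) N (g 0) (tensor_map (Q 0) N (f 0) z) \<ominus>\<^bsub>tensor_module (P 0) N\<^esub> z"
    if z: "z \<in> carrier (tensor_module (P 0) N)" for z
  proof -
    interpret T: tensor_product "P 0" N by (rule productI[OF DP])
    interpret h: tensor_functor "P 0" "P (Suc 0)" N "h 0" by (rule functorI[OF DP DP hh])
    interpret d: tensor_functor "P (Suc 0)" "P 0" N "d 0" by (rule functorI[OF DP DP hP])
    show ?thesis
    proof (rule T.tensor_hom_eqI[OF T.tensor.mpoly_module_axioms module_hom_comp[OF h.tensor_map_hom d.tensor_map_hom] gf _ z])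
      fix m n assume m: "m \<in> carrier (P 0)" and n: "n \<in> carrier N"
      have "d 0 (h 0 m) = g 0 (f 0 m) \<ominus>\<^bsub>P 0\<^esub> m"
        using h m unfolding retraction_up_to_homotopy_def by blast
      then show "tensor_map (P 0) N (d 0) (tensor_map (P (Suc 0)) N (h 0) (T.pure_tensor m n)) =
        tensor_map (P 0) N (g 0) (tensor_map (Q 0) N (f 0) (T.pure_tensor m n)) \<ominus>\<^bsub>tensor_module (P 0) N\<^esub> T.pure_tensor m n"
        using m n by (simp add: gf_pure h.tensor_map_pure d.tensor_map_pure module_homD(1)[OF hh])
    qed
  qed
  show "tensor_map (P (Suc i)) N (d (Suc i)) (tensor_map (P (Suc (Suc i))) N (h (Suc i)) z)
      \<oplus>\<^bsub>tensor_module (P (Suc i)) N\<^esub> tensor_map (P (Suc i)) N (h i) (tensor_map (P i) N (d i) z) =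
      tensor_map (P (Suc i)) N (g (Suc i)) (tensor_map (Q (Suc i)) N (f (Suc i)) z)
      \<ominus>\<^bsub>tensor_module (P (Suc i)) N\<^esub> z"
    if z: "z \<in> carrier (tensor_module (P (Suc i)) N)" for i z
  proof -
    interpret T: tensor_product "P (Suc i)" N by (rule productI[OF DP])
    interpret h: tensor_functor "P i" "P (Suc i)" N "h i" by (rule functorI[OF DP DP hh])
    interpret h1: tensor_functor "P (Suc i)" "P (Suc (Suc i))" N "h (Suc i)" by (rule functorI[OF DP DP hh])
    interpret d: tensor_functor "P (Suc i)" "P i" N "d i" by (rule functorI[OF DP DP hP])
    interpret d1: tensor_functor "P (Suc (Suc i))" "P (Suc i)" N "d (Suc i)" by (rule functorI[OF DP DP hP])
    show ?thesis
    proof (rule T.tensor_hom_eqI[OF T.tensor.mpoly_module_axioms module_hom_sum[OF T.tensor.mpoly_module_axioms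
          module_hom_comp[OF h1.tensor_map_hom d1.tensor_map_hom] module_hom_comp[OF d.tensor_map_hom h.tensor_map_hom]] gf _ z])
      fix m n assume m: "m \<in> carrier (P (Suc i))" and n: "n \<in> carrier N"
      have "d (Suc i) (h (Suc i) m) \<oplus>\<^bsub>P (Suc i)\<^esub> h i (d i m) = g (Suc i) (f (Suc i) m) \<ominus>\<^bsub>P (Suc i)\<^esub> m"
        using h m unfolding retraction_up_to_homotopy_def by blast
      then show "tensor_map (P (Suc i)) N (d (Suc i)) (tensor_map (P (Suc (Suc i))) N (h (Suc i)) (T.pure_tensor m n))
        \<oplus>\<^bsub>tensor_module (P (Suc i)) N\<^esub> tensor_map (P (Suc i)) N (h i) (tensor_map (P i) N (d i) (T.pure_tensor m n)) =
        tensor_map (P (Suc i)) N (g (Suc i)) (tensor_map (Q (Suc i)) N (f (Suc i)) (T.pure_tensor m n))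
        \<ominus>\<^bsub>tensor_module (P (Suc i)) N\<^esub> T.pure_tensor m n"
        using m n
        by (simp add: gf_pure h.tensor_map_pure h1.tensor_map_pure d.tensor_map_pure d1.tensor_map_pure
            module_homD(1)[OF hh] module_homD(1)[OF hP] flip: T.pure_tensor_add_left)
    qed
  qed
qed

end

lemma (in resolution) chain_complex: "chain_complex P d"
  unfolding chain_complex_def using degreewise d_hom d_d by blast

text \<open>
  Tensoring carries the homotopy equivalence of the two resolutions to a homotopy equivalence of the
  tensored complexes.
\<close>

theorem tensor_homology_independent_of_resolution:
  assumes P: "resolution M P d \<epsilon>" and Q: "resolution M Q e \<epsilon>'" and N: "degreewise_module N"
  shows "hcomp_dim (chain_homology (\<lambda>i. tensor_module (P i) N) (\<lambda>i. tensor_map (P i) N (d i)) i) b =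
    hcomp_dim (chain_homology (\<lambda>i. tensor_module (Q i) N) (\<lambda>i. tensor_map (Q i) N (e i)) i) b"
proof -
  interpret tensor_complex N using N by (rule tensor_complex.intro)
  note cP = resolution.chain_complex[OF P] and cQ = resolution.chain_complex[OF Q]
  obtain f g h h' where fg: "chain_map P d Q e f" "chain_map Q e P d g"
    "retraction_up_to_homotopy P d Q e f g h" "retraction_up_to_homotopy Q e P d g f h'"
    using resolutions_homotopy_equivalent[OF P Q] by blast
  show ?thesis
    by (rule chain_homology_dim_eq[OF chain_complex_tensor[OF cP] chain_complex_tensor[OF cQ]
          chain_map_tensor[OF cP cQ fg(1)] chain_map_tensor[OF cQ cP fg(2)]
          retraction_tensor[OF cP cQ fg(1,2,3)] retraction_tensor[OF cQ cP fg(2,1,4)]])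
qed

section \<open>The graded Hom\<close>

lemma module_hom_finsum_homs:
  fixes M :: "(('n::finite, 'k::field) mpoly, 'm, 'x) module_scheme"
    and N :: "(('n, 'k) mpoly, 'p, 'y) module_scheme"
  assumes N: "mpoly_module N" and "finite D" "\<And>b. b \<in> D \<Longrightarrow> f b \<in> module_hom mpoly_ring M N"
  shows "(\<lambda>m. \<Oplus>\<^bsub>N\<^esub>b\<in>D. f b m) \<in> module_hom mpoly_ring M N"
proof (rule module_homI)
  interpret N: mpoly_module N by fact
  note h = module_homD[OF assms(3)]
  show "(\<Oplus>\<^bsub>N\<^esub>b\<in>D. f b m) \<in> carrier N" if "m \<in> carrier M" for m
    using that h by (intro N.finsum_closed) auto
  show "(\<Oplus>\<^bsub>N\<^esub>b\<in>D. f b (m \<oplus>\<^bsub>M\<^esub> m')) = (\<Oplus>\<^bsub>N\<^esub>b\<in>D. f b m) \<oplus>\<^bsub>N\<^esub> (\<Oplus>\<^bsub>N\<^esub>b\<in>D. f b m')"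
    if "m \<in> carrier M" "m' \<in> carrier M" for m m'
  proof -
    have "(\<Oplus>\<^bsub>N\<^esub>b\<in>D. f b (m \<oplus>\<^bsub>M\<^esub> m')) = (\<Oplus>\<^bsub>N\<^esub>b\<in>D. f b m \<oplus>\<^bsub>N\<^esub> f b m')"
      by (rule N.finsum_cong') (use that h in auto)
    also have "\<dots> = (\<Oplus>\<^bsub>N\<^esub>b\<in>D. f b m) \<oplus>\<^bsub>N\<^esub> (\<Oplus>\<^bsub>N\<^esub>b\<in>D. f b m')"
      by (rule N.finsum_addf) (use that h in auto)
    finally show ?thesis .
  qed
  show "(\<Oplus>\<^bsub>N\<^esub>b\<in>D. f b (s \<odot>\<^bsub>M\<^esub> m)) = s \<odot>\<^bsub>N\<^esub> (\<Oplus>\<^bsub>N\<^esub>b\<in>D. f b m)" if "m \<in> carrier M" for s m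
    using that h assms(2) by (subst N.finsum_smult_ldistr) (auto intro!: N.finsum_cong')
qed

text \<open>
  Scalars act on homomorphisms through \<open>N\<close>, so it is the grading of \<open>N\<close> that makes \<open>Hom\<close> a module.
\<close>

locale graded_hom = M: degreewise_module M + N: multigraded_module N
  for M :: "('n::finite, 'k::field, 'm) gr_mod" and N :: "('n, 'k, 'p) gr_mod"
begin

lemma Hom_simps:
  "\<zero>\<^bsub>Hom_module M N\<^esub> = (\<lambda>m\<in>carrier M. \<zero>\<^bsub>N\<^esub>)"
  "u \<oplus>\<^bsub>Hom_module M N\<^esub> v = (\<lambda>m\<in>carrier M. u m \<oplus>\<^bsub>N\<^esub> v m)"
  "s \<odot>\<^bsub>Hom_module M N\<^esub> u = (\<lambda>m\<in>carrier M. s \<odot>\<^bsub>N\<^esub> u m)"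
  "hcomp (Hom_module M N) b = gr_homs M N b \<inter> extensional (carrier M)"
  by (simp_all add: Hom_module_def)

lemma Hom_carrier: "carrier (Hom_module M N) =
    {\<lambda>m\<in>carrier M. \<Oplus>\<^bsub>N\<^esub>b\<in>D. f b m | D f. finite D \<and> (\<forall>b\<in>D. f b \<in> gr_homs M N b)}"
  by (simp add: Hom_module_def)

lemma restrict_gr_homs: "f \<in> gr_homs M N b \<Longrightarrow> restrict f (carrier M) \<in> gr_homs M N b \<inter> extensional (carrier M)"
  using M.hcomp_carrier by (auto simp: gr_homs_def module_hom_def)

lemma gr_homs_zero: "(\<lambda>_. \<zero>\<^bsub>N\<^esub>) \<in> gr_homs M N b"
  by (intro gr_homsI module_homI) (simp_all add: N.hcomp_zero)

lemma gr_homs_add: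
  assumes "f \<in> gr_homs M N b" "g \<in> gr_homs M N b"
  shows "(\<lambda>m. f m \<oplus>\<^bsub>N\<^esub> g m) \<in> gr_homs M N b"
proof (rule gr_homsI)
  show "(\<lambda>m. f m \<oplus>\<^bsub>N\<^esub> g m) \<in> module_hom mpoly_ring M N"
    using assms by (intro module_hom_sum gr_homsD(1) N.mpoly_module_axioms)
  show "f m \<oplus>\<^bsub>N\<^esub> g m \<in> hcomp N (c + b)" if "m \<in> hcomp M c" for m c
    using gr_homsD(2)[OF assms(1) that] gr_homsD(2)[OF assms(2) that] by (rule N.hcomp_add)
qed

lemma module_hom_smult: "f \<in> module_hom mpoly_ring M N \<Longrightarrow> (\<lambda>m. s \<odot>\<^bsub>N\<^esub> f m) \<in> module_hom mpoly_ring M N"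
  by (rule module_homI) (simp_all add: module_homD N.smult_add N.smult_mult[symmetric] mult.commute)

lemma gr_homs_smult:
  assumes "f \<in> gr_homs M N b" "s \<in> poly_comp a"
  shows "(\<lambda>m. s \<odot>\<^bsub>N\<^esub> f m) \<in> gr_homs M N (a + b)"
proof (rule gr_homsI)
  show "(\<lambda>m. s \<odot>\<^bsub>N\<^esub> f m) \<in> module_hom mpoly_ring M N" by (rule module_hom_smult[OF gr_homsD(1)[OF assms(1)]])
  show "s \<odot>\<^bsub>N\<^esub> f m \<in> hcomp N (c + (a + b))" if "m \<in> hcomp M c" for m c
    using N.smult_hcomp[OF assms(2) gr_homsD(2)[OF assms(1) that]] by (simp add: add.left_commute)
qed

lemma homogeneous_in_Hom:
  assumes "f \<in> gr_homs M N b" shows "restrict f (carrier M) \<in> carrier (Hom_module M N)"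
proof -
  have "restrict f (carrier M) = (\<lambda>m\<in>carrier M. \<Oplus>\<^bsub>N\<^esub>c\<in>{b}. f m)"
    using module_homD(1)[OF gr_homsD(1)[OF assms]] by (intro restrict_ext) simp
  then show ?thesis unfolding Hom_carrier using assms by (intro CollectI exI[of _ "{b}"] exI[of _ "\<lambda>_. f"]) auto
qed

lemma hcomp_in_Hom: "u \<in> hcomp (Hom_module M N) b \<Longrightarrow> u \<in> carrier (Hom_module M N)"
  using homogeneous_in_Hom[of u b] by (auto simp: Hom_simps extensional_restrict)

lemma zero_in_Hom: "\<zero>\<^bsub>Hom_module M N\<^esub> \<in> carrier (Hom_module M N)"
  using homogeneous_in_Hom[OF gr_homs_zero] by (simp add: Hom_simps)

lemma add_in_Hom:
  assumes "u \<in> carrier (Hom_module M N)" "v \<in> carrier (Hom_module M N)"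
  shows "u \<oplus>\<^bsub>Hom_module M N\<^esub> v \<in> carrier (Hom_module M N)"
proof -
  obtain D f where f: "finite D" "\<And>b. b \<in> D \<Longrightarrow> f b \<in> gr_homs M N b" "u = (\<lambda>m\<in>carrier M. \<Oplus>\<^bsub>N\<^esub>b\<in>D. f b m)"
    using assms(1) unfolding Hom_carrier by blast
  obtain E g where g: "finite E" "\<And>b. b \<in> E \<Longrightarrow> g b \<in> gr_homs M N b" "v = (\<lambda>m\<in>carrier M. \<Oplus>\<^bsub>N\<^esub>b\<in>E. g b m)"
    using assms(2) unfolding Hom_carrier by blast
  define f' where "f' b = (if b \<in> D then f b else (\<lambda>_. \<zero>\<^bsub>N\<^esub>))" for b
  define g' where "g' b = (if b \<in> E then g b else (\<lambda>_. \<zero>\<^bsub>N\<^esub>))" for b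
  have f': "f' b \<in> gr_homs M N b" and g': "g' b \<in> gr_homs M N b" for b
    using f(2) g(2) gr_homs_zero by (auto simp: f'_def g'_def)
  note c = module_homD(1)[OF gr_homsD(1)[OF f']] module_homD(1)[OF gr_homsD(1)[OF g']]
  have u: "(\<Oplus>\<^bsub>N\<^esub>b\<in>D. f b m) = (\<Oplus>\<^bsub>N\<^esub>b\<in>D \<union> E. f' b m)" if "m \<in> carrier M" for m
    using that f(1) g(1) module_homD(1)[OF gr_homsD(1)[OF f(2)]]
    by (intro N.add.finprod_mono_neutral_cong_left) (auto simp: f'_def)
  have v: "(\<Oplus>\<^bsub>N\<^esub>b\<in>E. g b m) = (\<Oplus>\<^bsub>N\<^esub>b\<in>D \<union> E. g' b m)" if "m \<in> carrier M" for m
    using that f(1) g(1) module_homD(1)[OF gr_homsD(1)[OF g(2)]]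
    by (intro N.add.finprod_mono_neutral_cong_left) (auto simp: g'_def)
  have "u \<oplus>\<^bsub>Hom_module M N\<^esub> v = (\<lambda>m\<in>carrier M. \<Oplus>\<^bsub>N\<^esub>b\<in>D \<union> E. f' b m \<oplus>\<^bsub>N\<^esub> g' b m)"
    unfolding Hom_simps f(3) g(3) using c by (intro restrict_ext) (simp add: u v N.finsum_addf Pi_def)
  then show ?thesis
    unfolding Hom_carrier using f(1) g(1) gr_homs_add[OF f' g']
    by (intro CollectI exI[of _ "D \<union> E"] exI[of _ "\<lambda>b m. f' b m \<oplus>\<^bsub>N\<^esub> g' b m"]) auto
qed

lemma HomD:
  assumes "u \<in> carrier (Hom_module M N)"
  shows "u \<in> module_hom mpoly_ring M N" "u \<in> extensional (carrier M)"
proof -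
  obtain D f where f: "finite D" "\<And>b. b \<in> D \<Longrightarrow> f b \<in> gr_homs M N b" "u = (\<lambda>m\<in>carrier M. \<Oplus>\<^bsub>N\<^esub>b\<in>D. f b m)"
    using assms unfolding Hom_carrier by blast
  show "u \<in> extensional (carrier M)" unfolding f(3) by simp
  have "(\<lambda>m. \<Oplus>\<^bsub>N\<^esub>b\<in>D. f b m) \<in> module_hom mpoly_ring M N"
    using f(1,2) gr_homsD(1) by (intro module_hom_finsum_homs N.mpoly_module_axioms) blast+
  then show "u \<in> module_hom mpoly_ring M N" unfolding f(3) by (auto simp: module_hom_def)
qed

lemma Hom_eqI:
  assumes "u \<in> carrier (Hom_module M N)" "v \<in> carrier (Hom_module M N)" "\<And>m. m \<in> carrier M \<Longrightarrow> u m = v m"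
  shows "u = v"
  using HomD(2)[OF assms(1)] HomD(2)[OF assms(2)] assms(3) by (rule extensionalityI)

lemma Hom_sums:
  assumes "u \<in> carrier (Hom_module M N)"
  shows "u \<in> sums_of (Hom_module M N) (\<Union>b. hcomp (Hom_module M N) b)"
proof -
  obtain D f where f: "finite D" "\<And>b. b \<in> D \<Longrightarrow> f b \<in> gr_homs M N b" "u = (\<lambda>m\<in>carrier M. \<Oplus>\<^bsub>N\<^esub>b\<in>D. f b m)"
    using assms unfolding Hom_carrier by blast
  have "(\<lambda>m\<in>carrier M. \<Oplus>\<^bsub>N\<^esub>b\<in>D. f b m) \<in> sums_of (Hom_module M N) (\<Union>b. hcomp (Hom_module M N) b)"
    using f(1,2)
  proof (induction D rule: finite_induct)
    case empty
    have "(\<lambda>m\<in>carrier M. \<Oplus>\<^bsub>N\<^esub>b\<in>{}. f b m) = \<zero>\<^bsub>Hom_module M N\<^esub>" by (simp add: Hom_simps(1))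
    then show ?case by (simp only: sums_of.zero)
  next
    case (insert b D)
    have "restrict (f b) (carrier M) \<in> hcomp (Hom_module M N) b"
      using restrict_gr_homs[of "f b" b] insert.prems by (simp add: Hom_simps)
    then have 1: "restrict (f b) (carrier M) \<in> sums_of (Hom_module M N) (\<Union>b. hcomp (Hom_module M N) b)"
      by (intro sums_of.base) blast
    have 2: "(\<lambda>m\<in>carrier M. \<Oplus>\<^bsub>N\<^esub>b\<in>D. f b m) \<in> sums_of (Hom_module M N) (\<Union>b. hcomp (Hom_module M N) b)"
      using insert by blast
    have "(\<lambda>m\<in>carrier M. \<Oplus>\<^bsub>N\<^esub>b\<in>insert b D. f b m) =
        restrict (f b) (carrier M) \<oplus>\<^bsub>Hom_module M N\<^esub> (\<lambda>m\<in>carrier M. \<Oplus>\<^bsub>N\<^esub>b\<in>D. f b m)"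
      unfolding Hom_simps using insert.hyps module_homD(1)[OF gr_homsD(1)[OF insert.prems]]
      by (intro restrict_ext) (simp add: Pi_def)
    then show ?case using sums_of.add[OF 1 2] by simp
  qed
  then show ?thesis using f(3) by simp
qed

lemma sums_in_Hom:
  "u \<in> sums_of (Hom_module M N) (\<Union>b. hcomp (Hom_module M N) b) \<Longrightarrow> u \<in> carrier (Hom_module M N)"
  by (induction rule: sums_of.induct) (auto intro: zero_in_Hom add_in_Hom hcomp_in_Hom)

text \<open>
  A scalar is a sum of terms and \<open>u\<close> a sum of homogeneous homomorphisms. The product of a term and a
  homogeneous homomorphism is homogeneous, so the product of \<open>s\<close> and \<open>u\<close> is again such a sum.
\<close>

lemma smult_in_Hom:
  assumes "u \<in> carrier (Hom_module M N)"
  shows "s \<odot>\<^bsub>Hom_module M N\<^esub> u \<in> carrier (Hom_module M N)"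
  using Hom_sums[OF assms]
proof (induction rule: sums_of.induct)
  case zero
  have "s \<odot>\<^bsub>Hom_module M N\<^esub> \<zero>\<^bsub>Hom_module M N\<^esub> = \<zero>\<^bsub>Hom_module M N\<^esub>"
    by (auto simp: Hom_simps intro!: restrict_ext)
  then show ?case using zero_in_Hom by simp
next
  case (base u)
  then obtain b where u: "u \<in> gr_homs M N b" "u \<in> carrier (Hom_module M N)"
    using hcomp_in_Hom by (auto simp: Hom_simps)
  note uD = module_homD[OF gr_homsD(1)[OF u(1)]]
  show ?case
  proof (induction s rule: poly_induct)
    case zero
    have "0 \<odot>\<^bsub>Hom_module M N\<^esub> u = \<zero>\<^bsub>Hom_module M N\<^esub>"
      using uD by (auto simp: Hom_simps intro!: restrict_ext)
    then show ?case using zero_in_Hom by simp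
  next
    case (single a c)
    show ?case
      unfolding Hom_simps by (rule homogeneous_in_Hom[OF gr_homs_smult[OF u(1) single_poly_comp]])
  next
    case (add s t)
    have "(s + t) \<odot>\<^bsub>Hom_module M N\<^esub> u = s \<odot>\<^bsub>Hom_module M N\<^esub> u \<oplus>\<^bsub>Hom_module M N\<^esub> t \<odot>\<^bsub>Hom_module M N\<^esub> u"
      using uD by (auto simp: Hom_simps N.smult_plus intro!: restrict_ext)
    then show ?case using add_in_Hom[OF add] by simp
  qed
next
  case (add u v)
  have "s \<odot>\<^bsub>Hom_module M N\<^esub> (u \<oplus>\<^bsub>Hom_module M N\<^esub> v) =
      s \<odot>\<^bsub>Hom_module M N\<^esub> u \<oplus>\<^bsub>Hom_module M N\<^esub> s \<odot>\<^bsub>Hom_module M N\<^esub> v"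
    using module_homD(1)[OF HomD(1)[OF sums_in_Hom[OF add.hyps(1)]]]
      module_homD(1)[OF HomD(1)[OF sums_in_Hom[OF add.hyps(2)]]]
    by (auto simp: Hom_simps N.smult_add intro!: restrict_ext)
  then show ?case using add_in_Hom[OF add.IH] by simp
qed

lemma Hom_module: "module mpoly_ring (Hom_module M N)"
proof (rule mpoly_module_criteria)
  note c = module_homD(1)[OF HomD(1)]
  fix u v w s t
  assume u: "u \<in> carrier (Hom_module M N)"
  show "u \<oplus>\<^bsub>Hom_module M N\<^esub> \<zero>\<^bsub>Hom_module M N\<^esub> = u"
    by (rule Hom_eqI[OF add_in_Hom[OF u zero_in_Hom] u]) (simp add: Hom_simps c[OF u])
  show "s \<odot>\<^bsub>Hom_module M N\<^esub> u \<in> carrier (Hom_module M N)" by (rule smult_in_Hom[OF u])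
  show "(s * t) \<odot>\<^bsub>Hom_module M N\<^esub> u = s \<odot>\<^bsub>Hom_module M N\<^esub> (t \<odot>\<^bsub>Hom_module M N\<^esub> u)"
    by (auto simp: Hom_simps N.smult_mult c[OF u] intro!: restrict_ext)
  show "1 \<odot>\<^bsub>Hom_module M N\<^esub> u = u"
    by (rule Hom_eqI[OF smult_in_Hom[OF u] u]) (simp add: Hom_simps c[OF u])
  show "0 \<odot>\<^bsub>Hom_module M N\<^esub> u = \<zero>\<^bsub>Hom_module M N\<^esub>"
    by (auto simp: Hom_simps c[OF u] intro!: restrict_ext)
  show "(s + t) \<odot>\<^bsub>Hom_module M N\<^esub> u = s \<odot>\<^bsub>Hom_module M N\<^esub> u \<oplus>\<^bsub>Hom_module M N\<^esub> t \<odot>\<^bsub>Hom_module M N\<^esub> u"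
    by (auto simp: Hom_simps N.smult_plus c[OF u] intro!: restrict_ext)
  assume v: "v \<in> carrier (Hom_module M N)"
  show "u \<oplus>\<^bsub>Hom_module M N\<^esub> v \<in> carrier (Hom_module M N)" by (rule add_in_Hom[OF u v])
  show "u \<oplus>\<^bsub>Hom_module M N\<^esub> v = v \<oplus>\<^bsub>Hom_module M N\<^esub> u"
    by (auto simp: Hom_simps c[OF u] c[OF v] N.a_comm intro!: restrict_ext)
  show "s \<odot>\<^bsub>Hom_module M N\<^esub> (u \<oplus>\<^bsub>Hom_module M N\<^esub> v) =
      s \<odot>\<^bsub>Hom_module M N\<^esub> u \<oplus>\<^bsub>Hom_module M N\<^esub> s \<odot>\<^bsub>Hom_module M N\<^esub> v"
    by (auto simp: Hom_simps c[OF u] c[OF v] N.smult_add intro!: restrict_ext)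
  assume w: "w \<in> carrier (Hom_module M N)"
  show "(u \<oplus>\<^bsub>Hom_module M N\<^esub> v) \<oplus>\<^bsub>Hom_module M N\<^esub> w = u \<oplus>\<^bsub>Hom_module M N\<^esub> (v \<oplus>\<^bsub>Hom_module M N\<^esub> w)"
    by (auto simp: Hom_simps c[OF u] c[OF v] c[OF w] N.a_assoc intro!: restrict_ext)
qed (rule zero_in_Hom)

lemma Hom_degreewise: "degreewise_module (Hom_module M N)"
proof (intro degreewise_module.intro degreewise_module_axioms.intro mpoly_moduleI Hom_module)
  show "u \<in> carrier (Hom_module M N)" if "u \<in> hcomp (Hom_module M N) b" for u b
    by (rule hcomp_in_Hom[OF that])
  show "\<zero>\<^bsub>Hom_module M N\<^esub> \<in> hcomp (Hom_module M N) b" for b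
    using restrict_gr_homs[OF gr_homs_zero] by (simp add: Hom_simps)
  show "u \<oplus>\<^bsub>Hom_module M N\<^esub> v \<in> hcomp (Hom_module M N) b"
    if "u \<in> hcomp (Hom_module M N) b" "v \<in> hcomp (Hom_module M N) b" for u v b
    using restrict_gr_homs[OF gr_homs_add, of u b v] that by (simp add: Hom_simps)
  show "const c \<odot>\<^bsub>Hom_module M N\<^esub> u \<in> hcomp (Hom_module M N) b" if "u \<in> hcomp (Hom_module M N) b" for u b c
    using restrict_gr_homs[OF gr_homs_smult[OF _ const_poly_comp], of u b c] that by (simp add: Hom_simps)
qed

sublocale H: degreewise_module "Hom_module M N"
  by (rule Hom_degreewise)

lemma Hom_minus:
  assumes "u \<in> carrier (Hom_module M N)" "v \<in> carrier (Hom_module M N)" "m \<in> carrier M"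
  shows "(u \<ominus>\<^bsub>Hom_module M N\<^esub> v) m = u m \<ominus>\<^bsub>N\<^esub> v m"
  using assms module_homD(1)[OF HomD(1)[OF assms(2)]]
  by (simp add: a_minus_def H.minus_smult N.minus_smult) (simp add: Hom_simps)

end

text \<open>
  Precomposition with \<open>f\<close> acts on each homogeneous summand, keeping its degree as \<open>f\<close> has degree \<open>0\<close>.
\<close>

lemma precompose_gr_hom:
  assumes M: "degreewise_module M" and M': "degreewise_module M'" and N: "multigraded_module N"
    and f: "f \<in> gr_homs M M' 0"
  shows "(\<lambda>u. compose (carrier M) u f) \<in> gr_homs (Hom_module M' N) (Hom_module M N) 0"
proof -
  interpret H: graded_hom M N using M N by (rule graded_hom.intro)
  interpret H': graded_hom M' N using M' N by (rule graded_hom.intro)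
  note fD = module_homD[OF gr_homsD(1)[OF f]]
  show ?thesis
  proof (intro gr_homsI module_homI)
    fix u assume u: "u \<in> carrier (Hom_module M' N)"
    show "compose (carrier M) u f \<in> carrier (Hom_module M N)"
    proof -
      obtain D g where g: "finite D" "\<And>b. b \<in> D \<Longrightarrow> g b \<in> gr_homs M' N b" "u = (\<lambda>m\<in>carrier M'. \<Oplus>\<^bsub>N\<^esub>b\<in>D. g b m)"
        using u unfolding H'.Hom_carrier by blast
      have "compose (carrier M) u f = (\<lambda>m\<in>carrier M. \<Oplus>\<^bsub>N\<^esub>b\<in>D. g b (f m))"
        unfolding compose_def g(3) using fD(1) by (intro restrict_ext) simp
      moreover have "(\<lambda>m. g b (f m)) \<in> gr_homs M N b" if "b \<in> D" for b
        using gr_homs_comp[OF f g(2)[OF that]] by simp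
      ultimately show ?thesis
        unfolding H.Hom_carrier using g(1) by (intro CollectI exI[of _ D] exI[of _ "\<lambda>b m. g b (f m)"]) auto
    qed
    show "compose (carrier M) (s \<odot>\<^bsub>Hom_module M' N\<^esub> u) f = s \<odot>\<^bsub>Hom_module M N\<^esub> compose (carrier M) u f" for s
      unfolding compose_def H.Hom_simps H'.Hom_simps using fD(1) by (intro restrict_ext) simp
    show "compose (carrier M) (u \<oplus>\<^bsub>Hom_module M' N\<^esub> v) f =
        compose (carrier M) u f \<oplus>\<^bsub>Hom_module M N\<^esub> compose (carrier M) v f" for v
      unfolding compose_def H.Hom_simps H'.Hom_simps using fD(1) by (intro restrict_ext) simp
  next
    fix b u assume "u \<in> hcomp (Hom_module M' N) b"
    then have "u \<in> gr_homs M' N b" by (simp add: H'.Hom_simps)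
    then have "(\<lambda>m. u (f m)) \<in> gr_homs M N b" using gr_homs_comp[OF f] by fastforce
    then show "compose (carrier M) u f \<in> hcomp (Hom_module M N) (b + 0)"
      using H.restrict_gr_homs unfolding compose_def H.Hom_simps by fastforce
  qed
qed

section \<open>Homotopy invariance of cohomology\<close>

definition cochain_complex :: "(nat \<Rightarrow> ('n::finite, 'k::field, 'm) gr_mod) \<Rightarrow> (nat \<Rightarrow> 'm \<Rightarrow> 'm) \<Rightarrow> bool" where
  "cochain_complex C d \<longleftrightarrow> (\<forall>i. degreewise_module (C i)) \<and> (\<forall>i. d i \<in> gr_homs (C i) (C (Suc i)) 0) \<and>
     (\<forall>i. \<forall>x \<in> carrier (C i). d (Suc i) (d i x) = \<zero>\<^bsub>C (Suc (Suc i))\<^esub>)"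

definition cocycles :: "(nat \<Rightarrow> ('n::finite, 'k::field, 'm) gr_mod) \<Rightarrow> (nat \<Rightarrow> 'm \<Rightarrow> 'm) \<Rightarrow> nat \<Rightarrow> 'm set" where
  "cocycles C d i = {z \<in> carrier (C i). d i z = \<zero>\<^bsub>C (Suc i)\<^esub>}"

definition coboundaries :: "(nat \<Rightarrow> ('n::finite, 'k::field, 'm) gr_mod) \<Rightarrow> (nat \<Rightarrow> 'm \<Rightarrow> 'm) \<Rightarrow> nat \<Rightarrow> 'm set" where
  "coboundaries C d i = (case i of 0 \<Rightarrow> {\<zero>\<^bsub>C 0\<^esub>} | Suc j \<Rightarrow> d j ` carrier (C j))"

definition cochain_map ::
    "(nat \<Rightarrow> ('n::finite, 'k::field, 'p) gr_mod) \<Rightarrow> (nat \<Rightarrow> 'p \<Rightarrow> 'p) \<Rightarrow>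
     (nat \<Rightarrow> ('n, 'k, 'q) gr_mod) \<Rightarrow> (nat \<Rightarrow> 'q \<Rightarrow> 'q) \<Rightarrow> (nat \<Rightarrow> 'p \<Rightarrow> 'q) \<Rightarrow> bool" where
  "cochain_map C d D e f \<longleftrightarrow> (\<forall>i. f i \<in> gr_homs (C i) (D i) 0) \<and>
     (\<forall>i. \<forall>x \<in> carrier (C i). e i (f i x) = f (Suc i) (d i x))"

text \<open>
  A homotopy from \<open>g \<circ> f\<close> to the identity, lowering cohomological degrees.
\<close>

definition cochain_retraction ::
    "(nat \<Rightarrow> ('n::finite, 'k::field, 'p) gr_mod) \<Rightarrow> (nat \<Rightarrow> 'p \<Rightarrow> 'p) \<Rightarrow> (nat \<Rightarrow> 'p \<Rightarrow> 'q) \<Rightarrow> (nat \<Rightarrow> 'q \<Rightarrow> 'p) \<Rightarrow>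
     (nat \<Rightarrow> 'p \<Rightarrow> 'p) \<Rightarrow> bool" where
  "cochain_retraction C d f g h \<longleftrightarrow>
     (\<forall>i. h i \<in> module_hom mpoly_ring (C (Suc i)) (C i)) \<and>
     (\<forall>x \<in> carrier (C 0). h 0 (d 0 x) = g 0 (f 0 x) \<ominus>\<^bsub>C 0\<^esub> x) \<and>
     (\<forall>i. \<forall>x \<in> carrier (C (Suc i)).
        d i (h i x) \<oplus>\<^bsub>C (Suc i)\<^esub> h (Suc i) (d (Suc i) x) = g (Suc i) (f (Suc i) x) \<ominus>\<^bsub>C (Suc i)\<^esub> x)"

lemma cochain_homology_eq:
  "cochain_homology C d i = quot_module (sub_module (C i) (cocycles C d i)) (coboundaries C d i)"
  by (simp add: cochain_homology_def cocycles_def coboundaries_def)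

lemma cochain_complexD:
  assumes "cochain_complex C d"
  shows "degreewise_module (C i)" "mpoly_module (C i)" "d i \<in> module_hom mpoly_ring (C i) (C (Suc i))"
    "x \<in> carrier (C i) \<Longrightarrow> d (Suc i) (d i x) = \<zero>\<^bsub>C (Suc (Suc i))\<^esub>"
  using assms degreewise_module.axioms(1) gr_homsD(1) unfolding cochain_complex_def by blast+

lemma cocycles_submodule:
  assumes C: "cochain_complex C d" shows "submodule mpoly_ring (cocycles C d i) (C i)"
  unfolding cocycles_def
  using module_hom_kernel[OF cochain_complexD(2)[OF C] cochain_complexD(2)[OF C] cochain_complexD(3)[OF C]] .

lemma coboundaries_submodule:
  assumes C: "cochain_complex C d" shows "submodule mpoly_ring (coboundaries C d i) (C i)"
proof (cases i)
  case 0
  interpret mpoly_module "C 0" using cochain_complexD(2)[OF C] .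
  show ?thesis unfolding 0 coboundaries_def by (auto intro!: submodule.intro mpoly_module)
next
  case (Suc j)
  show ?thesis
    unfolding Suc coboundaries_def nat.case
    using module_hom_image[OF cochain_complexD(2)[OF C] cochain_complexD(2)[OF C] cochain_complexD(3)[OF C]] .
qed

lemma coboundaries_cocycles:
  assumes C: "cochain_complex C d" shows "coboundaries C d i \<subseteq> cocycles C d i"
proof (cases i)
  case 0
  interpret mpoly_module "C 0" using cochain_complexD(2)[OF C] .
  show ?thesis
    using module_hom_zero_minus(1)[OF cochain_complexD(2)[OF C] cochain_complexD(2)[OF C] cochain_complexD(3)[OF C]]
    unfolding 0 coboundaries_def cocycles_def by simp
next
  case (Suc j)
  then show ?thesis
    using module_homD(1)[OF cochain_complexD(3)[OF C]] cochain_complexD(4)[OF C]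
    by (auto simp: coboundaries_def cocycles_def)
qed

lemma cochain_homology_degreewise:
  assumes C: "cochain_complex C d" shows "degreewise_module (cochain_homology C d i)"
  unfolding cochain_homology_eq
  by (intro quot_degreewise sub_degreewise submodule_sub_module cochain_complexD(1)[OF C]
    degreewise_module.axioms(1)[OF cochain_complexD(1)[OF C], THEN mpoly_module.mpoly_module]
    cocycles_submodule[OF C] coboundaries_submodule[OF C] coboundaries_cocycles[OF C])

lemma cochain_mapD:
  assumes "cochain_map C d D e f"
  shows "f i \<in> gr_homs (C i) (D i) 0" "f i \<in> module_hom mpoly_ring (C i) (D i)"
    "x \<in> carrier (C i) \<Longrightarrow> e i (f i x) = f (Suc i) (d i x)"
  using assms gr_homsD(1) unfolding cochain_map_def by blast+

lemma cochain_map_cocycles: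
  assumes C: "cochain_complex C d" and D: "cochain_complex D e" and f: "cochain_map C d D e f"
    and z: "z \<in> cocycles C d i"
  shows "f i z \<in> cocycles D e i"
  using z module_homD(1)[OF cochain_mapD(2)[OF f]] cochain_mapD(3)[OF f]
    module_hom_zero_minus(1)[OF cochain_complexD(2)[OF C] cochain_complexD(2)[OF D] cochain_mapD(2)[OF f]]
  by (auto simp: cocycles_def)

lemma cochain_map_coboundaries:
  assumes C: "cochain_complex C d" and D: "cochain_complex D e" and f: "cochain_map C d D e f"
    and z: "z \<in> coboundaries C d i"
  shows "f i z \<in> coboundaries D e i"
  using z module_homD(1)[OF cochain_mapD(2)[OF f]] cochain_mapD(3)[OF f, symmetric]
    module_hom_zero_minus(1)[OF cochain_complexD(2)[OF C] cochain_complexD(2)[OF D] cochain_mapD(2)[OF f]]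
  by (cases i) (auto simp: coboundaries_def)

lemma cochain_retraction_on_cocycles:
  assumes C: "cochain_complex C d" and h: "cochain_retraction C d f g h" and z: "z \<in> cocycles C d i"
  shows "g i (f i z) \<ominus>\<^bsub>C i\<^esub> z \<in> coboundaries C d i"
proof -
  have hh: "h j \<in> module_hom mpoly_ring (C (Suc j)) (C j)" for j
    using h unfolding cochain_retraction_def by blast
  note h0 = module_hom_zero_minus(1)[OF cochain_complexD(2)[OF C] cochain_complexD(2)[OF C] hh]
  have zC: "z \<in> carrier (C i)" and dz: "d i z = \<zero>\<^bsub>C (Suc i)\<^esub>" using z by (auto simp: cocycles_def)
  show ?thesis
  proof (cases i)
    case 0
    have "h 0 (d 0 z) = g 0 (f 0 z) \<ominus>\<^bsub>C 0\<^esub> z"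
      using h zC 0 unfolding cochain_retraction_def by blast
    then show ?thesis using dz h0 0 by (simp add: coboundaries_def)
  next
    case (Suc j)
    interpret Cj: mpoly_module "C (Suc j)" using cochain_complexD(2)[OF C] .
    have "d j (h j z) \<oplus>\<^bsub>C (Suc j)\<^esub> h (Suc j) (d (Suc j) z) = g (Suc j) (f (Suc j) z) \<ominus>\<^bsub>C (Suc j)\<^esub> z"
      using h zC Suc unfolding cochain_retraction_def by blast
    moreover have hz: "h j z \<in> carrier (C j)" using zC Suc module_homD(1)[OF hh] by blast
    moreover have "d j (h j z) \<in> carrier (C (Suc j))"
      using hz module_homD(1)[OF cochain_complexD(3)[OF C]] by blast
    ultimately have "g (Suc j) (f (Suc j) z) \<ominus>\<^bsub>C (Suc j)\<^esub> z = d j (h j z)"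
      using dz h0 Suc by simp
    then show ?thesis using hz Suc by (simp add: coboundaries_def)
  qed
qed

theorem cochain_homology_dim_eq:
  assumes C: "cochain_complex C d" and D: "cochain_complex D e"
    and f: "cochain_map C d D e f" and g: "cochain_map D e C d g"
    and h: "cochain_retraction C d f g h" and h': "cochain_retraction D e g f h'"
  shows "hcomp_dim (cochain_homology C d i) b = hcomp_dim (cochain_homology D e i) b"
  unfolding cochain_homology_eq
proof (rule hcomp_dim_quot_eq[where \<phi> = "f i" and \<psi> = "g i"])
  note cycles_C = submodule.subset[OF cocycles_submodule[OF C], THEN subsetD]
  show "f i z \<in> cocycles D e i \<inter> hcomp (D i) b" if "z \<in> cocycles C d i" "z \<in> hcomp (C i) b" for z
    using cochain_map_cocycles[OF C D f that(1)] gr_homs_0D[OF cochain_mapD(1)[OF f] that(2)] by blast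
  show "g i z \<in> cocycles C d i \<inter> hcomp (C i) b" if "z \<in> cocycles D e i" "z \<in> hcomp (D i) b" for z
    using cochain_map_cocycles[OF D C g that(1)] gr_homs_0D[OF cochain_mapD(1)[OF g] that(2)] by blast
  show "f i (z \<oplus>\<^bsub>C i\<^esub> w) = f i z \<oplus>\<^bsub>D i\<^esub> f i w"
    if "z \<in> cocycles C d i" "w \<in> cocycles C d i" for z w
    using module_homD(2)[OF cochain_mapD(2)[OF f]] that cycles_C by blast
  show "f i (const c \<odot>\<^bsub>C i\<^esub> z) = const c \<odot>\<^bsub>D i\<^esub> f i z" if "z \<in> cocycles C d i" for z c
    using module_homD(3)[OF cochain_mapD(2)[OF f]] that cycles_C by blast
  show "f i z \<in> coboundaries D e i" if "z \<in> coboundaries C d i" for z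
    using cochain_map_coboundaries[OF C D f that] .
  show "g i z \<in> coboundaries C d i" if "z \<in> coboundaries D e i" for z
    using cochain_map_coboundaries[OF D C g that] .
  show "g i (f i z) \<ominus>\<^bsub>C i\<^esub> z \<in> coboundaries C d i" if "z \<in> cocycles C d i" for z
    using cochain_retraction_on_cocycles[OF C h that] .
  show "f i (g i z) \<ominus>\<^bsub>D i\<^esub> z \<in> coboundaries D e i" if "z \<in> cocycles D e i" for z
    using cochain_retraction_on_cocycles[OF D h' that] .
qed (use C D in \<open>auto intro: cochain_complexD(1) cocycles_submodule coboundaries_submodule
    coboundaries_cocycles[THEN subsetD]\<close>)

section \<open>Contravariance of Hom\<close>

locale hom_complex = N: multigraded_module N
  for N :: "('n::finite, 'k::field, 'p) gr_mod"
begin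

lemma homI: "degreewise_module M \<Longrightarrow> graded_hom M N"
  by (intro graded_hom.intro N.multigraded_module_axioms)

abbreviation dual_d :: "(nat \<Rightarrow> ('n, 'k, 'm) gr_mod) \<Rightarrow> (nat \<Rightarrow> 'm \<Rightarrow> 'm) \<Rightarrow> nat \<Rightarrow> ('m \<Rightarrow> 'p) \<Rightarrow> 'm \<Rightarrow> 'p" where
  "dual_d P d \<equiv> \<lambda>j f. compose (carrier (P (Suc j))) f (d j)"

lemma cochain_complex_Hom:
  assumes P: "chain_complex P d"
  shows "cochain_complex (\<lambda>i. Hom_module (P i) N) (dual_d P d)"
  unfolding cochain_complex_def
proof (intro conjI allI ballI)
  fix i
  note D = chain_complexD(1)[OF P] and dD = module_homD[OF chain_complexD(4)[OF P]]
  show "degreewise_module (Hom_module (P i) N)"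
    by (rule graded_hom.Hom_degreewise[OF homI[OF D]])
  show "(\<lambda>f. compose (carrier (P (Suc i))) f (d i)) \<in> gr_homs (Hom_module (P i) N) (Hom_module (P (Suc i)) N) 0"
    by (rule precompose_gr_hom[OF D D N.multigraded_module_axioms chain_complexD(3)[OF P]])
  interpret H: graded_hom "P i" N by (rule homI[OF D])
  interpret H2: graded_hom "P (Suc (Suc i))" N by (rule homI[OF D])
  fix u assume u: "u \<in> carrier (Hom_module (P i) N)"
  show "compose (carrier (P (Suc (Suc i)))) (compose (carrier (P (Suc i))) u (d i)) (d (Suc i)) =
      \<zero>\<^bsub>Hom_module (P (Suc (Suc i))) N\<^esub>"
    unfolding H2.Hom_simps compose_def
    using dD(1) chain_complexD(5)[OF P]
      module_hom_zero_minus(1)[OF chain_complexD(2)[OF P] N.mpoly_module_axioms H.HomD(1)[OF u]]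
    by (intro restrict_ext) simp
qed

lemma cochain_map_Hom:
  assumes P: "chain_complex P d" and Q: "chain_complex Q e" and f: "chain_map P d Q e f"
  shows "cochain_map (\<lambda>i. Hom_module (Q i) N) (dual_d Q e) (\<lambda>i. Hom_module (P i) N) (dual_d P d)
    (\<lambda>i u. compose (carrier (P i)) u (f i))"
  unfolding cochain_map_def
proof (intro conjI allI ballI)
  fix i
  show "(\<lambda>u. compose (carrier (P i)) u (f i)) \<in> gr_homs (Hom_module (Q i) N) (Hom_module (P i) N) 0"
    by (rule precompose_gr_hom[OF chain_complexD(1)[OF P] chain_complexD(1)[OF Q] N.multigraded_module_axioms chain_mapD(1)[OF f]])
  fix u
  show "compose (carrier (P (Suc i))) (compose (carrier (P i)) u (f i)) (d i) =
      compose (carrier (P (Suc i))) (compose (carrier (Q (Suc i))) u (e i)) (f (Suc i))"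
    unfolding compose_def
    using module_homD(1)[OF chain_complexD(4)[OF P]] module_homD(1)[OF chain_mapD(2)[OF f]] chain_mapD(3)[OF f]
    by (intro restrict_ext) simp
qed

lemma cochain_retraction_Hom:
  assumes P: "chain_complex P d" and Q: "chain_complex Q e"
    and f: "chain_map P d Q e f" and g: "chain_map Q e P d g" and h: "retraction_up_to_homotopy P d Q e f g h"
  shows "cochain_retraction (\<lambda>i. Hom_module (P i) N) (dual_d P d)
    (\<lambda>i u. compose (carrier (Q i)) u (g i)) (\<lambda>i u. compose (carrier (P i)) u (f i))
    (\<lambda>i u. compose (carrier (P i)) u (h i))"
  unfolding cochain_retraction_def
proof (intro conjI allI ballI)
  note D = chain_complexD(1)[OF P] and dD = module_homD(1)[OF chain_complexD(4)[OF P]]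
    and fD = module_homD(1)[OF chain_mapD(2)[OF f]] and gD = module_homD(1)[OF chain_mapD(2)[OF g]]
  have hh: "h i \<in> gr_homs (P i) (P (Suc i)) 0" for i
    using h unfolding retraction_up_to_homotopy_def by blast
  note hD = module_homD(1)[OF gr_homsD(1)[OF hh]]
  note H = graded_hom.Hom_degreewise[OF homI[OF D]]
  have hstar: "(\<lambda>u. compose (carrier (P i)) u (h i)) \<in> module_hom mpoly_ring (Hom_module (P (Suc i)) N) (Hom_module (P i) N)" for i
    by (rule gr_homsD(1)[OF precompose_gr_hom[OF D D N.multigraded_module_axioms hh]])
  have dstar: "(\<lambda>u. compose (carrier (P (Suc i))) u (d i)) \<in> module_hom mpoly_ring (Hom_module (P i) N) (Hom_module (P (Suc i)) N)" for i
    by (rule gr_homsD(1)[OF precompose_gr_hom[OF D D N.multigraded_module_axioms chain_complexD(3)[OF P]]])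
  have gfstar: "(\<lambda>u. compose (carrier (P i)) (compose (carrier (Q i)) u (g i)) (f i))
      \<in> module_hom mpoly_ring (Hom_module (P i) N) (Hom_module (P i) N)" for i
    by (rule module_hom_comp[OF gr_homsD(1)[OF precompose_gr_hom] gr_homsD(1)[OF precompose_gr_hom]])
      (auto intro: D chain_complexD(1)[OF Q] N.multigraded_module_axioms chain_mapD(1)[OF f] chain_mapD(1)[OF g])
  show "(\<lambda>u. compose (carrier (P i)) u (h i)) \<in> module_hom mpoly_ring (Hom_module (P (Suc i)) N) (Hom_module (P i) N)" for i
    by (rule hstar)
  note Hadd = module_homD(2) and minus = module_hom_zero_minus(2)[OF chain_complexD(2)[OF P] N.mpoly_module_axioms]
  show "compose (carrier (P 0)) (compose (carrier (P (Suc 0))) u (d 0)) (h 0) =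
      compose (carrier (P 0)) (compose (carrier (Q 0)) u (g 0)) (f 0) \<ominus>\<^bsub>Hom_module (P 0) N\<^esub> u"
    if u: "u \<in> carrier (Hom_module (P 0) N)" for u
  proof -
    interpret H: graded_hom "P 0" N by (rule homI[OF D])
    show ?thesis
    proof (rule H.Hom_eqI)
      show "compose (carrier (P 0)) (compose (carrier (P (Suc 0))) u (d 0)) (h 0) \<in> carrier (Hom_module (P 0) N)"
        by (rule module_homD(1)[OF hstar module_homD(1)[OF dstar u]])
      show "compose (carrier (P 0)) (compose (carrier (Q 0)) u (g 0)) (f 0) \<ominus>\<^bsub>Hom_module (P 0) N\<^esub> u \<in> carrier (Hom_module (P 0) N)"
        by (rule H.H.minus_closed[OF module_homD(1)[OF gfstar u] u])
      fix m assume m: "m \<in> carrier (P 0)"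
      have "d 0 (h 0 m) = g 0 (f 0 m) \<ominus>\<^bsub>P 0\<^esub> m"
        using h m unfolding retraction_up_to_homotopy_def by blast
      then show "compose (carrier (P 0)) (compose (carrier (P (Suc 0))) u (d 0)) (h 0) m =
          (compose (carrier (P 0)) (compose (carrier (Q 0)) u (g 0)) (f 0) \<ominus>\<^bsub>Hom_module (P 0) N\<^esub> u) m"
        using m hD fD gD minus[OF H.HomD(1)[OF u]]
        by (simp add: H.Hom_minus[OF module_homD(1)[OF gfstar u] u] compose_eq)
    qed
  qed
  show "compose (carrier (P (Suc i))) (compose (carrier (P i)) u (h i)) (d i) \<oplus>\<^bsub>Hom_module (P (Suc i)) N\<^esub>
      compose (carrier (P (Suc i))) (compose (carrier (P (Suc (Suc i)))) u (d (Suc i))) (h (Suc i)) =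
      compose (carrier (P (Suc i))) (compose (carrier (Q (Suc i))) u (g (Suc i))) (f (Suc i)) \<ominus>\<^bsub>Hom_module (P (Suc i)) N\<^esub> u"
    if u: "u \<in> carrier (Hom_module (P (Suc i)) N)" for i u
  proof -
    interpret H: graded_hom "P (Suc i)" N by (rule homI[OF D])
    show ?thesis
    proof (rule H.Hom_eqI)
      show "compose (carrier (P (Suc i))) (compose (carrier (P i)) u (h i)) (d i) \<oplus>\<^bsub>Hom_module (P (Suc i)) N\<^esub>
        compose (carrier (P (Suc i))) (compose (carrier (P (Suc (Suc i)))) u (d (Suc i))) (h (Suc i)) \<in> carrier (Hom_module (P (Suc i)) N)"
        by (rule H.H.a_closed[OF module_homD(1)[OF dstar module_homD(1)[OF hstar u]] module_homD(1)[OF hstar module_homD(1)[OF dstar u]]])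
      show "compose (carrier (P (Suc i))) (compose (carrier (Q (Suc i))) u (g (Suc i))) (f (Suc i)) \<ominus>\<^bsub>Hom_module (P (Suc i)) N\<^esub> u
          \<in> carrier (Hom_module (P (Suc i)) N)"
        by (rule H.H.minus_closed[OF module_homD(1)[OF gfstar u] u])
      fix m assume m: "m \<in> carrier (P (Suc i))"
      have "d (Suc i) (h (Suc i) m) \<oplus>\<^bsub>P (Suc i)\<^esub> h i (d i m) = g (Suc i) (f (Suc i) m) \<ominus>\<^bsub>P (Suc i)\<^esub> m"
        using h m unfolding retraction_up_to_homotopy_def by blast
      then have "u (h i (d i m) \<oplus>\<^bsub>P (Suc i)\<^esub> d (Suc i) (h (Suc i) m)) = u (g (Suc i) (f (Suc i) m) \<ominus>\<^bsub>P (Suc i)\<^esub> m)"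
        using m hD dD by (simp add: H.M.a_comm)
      then show "(compose (carrier (P (Suc i))) (compose (carrier (P i)) u (h i)) (d i) \<oplus>\<^bsub>Hom_module (P (Suc i)) N\<^esub>
          compose (carrier (P (Suc i))) (compose (carrier (P (Suc (Suc i)))) u (d (Suc i))) (h (Suc i))) m =
          (compose (carrier (P (Suc i))) (compose (carrier (Q (Suc i))) u (g (Suc i))) (f (Suc i)) \<ominus>\<^bsub>Hom_module (P (Suc i)) N\<^esub> u) m"
        using m hD dD fD gD minus[OF H.HomD(1)[OF u]] module_homD(2)[OF H.HomD(1)[OF u]]
        by (simp add: H.Hom_minus[OF module_homD(1)[OF gfstar u] u] compose_eq H.Hom_simps)
    qed
  qed
qed

end

text \<open>
  Since \<open>Hom\<close> is contravariant, the chain map from \<open>P\<close> to \<open>Q\<close> induces the one from \<open>Hom(Q, N)\<close> to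
  \<open>Hom(P, N)\<close>, and the homotopy on \<open>P\<close> again one on \<open>Hom(P, N)\<close>.
\<close>

theorem hom_cohomology_independent_of_resolution:
  assumes P: "resolution M P d \<epsilon>" and Q: "resolution M Q e \<epsilon>'" and N: "multigraded_module N"
  shows "hcomp_dim (cochain_homology (\<lambda>i. Hom_module (P i) N) (\<lambda>j f. compose (carrier (P (Suc j))) f (d j)) i) b =
    hcomp_dim (cochain_homology (\<lambda>i. Hom_module (Q i) N) (\<lambda>j f. compose (carrier (Q (Suc j))) f (e j)) i) b"
proof -
  interpret hom_complex N using N by (rule hom_complex.intro)
  note cP = resolution.chain_complex[OF P] and cQ = resolution.chain_complex[OF Q]
  obtain f g h h' where fg: "chain_map P d Q e f" "chain_map Q e P d g"
    "retraction_up_to_homotopy P d Q e f g h" "retraction_up_to_homotopy Q e P d g f h'"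
    using resolutions_homotopy_equivalent[OF P Q] by blast
  show ?thesis
    by (rule cochain_homology_dim_eq[OF cochain_complex_Hom[OF cP] cochain_complex_Hom[OF cQ]
          cochain_map_Hom[OF cQ cP fg(2)] cochain_map_Hom[OF cP cQ fg(1)]
          cochain_retraction_Hom[OF cP cQ fg(1,2,3)] cochain_retraction_Hom[OF cQ cP fg(2,1,4)]])
qed

section \<open>Self-duality of the Koszul complex\<close>

text \<open>
  The sign of the product of \<open>e\<^sub>A\<close> and \<open>e\<^sub>B\<close> in the exterior algebra, for the complement \<open>B\<close> of \<open>A\<close>, is
  the product over \<open>a \<in> A\<close> of the signs for moving \<open>e\<^sub>a\<close> past the smaller elements of \<open>B\<close>. Counting all
  smaller elements instead changes the sign by a factor that depends on the size of \<open>A\<close> only, and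
  this factor turns the differential into an operator that is self-adjoint without further signs.
\<close>

definition duality_sign :: "'n::finite set \<Rightarrow> 'a::comm_ring_1" where
  "duality_sign A = (\<Prod>a\<in>A. (- 1) ^ card {i :: 'n. idx i < idx a})"

lemma duality_sign_square: "duality_sign A * duality_sign A = (1 :: 'a::comm_ring_1)"
  unfolding duality_sign_def prod.distrib[symmetric]
  by (intro prod.neutral) (simp flip: power_add mult_2 power_mult)

lemma duality_sign_cases: "duality_sign (A :: 'n::finite set) = (1 :: 'a::comm_ring_1) \<or> duality_sign A = (- 1 :: 'a)"
  unfolding duality_sign_def
proof (induction A rule: infinite_finite_induct)
  case (insert a A)
  have "(- 1) ^ card {i :: 'n. idx i < idx a} = (1 :: 'a) \<or> (- 1) ^ card {i :: 'n. idx i < idx a} = (- 1 :: 'a)"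
    by (cases "even (card {i :: 'n. idx i < idx a})") auto
  then show ?case using insert by auto
qed auto

lemma duality_sign_poly_comp: "p \<in> poly_comp b \<Longrightarrow> duality_sign A * p \<in> poly_comp b"
  using duality_sign_cases[of A, where 'a = "('a, 'b) mpoly"] by (auto intro: poly_comp_uminus)

text \<open>
  The number of elements below \<open>j\<close> is the sum of the numbers of those in \<open>B\<close> and in its complement.
\<close>

lemma duality_sign_insert:
  fixes B :: "'n::finite set"
  assumes "j \<notin> B"
  shows "duality_sign (insert j B) * ksign j (- B) = (duality_sign B * ksign j B :: 'a::comm_ring_1)"
proof -
  have "{i :: 'n. idx i < idx j} = {i \<in> B. idx i < idx j} \<union> {i \<in> - B. idx i < idx j}" by auto
  moreover have "card ({i \<in> B. idx i < idx j} \<union> {i \<in> - B. idx i < idx j}) =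
      card {i \<in> B. idx i < idx j} + card {i \<in> - B. idx i < idx j}"
    by (rule card_Un_disjoint) auto
  ultimately have "(- 1) ^ card {i :: 'n. idx i < idx j} = (ksign j B * ksign j (- B) :: 'a)"
    by (simp add: ksign_def power_add)
  then have "duality_sign (insert j B) = (ksign j B * ksign j (- B) * duality_sign B :: 'a)"
    using assms by (simp add: duality_sign_def)
  then have "duality_sign (insert j B) * ksign j (- B) = (ksign j B * (ksign j (- B) * ksign j (- B)) * duality_sign B :: 'a)"
    by (simp add: mult_ac)
  then show ?thesis by (simp add: ksign_square mult.commute)
qed

definition koszul_pairing :: "(('n::finite, 'k::field) mpoly set \<Rightarrow>\<^sub>0 ('n, 'k) mpoly) \<Rightarrow>
    (('n, 'k) mpoly set \<Rightarrow>\<^sub>0 ('n, 'k) mpoly) \<Rightarrow> ('n, 'k) mpoly" where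
  "koszul_pairing x y = (\<Sum>A\<in>UNIV. duality_sign A * (coord x A * coord y (- A)))"

lemma koszul_pairing_add:
  "koszul_pairing (x + x') y = koszul_pairing x y + koszul_pairing x' y"
  "koszul_pairing x (y + y') = koszul_pairing x y + koszul_pairing x y'"
  by (simp_all add: koszul_pairing_def sum.distrib[symmetric] distrib_left distrib_right)

lemma koszul_pairing_smult:
  "koszul_pairing (Poly_Mapping.map ((*) s) x) y = s * koszul_pairing x y"
  "koszul_pairing x (Poly_Mapping.map ((*) s) y) = s * koszul_pairing x y"
  by (simp_all add: koszul_pairing_def sum_distrib_left mult_ac)

text \<open>
  Both sides are sums over all pairs of a set \<open>A\<close> and an element \<open>j\<close> of \<open>A\<close>: on the left, \<open>d\<close> takes
  \<open>j\<close> out of \<open>A\<close>; on the right, it takes \<open>j\<close> out of the complement of \<open>A - {j}\<close>. The signs agree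
  by \<open>duality_sign_insert\<close>.
\<close>

lemma koszul_pairing_d:
  fixes x y :: "('n::finite, 'k::field) mpoly set \<Rightarrow>\<^sub>0 ('n, 'k) mpoly"
  shows "koszul_pairing (koszul_d x) y = koszul_pairing x (koszul_d y)"
proof -
  let ?L = "Sigma UNIV (\<lambda>B :: 'n set. - B)" and ?R = "Sigma UNIV (\<lambda>A :: 'n set. A)"
  have "koszul_pairing (koszul_d x) y = (\<Sum>B\<in>UNIV. \<Sum>j\<in>- B.
      duality_sign B * ksign j B * (var j * coord x (insert j B) * coord y (- B)))"
    unfolding koszul_pairing_def coord_koszul_d sum_distrib_left sum_distrib_right
    by (simp add: mult_ac)
  also have "\<dots> = (\<Sum>(B, j)\<in>?L. duality_sign B * ksign j B * (var j * coord x (insert j B) * coord y (- B)))"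
    by (rule sum.Sigma) auto
  also have "\<dots> = (\<Sum>(A, j)\<in>?R. duality_sign A * ksign j (- A) * (var j * coord x A * coord y (insert j (- A))))"
  proof (rule sum.reindex_bij_witness[of _ "\<lambda>(A, j). (A - {j}, j)" "\<lambda>(B, j). (insert j B, j)"])
    fix p :: "'n set \<times> 'n" assume p: "p \<in> ?L"
    obtain B j where Bj: "p = (B, j)" by (cases p)
    then have j: "j \<notin> B" using p by auto
    have "- insert j B = - B - {j}" "insert j (- insert j B) = - B" using j by auto
    moreover have "ksign j (- insert j B) = (ksign j (- B) :: ('n, 'k) mpoly)"
      using calculation(1) ksign_remove_self[of j "- B"] by metis
    ultimately show "(case case p of (B, j) \<Rightarrow> (insert j B, j) of
        (A, j) \<Rightarrow> duality_sign A * ksign j (- A) * (var j * coord x A * coord y (insert j (- A)))) =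
      (case p of (B, j) \<Rightarrow> duality_sign B * ksign j B * (var j * coord x (insert j B) * coord y (- B)))"
      unfolding Bj prod.case using duality_sign_insert[OF j, where 'a = "('n, 'k) mpoly"] by (simp only:)
  qed auto
  also have "\<dots> = (\<Sum>A\<in>UNIV. \<Sum>j\<in>A. duality_sign A * ksign j (- A) * (var j * coord x A * coord y (insert j (- A))))"
    by (rule sum.Sigma[symmetric]) auto
  also have "\<dots> = koszul_pairing x (koszul_d y)"
    unfolding koszul_pairing_def coord_koszul_d sum_distrib_left double_complement
    by (simp add: mult_ac)
  finally show ?thesis .
qed

text \<open>
  The degrees of \<open>e\<^sub>A\<close> and of \<open>e\<^sub>B\<close> for the complement \<open>B\<close> of \<open>A\<close> add up to \<open>(1, \<dots>, 1)\<close>. This is the origin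
  of the shift by \<open>1\<close> between Betti and Bass numbers.
\<close>

lemma koszul_pairing_degree:
  assumes x: "x \<in> hcomp (koszul p) c" and y: "y \<in> hcomp (koszul q) e"
  shows "koszul_pairing x y \<in> poly_comp (c + e - 1)"
  unfolding koszul_pairing_def
proof (intro poly_comp_sum duality_sign_poly_comp)
  fix A
  have "coord x A * coord y (- A) \<in> poly_comp ((c - face_degree A) + (e - face_degree (- A)))"
    using x y by (intro poly_comp_mult) (auto simp: koszul_hcomp_iff)
  moreover have "(c - face_degree A) + (e - face_degree (- A)) = c + e - 1"
    by (auto simp: face_degree_def fun_eq_iff)
  ultimately show "coord x A * coord y (- A) \<in> poly_comp (c + e - 1)" by simp
qed

abbreviation koszul_basis :: "'n::finite set \<Rightarrow> (('n, 'k::field) mpoly set \<Rightarrow>\<^sub>0 ('n, 'k) mpoly)" where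
  "koszul_basis A \<equiv> Poly_Mapping.single (label A) 1"

lemma koszul_pairing_basis_left: "koszul_pairing (koszul_basis A) y = duality_sign A * coord y (- A)"
proof -
  have "koszul_pairing (koszul_basis A) y = (\<Sum>B\<in>UNIV. if B = A then duality_sign A * coord y (- A) else 0)"
    unfolding koszul_pairing_def by (intro sum.cong) (auto simp: coord_single)
  then show ?thesis by simp
qed

lemma koszul_pairing_basis_right: "koszul_pairing x (koszul_basis (- A)) = duality_sign A * coord x A"
proof -
  have "koszul_pairing x (koszul_basis (- A)) = (\<Sum>B\<in>UNIV. if B = A then duality_sign A * coord x A else 0)"
    unfolding koszul_pairing_def by (intro sum.cong) (auto simp: coord_single)
  then show ?thesis by simp
qed

lemma koszul_decompose:
  assumes u: "u \<in> carrier (koszul i)"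
  shows "u = (\<Oplus>\<^bsub>koszul i\<^esub>A\<in>{A. card A = i}. coord u A \<odot>\<^bsub>koszul i\<^esub> koszul_basis A)"
proof -
  have car: "coord u A \<odot>\<^bsub>koszul i\<^esub> koszul_basis A \<in> carrier (koszul i)" if "A \<in> {A. card A = i}" for A
    using that by (intro koszul.smult_in) auto
  have "u = (\<Sum>A\<in>{A. card A = i}. coord u A \<odot>\<^bsub>koszul i\<^esub> koszul_basis A)"
  proof (rule coord_ext[OF u koszul.sum_carrier[OF car]])
    fix B
    have "coord (\<Sum>A\<in>{A. card A = i}. coord u A \<odot>\<^bsub>koszul i\<^esub> koszul_basis A) B
        = (\<Sum>A\<in>{A. card A = i}. if A = B then coord u B else 0)"
      unfolding coord_def lookup_sum
      by (intro sum.cong) (auto simp: lookup_map_times lookup_single when_def label_inj)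
    then show "coord u B = coord (\<Sum>A\<in>{A. card A = i}. coord u A \<odot>\<^bsub>koszul i\<^esub> koszul_basis A) B"
      using u unfolding koszul_carrier_iff by simp
  qed
  also have "\<dots> = (\<Oplus>\<^bsub>koszul i\<^esub>A\<in>{A. card A = i}. coord u A \<odot>\<^bsub>koszul i\<^esub> koszul_basis A)"
    by (rule koszul.finsum_eq_sum[symmetric]) (rule car)
  finally show ?thesis .
qed

lemma koszul_multigraded: "multigraded_module (koszul i)"
  by (rule graded_multigraded[OF koszul_graded])

lemma card_complement_eq: "card (- A) = CARD('n) - card (A :: 'n::finite set)"
  by (simp add: Compl_eq_Diff_UNIV card_Diff_subset)

locale koszul_duality = N: multigraded_module N
  for N :: "('n::finite, 'k::field, 'm) gr_mod" +
  fixes p q :: nat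
  assumes sum: "p + q = CARD('n)"
begin

abbreviation Kp :: "('n, 'k, ('n, 'k) mpoly set \<Rightarrow>\<^sub>0 ('n, 'k) mpoly) gr_mod" where "Kp \<equiv> koszul p"
abbreviation Kq :: "('n, 'k, ('n, 'k) mpoly set \<Rightarrow>\<^sub>0 ('n, 'k) mpoly) gr_mod" where "Kq \<equiv> koszul q"

sublocale T: tensor_product Kp N
  by (intro tensor_product.intro koszul_degreewise N.degreewise_module_axioms)

sublocale H: graded_hom Kq N
  by (intro graded_hom.intro koszul_degreewise N.multigraded_module_axioms)

interpretation Kp: multigraded_module Kp by (rule koszul_multigraded)
interpretation Kq: multigraded_module Kq by (rule koszul_multigraded)

text \<open>
  The image of \<open>x \<otimes> n\<close> under the duality isomorphism.
\<close>

definition contract where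
  "contract x n = (\<lambda>y\<in>carrier Kq. koszul_pairing x y \<odot>\<^bsub>N\<^esub> n)"

lemma contract_homogeneous:
  assumes x: "x \<in> hcomp Kp c" and n: "n \<in> hcomp N b"
  shows "contract x n \<in> hcomp (Hom_module Kq N) (c + b - 1)"
proof -
  have nc: "n \<in> carrier N" using n by (rule N.hcomp_carrier)
  have "(\<lambda>y. koszul_pairing x y \<odot>\<^bsub>N\<^esub> n) \<in> gr_homs Kq N (c + b - 1)"
  proof (intro gr_homsI module_homI)
    fix y e assume "y \<in> hcomp Kq e"
    then have "koszul_pairing x y \<odot>\<^bsub>N\<^esub> n \<in> hcomp N ((c + e - 1) + b)"
      using koszul_pairing_degree[OF x] n by (intro N.smult_hcomp)
    moreover have "(c + e - 1) + b = e + (c + b - 1)" by (simp add: fun_eq_iff)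
    ultimately show "koszul_pairing x y \<odot>\<^bsub>N\<^esub> n \<in> hcomp N (e + (c + b - 1))" by simp
  qed (use nc in \<open>simp_all add: koszul_pairing_add koszul_pairing_smult N.smult_plus N.smult_mult\<close>)
  then show ?thesis unfolding H.Hom_simps contract_def by (rule H.restrict_gr_homs)
qed

lemma contract_add_left:
  "n \<in> carrier N \<Longrightarrow> contract (x + x') n = contract x n \<oplus>\<^bsub>Hom_module Kq N\<^esub> contract x' n"
  by (auto simp: contract_def H.Hom_simps koszul_pairing_add N.smult_plus intro!: restrict_ext)

lemma contract_add_right:
  "\<lbrakk>n \<in> carrier N; n' \<in> carrier N\<rbrakk> \<Longrightarrow> contract x (n \<oplus>\<^bsub>N\<^esub> n') = contract x n \<oplus>\<^bsub>Hom_module Kq N\<^esub> contract x n'"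
  by (auto simp: contract_def H.Hom_simps N.smult_add intro!: restrict_ext)

lemma contract_smult_left:
  "n \<in> carrier N \<Longrightarrow> contract (s \<odot>\<^bsub>Kp\<^esub> x) n = s \<odot>\<^bsub>Hom_module Kq N\<^esub> contract x n"
  by (auto simp: contract_def H.Hom_simps koszul_pairing_smult N.smult_mult intro!: restrict_ext)

lemma contract_smult_right:
  "n \<in> carrier N \<Longrightarrow> contract x (s \<odot>\<^bsub>N\<^esub> n) = s \<odot>\<^bsub>Hom_module Kq N\<^esub> contract x n"
  by (auto simp: contract_def H.Hom_simps N.smult_mult[symmetric] mult.commute intro!: restrict_ext)

text \<open>
  An element of the graded \<open>Hom\<close> has to be a sum of homogeneous homomorphisms, so \<open>x\<close> and \<open>n\<close> are decomposed
  into homogeneous elements.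
\<close>

lemma contract_in_Hom:
  assumes x: "x \<in> carrier Kp" and n: "n \<in> carrier N"
  shows "contract x n \<in> carrier (Hom_module Kq N)"
  using n
proof (induction n rule: N.homogeneous_induct)
  case zero
  have "contract x \<zero>\<^bsub>N\<^esub> = \<zero>\<^bsub>Hom_module Kq N\<^esub>" by (simp add: contract_def H.Hom_simps)
  then show ?case using H.zero_in_Hom by simp
next
  case (homogeneous n b)
  then have nc: "n \<in> carrier N" by (rule N.hcomp_carrier)
  show ?case
    using x
  proof (induction x rule: Kp.homogeneous_induct)
    case zero
    have "contract \<zero>\<^bsub>Kp\<^esub> n = \<zero>\<^bsub>Hom_module Kq N\<^esub>"
      using nc by (auto simp: contract_def H.Hom_simps koszul_pairing_def intro!: restrict_ext)
    then show ?case using H.zero_in_Hom by simp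
  next
    case (homogeneous x c)
    then show ?case using contract_homogeneous \<open>n \<in> hcomp N b\<close> H.hcomp_in_Hom by blast
  next
    case (add x x')
    then show ?case using contract_add_left[OF nc, of x x'] H.add_in_Hom by simp
  qed
next
  case (add n n')
  then show ?case using contract_add_right H.add_in_Hom by simp
qed

sublocale c: bilinear_map Kp N "Hom_module Kq N" contract
proof unfold_locales
  show "(\<lambda>x. contract x n) \<in> module_hom mpoly_ring Kp (Hom_module Kq N)" if "n \<in> carrier N" for n
    using that contract_in_Hom contract_add_left contract_smult_left by (intro module_homI) simp_all
  show "(\<lambda>n. contract x n) \<in> module_hom mpoly_ring N (Hom_module Kq N)" if "x \<in> carrier Kp" for x
    using that contract_in_Hom contract_add_right contract_smult_right by (intro module_homI) simp_all
qed

abbreviation to_Hom where "to_Hom \<equiv> c.lift"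

lemma to_Hom_hcomp:
  assumes "z \<in> hcomp (tensor_module Kp N) b" shows "to_Hom z \<in> hcomp (Hom_module Kq N) (b - 1)"
proof (rule lift_hcomp[OF c.bilinear_map_axioms H.Hom_degreewise _ assms])
  show "contract x n \<in> hcomp (Hom_module Kq N) (b - 1)" if "x \<in> hcomp Kp e" "n \<in> hcomp N (b - e)" for x n e
    using contract_homogeneous[OF that] by simp
qed

text \<open>
  The inverse of \<open>to_Hom\<close>: as \<open>K\<^sub>q\<close> is free, a homomorphism is given by its values on the basis, and the element
  dual to \<open>e\<^sub>B\<close> under the pairing is up to sign \<open>e\<^sub>A\<close> for the complement \<open>A\<close> of \<open>B\<close>.
\<close>

definition to_tensor where
  "to_tensor u = (\<Oplus>\<^bsub>tensor_module Kp N\<^esub>A\<in>{A. card A = p}.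
     T.pure_tensor (koszul_basis A) (duality_sign A \<odot>\<^bsub>N\<^esub> u (koszul_basis (- A))))"

lemma card_complement: "card A = p \<Longrightarrow> card (- A) = q" for A :: "'n set"
  using sum by (simp add: card_complement_eq)

lemma basis_p: "card A = p \<Longrightarrow> koszul_basis A \<in> carrier Kp"
  by auto

lemma basis_q: "card A = p \<Longrightarrow> koszul_basis (- A) \<in> carrier Kq"
  using card_complement by auto

lemma eval_hom: "y \<in> carrier Kq \<Longrightarrow> (\<lambda>u. u y) \<in> module_hom mpoly_ring (Hom_module Kq N) N"
  using module_homD(1)[OF H.HomD(1)] by (intro module_homI) (simp_all add: H.Hom_simps)

lemma smult_hom: "(\<lambda>n. s \<odot>\<^bsub>N\<^esub> n) \<in> module_hom mpoly_ring N N"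
  by (rule module_homI) (simp_all add: N.smult_add N.smult_mult[symmetric] mult.commute)

lemma to_tensor_hom: "to_tensor \<in> module_hom mpoly_ring (Hom_module Kq N) (tensor_module Kp N)"
  unfolding to_tensor_def[abs_def]
proof (rule module_hom_finsum_homs[OF T.tensor.mpoly_module_axioms])
  fix A :: "'n set" assume "A \<in> {A. card A = p}"
  then show "(\<lambda>u. T.pure_tensor (koszul_basis A) (duality_sign A \<odot>\<^bsub>N\<^esub> u (koszul_basis (- A))))
      \<in> module_hom mpoly_ring (Hom_module Kq N) (tensor_module Kp N)"
    using module_hom_comp[OF module_hom_comp[OF eval_hom[OF basis_q] smult_hom] T.pure_tensor_hom_right[OF basis_p]]
    by simp
qed simp

lemma to_tensor_hcomp:
  assumes u: "u \<in> hcomp (Hom_module Kq N) (b - 1)" shows "to_tensor u \<in> hcomp (tensor_module Kp N) b"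
  unfolding to_tensor_def
proof (rule T.tensor.hcomp_finsum)
  fix A :: "'n set" assume "A \<in> {A. card A = p}"
  then have A: "card A = p" by simp
  have e: "koszul_basis (- A) \<in> hcomp Kq (face_degree (- A))"
    using basis_hcomp[of "- A"] card_complement[OF A] by simp
  have "u \<in> gr_homs Kq N (b - 1)" using u by (simp add: H.Hom_simps)
  then have "u (koszul_basis (- A)) \<in> hcomp N (face_degree (- A) + (b - 1))"
    by (rule gr_homsD(2)[OF _ e])
  moreover have "face_degree (- A) + (b - 1) = b - face_degree A"
    by (auto simp: face_degree_def fun_eq_iff)
  ultimately have "u (koszul_basis (- A)) \<in> hcomp N (b - face_degree A)" by simp
  then have "duality_sign A \<odot>\<^bsub>N\<^esub> u (koszul_basis (- A)) \<in> hcomp N (0 + (b - face_degree A))"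
    using duality_sign_poly_comp[OF const_poly_comp[of 1], of A] by (intro N.smult_hcomp) simp_all
  then have "T.pure_tensor (koszul_basis A) (duality_sign A \<odot>\<^bsub>N\<^esub> u (koszul_basis (- A)))
      \<in> hcomp (tensor_module Kp N) (face_degree A + (b - face_degree A))"
    using basis_hcomp[of A] A by (intro T.pure_tensor_hcomp) simp_all
  then show "T.pure_tensor (koszul_basis A) (duality_sign A \<odot>\<^bsub>N\<^esub> u (koszul_basis (- A)))
      \<in> hcomp (tensor_module Kp N) b" by simp
qed

lemma to_tensor_to_Hom:
  assumes "z \<in> carrier (tensor_module Kp N)" shows "to_tensor (to_Hom z) = z"
proof (rule T.tensor_hom_eqI[OF T.tensor.mpoly_module_axioms module_hom_comp[OF c.lift_hom to_tensor_hom] module_hom_id _ assms])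
  fix x n assume x: "x \<in> carrier Kp" and n: "n \<in> carrier N"
  have "to_tensor (contract x n) = (\<Oplus>\<^bsub>tensor_module Kp N\<^esub>A\<in>{A. card A = p}.
      T.pure_tensor (coord x A \<odot>\<^bsub>Kp\<^esub> koszul_basis A) n)"
    unfolding to_tensor_def
  proof (rule T.tensor.finsum_cong')
    fix A :: "'n set" assume "A \<in> {A. card A = p}"
    then have A: "card A = p" by simp
    have "duality_sign A \<odot>\<^bsub>N\<^esub> contract x n (koszul_basis (- A)) = coord x A \<odot>\<^bsub>N\<^esub> n"
      using basis_q[OF A] n
      by (simp add: contract_def koszul_pairing_basis_right duality_sign_square
          flip: N.smult_mult mult.assoc del: koszul_simps)
    then show "T.pure_tensor (koszul_basis A) (duality_sign A \<odot>\<^bsub>N\<^esub> contract x n (koszul_basis (- A))) =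
        T.pure_tensor (coord x A \<odot>\<^bsub>Kp\<^esub> koszul_basis A) n"
      using T.pure_tensor_smult_left[OF basis_p[OF A] n] T.pure_tensor_smult_right[OF basis_p[OF A] n]
      by (simp del: koszul_simps)
  qed (use T.pure_tensor_carrier[OF koszul.smult_in[OF basis_p] n] in \<open>auto simp del: koszul_simps\<close>)
  also have "\<dots> = T.pure_tensor (\<Oplus>\<^bsub>Kp\<^esub>A\<in>{A. card A = p}. coord x A \<odot>\<^bsub>Kp\<^esub> koszul_basis A) n"
    using basis_p
    by (intro module_hom_finsum[OF koszul.mpoly_module_axioms T.tensor.mpoly_module_axioms
          T.pure_tensor_hom_left[OF n], symmetric] koszul.smult_in) simp
  also have "\<dots> = T.pure_tensor x n" using koszul_decompose[OF x] by simp
  finally show "to_tensor (to_Hom (T.pure_tensor x n)) = T.pure_tensor x n"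
    using c.lift_pure[OF x n] by simp
qed

lemma to_Hom_to_tensor:
  assumes u: "u \<in> carrier (Hom_module Kq N)" shows "to_Hom (to_tensor u) = u"
proof (rule H.Hom_eqI[OF _ u])
  show "to_Hom (to_tensor u) \<in> carrier (Hom_module Kq N)"
    by (rule module_homD(1)[OF c.lift_hom module_homD(1)[OF to_tensor_hom u]])
  fix y assume y: "y \<in> carrier Kq"
  note uD = module_homD[OF H.HomD(1)[OF u]]
  let ?n = "\<lambda>A. duality_sign A \<odot>\<^bsub>N\<^esub> u (koszul_basis (- A))"
  have n: "?n A \<in> carrier N" if "card A = p" for A
    using uD(1)[OF basis_q[OF that]] by simp
  have eh: "(\<lambda>z. to_Hom z y) \<in> module_hom mpoly_ring (tensor_module Kp N) N"
    by (rule module_hom_comp[OF c.lift_hom eval_hom[OF y]])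
  have "to_Hom (to_tensor u) y = (\<Oplus>\<^bsub>N\<^esub>A\<in>{A. card A = p}. to_Hom (T.pure_tensor (koszul_basis A) (?n A)) y)"
    unfolding to_tensor_def
    by (rule module_hom_finsum[OF T.tensor.mpoly_module_axioms N.mpoly_module_axioms eh])
      (use T.pure_tensor_carrier[OF basis_p n] in simp)
  also have "\<dots> = (\<Oplus>\<^bsub>N\<^esub>A\<in>{A. card A = p}. u (coord y (- A) \<odot>\<^bsub>Kq\<^esub> koszul_basis (- A)))"
  proof (rule N.finsum_cong')
    fix A :: "'n set" assume "A \<in> {A. card A = p}"
    then have A: "card A = p" by simp
    have "to_Hom (T.pure_tensor (koszul_basis A) (?n A)) y = koszul_pairing (koszul_basis A) y \<odot>\<^bsub>N\<^esub> ?n A"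
      using c.lift_pure[OF basis_p[OF A] n[OF A]] y by (simp add: contract_def del: koszul_simps)
    also have "\<dots> = (duality_sign A * duality_sign A * coord y (- A)) \<odot>\<^bsub>N\<^esub> u (koszul_basis (- A))"
      unfolding koszul_pairing_basis_left using uD(1)[OF basis_q[OF A]]
      by (simp add: mult_ac flip: N.smult_mult)
    also have "\<dots> = u (coord y (- A) \<odot>\<^bsub>Kq\<^esub> koszul_basis (- A))"
      using uD(3)[OF basis_q[OF A]] by (simp add: duality_sign_square del: koszul_simps)
    finally show "to_Hom (T.pure_tensor (koszul_basis A) (?n A)) y = u (coord y (- A) \<odot>\<^bsub>Kq\<^esub> koszul_basis (- A))" .
  qed (use uD(1)[OF koszul.smult_in[OF basis_q]] in \<open>auto simp del: koszul_simps\<close>)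
  also have "\<dots> = (\<Oplus>\<^bsub>N\<^esub>B\<in>uminus ` {A. card A = p}. u (coord y B \<odot>\<^bsub>Kq\<^esub> koszul_basis B))"
    by (rule N.add.finprod_reindex[symmetric])
      (use uD(1)[OF koszul.smult_in[OF basis_q]] in \<open>auto simp del: koszul_simps intro: inj_onI\<close>)
  also have "uminus ` {A. card A = p} = {B :: 'n set. card B = q}"
  proof
    show "{B :: 'n set. card B = q} \<subseteq> uminus ` {A. card A = p}"
    proof
      fix B :: "'n set" assume "B \<in> {B. card B = q}"
      then have "card (- B) = p" using sum by (simp add: card_complement_eq)
      then show "B \<in> uminus ` {A. card A = p}" by (intro image_eqI[of _ _ "- B"]) simp_all
    qed
  qed (use card_complement in auto)
  also have "(\<Oplus>\<^bsub>N\<^esub>B\<in>{B. card B = q}. u (coord y B \<odot>\<^bsub>Kq\<^esub> koszul_basis B)) =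
      u (\<Oplus>\<^bsub>Kq\<^esub>B\<in>{B. card B = q}. coord y B \<odot>\<^bsub>Kq\<^esub> koszul_basis B)"
    by (intro module_hom_finsum[OF koszul.mpoly_module_axioms N.mpoly_module_axioms H.HomD(1)[OF u], symmetric] koszul.smult_in) auto
  also have "\<dots> = u y" using koszul_decompose[OF y] by simp
  finally show "to_Hom (to_tensor u) y = u y" .
qed

end

section \<open>Betti and Bass numbers from the Koszul complex\<close>

lemma koszul_trivial: "CARD('n) < i \<Longrightarrow> x \<in> carrier (koszul i) \<Longrightarrow> x = 0"
  for x :: "('n::finite, 'k::field) mpoly set \<Rightarrow>\<^sub>0 ('n, 'k) mpoly"
proof -
  assume i: "CARD('n) < i" and x: "x \<in> carrier (koszul i)"
  have "card A \<noteq> i" for A :: "'n set" using i card_mono[of UNIV A] by auto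
  then have "coord x A = 0" for A using x unfolding koszul_carrier_iff by simp
  then show "x = 0" using x by (intro coord_ext[of x i 0 i]) (auto simp: coord_def)
qed

lemma koszul_chain_complex:
  "chain_complex (koszul :: nat \<Rightarrow> ('n::finite, 'k::field, ('n, 'k) mpoly set \<Rightarrow>\<^sub>0 ('n, 'k) mpoly) gr_mod) (\<lambda>_. koszul_d)"
  by (rule resolution.chain_complex[OF resolution.intro[OF koszul_resolution residue_field_graded]])

context
  fixes N :: "('n::finite, 'k::field, 'm) gr_mod"
  assumes N: "multigraded_module N"
begin

interpretation N: multigraded_module N by (rule N)

abbreviation koszul_tensor where
  "koszul_tensor i \<equiv> tensor_module (koszul i :: ('n, 'k, ('n, 'k) mpoly set \<Rightarrow>\<^sub>0 ('n, 'k) mpoly) gr_mod) N"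

abbreviation koszul_tensor_d where
  "koszul_tensor_d i \<equiv> tensor_map (koszul i :: ('n, 'k, ('n, 'k) mpoly set \<Rightarrow>\<^sub>0 ('n, 'k) mpoly) gr_mod) N koszul_d"

abbreviation koszul_Hom where
  "koszul_Hom i \<equiv> Hom_module (koszul i :: ('n, 'k, ('n, 'k) mpoly set \<Rightarrow>\<^sub>0 ('n, 'k) mpoly) gr_mod) N"

abbreviation koszul_Hom_d where
  "koszul_Hom_d i f \<equiv> compose (carrier (koszul (Suc i) :: ('n, 'k, ('n, 'k) mpoly set \<Rightarrow>\<^sub>0 ('n, 'k) mpoly) gr_mod)) f koszul_d"

lemma tensor_complex: "chain_complex koszul_tensor koszul_tensor_d"
  using tensor_complex.chain_complex_tensor[OF tensor_complex.intro[OF N.degreewise_module_axioms] koszul_chain_complex] .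

lemma Hom_complex: "cochain_complex koszul_Hom koszul_Hom_d"
  using hom_complex.cochain_complex_Hom[OF hom_complex.intro[OF N] koszul_chain_complex] .

lemma tensor_trivial:
  assumes "CARD('n) < i" "z \<in> carrier (koszul_tensor i)" shows "z = \<zero>\<^bsub>koszul_tensor i\<^esub>"
proof -
  interpret T: tensor_product "koszul i :: ('n, 'k, ('n, 'k) mpoly set \<Rightarrow>\<^sub>0 ('n, 'k) mpoly) gr_mod" N
    by (intro tensor_product.intro koszul_degreewise N.degreewise_module_axioms)
  have zero: "(\<lambda>_. \<zero>\<^bsub>koszul_tensor i\<^esub>) \<in> module_hom mpoly_ring (koszul_tensor i) (koszul_tensor i)"
    by (rule module_homI) simp_all
  show ?thesis
  proof (rule T.tensor_hom_eqI[OF T.tensor.mpoly_module_axioms module_hom_id zero _ assms(2)])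
    fix x n assume xn: "x \<in> carrier (koszul i :: ('n, 'k, ('n, 'k) mpoly set \<Rightarrow>\<^sub>0 ('n, 'k) mpoly) gr_mod)" "n \<in> carrier N"
    have "x = \<zero>\<^bsub>koszul i\<^esub>" using koszul_trivial[OF assms(1) xn(1)] by simp
    then show "T.pure_tensor x n = \<zero>\<^bsub>koszul_tensor i\<^esub>"
      using module_hom_zero_minus(1)[OF koszul.mpoly_module_axioms T.tensor.mpoly_module_axioms
        T.pure_tensor_hom_left[OF xn(2)]] by (simp del: koszul_simps)
  qed
qed

lemma Hom_trivial:
  assumes "CARD('n) < i" "u \<in> carrier (koszul_Hom i)" shows "u = \<zero>\<^bsub>koszul_Hom i\<^esub>"
proof -
  interpret H: graded_hom "koszul i :: ('n, 'k, ('n, 'k) mpoly set \<Rightarrow>\<^sub>0 ('n, 'k) mpoly) gr_mod" N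
    by (intro graded_hom.intro koszul_degreewise N)
  show ?thesis
  proof (rule H.Hom_eqI[OF assms(2) H.zero_in_Hom])
    fix x assume x: "x \<in> carrier (koszul i :: ('n, 'k, ('n, 'k) mpoly set \<Rightarrow>\<^sub>0 ('n, 'k) mpoly) gr_mod)"
    then have "x = \<zero>\<^bsub>koszul i\<^esub>" using koszul_trivial[OF assms(1)] by simp
    then show "u x = \<zero>\<^bsub>koszul_Hom i\<^esub> x"
      using x module_hom_zero_minus(1)[OF koszul.mpoly_module_axioms N.mpoly_module_axioms H.HomD(1)[OF assms(2)]]
      by (simp add: H.Hom_simps del: koszul_simps)
  qed
qed

text \<open>
  On a pure tensor \<open>x \<otimes> n\<close> this is the self-adjointness of the differential for the pairing.
\<close>

lemma duality_commutes:
  assumes "Suc p + q = CARD('n)" and z: "z \<in> carrier (koszul_tensor (Suc p))"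
  shows "koszul_duality.to_Hom N p (Suc q) (koszul_tensor_d p z) =
    koszul_Hom_d q (koszul_duality.to_Hom N (Suc p) q z)"
proof -
  interpret A: koszul_duality N "Suc p" q
    by (intro koszul_duality.intro koszul_duality_axioms.intro N assms(1))
  interpret B: koszul_duality N p "Suc q"
    by (intro koszul_duality.intro koszul_duality_axioms.intro N) (use assms(1) in simp)
  note d = gr_homsD(1)[OF koszul_d_hom]
  interpret t: tensor_functor "koszul (Suc p)" "koszul p" N koszul_d
    by (intro tensor_functor.intro tensor_functor_axioms.intro tensor_product.intro koszul_degreewise
        N.degreewise_module_axioms d)
  have dH: "koszul_Hom_d q \<in> module_hom mpoly_ring (koszul_Hom q) (koszul_Hom (Suc q))"
    by (rule cochain_complexD(3)[OF Hom_complex])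
  show ?thesis
  proof (rule A.T.tensor_hom_eqI[OF B.H.H.mpoly_module_axioms module_hom_comp[OF t.tensor_map_hom B.c.lift_hom]
        module_hom_comp[OF A.c.lift_hom dH] _ z])
    fix x n assume x: "x \<in> carrier A.Kp" and n: "n \<in> carrier N"
    have "B.contract (koszul_d x) n = koszul_Hom_d q (A.contract x n)"
      unfolding A.contract_def B.contract_def compose_def
      by (intro restrict_ext) (simp add: koszul_pairing_d koszul_d_carrier del: koszul_simps)
    then show "B.to_Hom (koszul_tensor_d p (A.T.pure_tensor x n)) = koszul_Hom_d q (A.to_Hom (A.T.pure_tensor x n))"
      using x n by (simp add: t.tensor_map_pure A.c.lift_pure B.c.lift_pure koszul_d_carrier del: koszul_simps)
  qed
qed

text \<open>
  The duality isomorphism matches cycles with cocycles and boundaries with coboundaries. At the ends of the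
  complex it does so because \<open>K\<close> vanishes beyond \<open>n\<close>: for \<open>p = 0\<close> every element is a cycle, and every
  element of \<open>Hom(K\<^sub>n, N)\<close> is a cocycle; for \<open>q = 0\<close> all boundaries and coboundaries are zero.
\<close>

theorem koszul_duality_dim:
  assumes pq: "p + q = CARD('n)"
  shows "hcomp_dim (chain_homology koszul_tensor koszul_tensor_d p) b =
    hcomp_dim (cochain_homology koszul_Hom koszul_Hom_d q) (b - 1)"
  unfolding chain_homology_eq cochain_homology_eq
proof -
  interpret D: koszul_duality N p q by (intro koszul_duality.intro koszul_duality_axioms.intro N pq)
  note tc = tensor_complex and hc = Hom_complex
  note hom = module_homD[OF D.c.lift_hom] and tens = module_homD[OF D.to_tensor_hom]
  have hom0: "D.to_Hom \<zero>\<^bsub>koszul_tensor p\<^esub> = \<zero>\<^bsub>koszul_Hom q\<^esub>"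
    by (rule module_hom_zero_minus(1)[OF D.T.tensor.mpoly_module_axioms D.H.H.mpoly_module_axioms D.c.lift_hom])
  have tens0: "D.to_tensor \<zero>\<^bsub>koszul_Hom q\<^esub> = \<zero>\<^bsub>koszul_tensor p\<^esub>"
    by (rule module_hom_zero_minus(1)[OF D.H.H.mpoly_module_axioms D.T.tensor.mpoly_module_axioms D.to_tensor_hom])
  have cycles: "D.to_Hom z \<in> cocycles koszul_Hom koszul_Hom_d q \<longleftrightarrow> z \<in> chain_cycles koszul_tensor koszul_tensor_d p"
    if z: "z \<in> carrier (koszul_tensor p)" for z
  proof (cases p)
    case 0
    have "koszul_Hom_d q (D.to_Hom z) \<in> carrier (koszul_Hom (Suc q))"
      using module_homD(1)[OF cochain_complexD(3)[OF hc] hom(1)[OF z]] .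
    then have "koszul_Hom_d q (D.to_Hom z) = \<zero>\<^bsub>koszul_Hom (Suc q)\<^esub>"
      using pq 0 by (intro Hom_trivial) simp_all
    then show ?thesis using z 0 hom(1)[OF z] by (simp add: cocycles_def chain_cycles_def)
  next
    case (Suc p')
    interpret B: koszul_duality N p' "Suc q"
      by (intro koszul_duality.intro koszul_duality_axioms.intro N) (use pq Suc in simp)
    have dz: "koszul_tensor_d p' z \<in> carrier (koszul_tensor p')"
      using module_homD(1)[OF chain_complexD(4)[OF tc]] z Suc by blast
    have "koszul_Hom_d q (D.to_Hom z) = B.to_Hom (koszul_tensor_d p' z)"
      using duality_commutes[of p' q z] pq z Suc by simp
    moreover have "B.to_Hom (koszul_tensor_d p' z) = \<zero>\<^bsub>koszul_Hom (Suc q)\<^esub> \<longleftrightarrow> koszul_tensor_d p' z = \<zero>\<^bsub>koszul_tensor p'\<^esub>"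
      using B.to_tensor_to_Hom[OF dz]
        module_hom_zero_minus(1)[OF B.H.H.mpoly_module_axioms B.T.tensor.mpoly_module_axioms B.to_tensor_hom]
        module_hom_zero_minus(1)[OF B.T.tensor.mpoly_module_axioms B.H.H.mpoly_module_axioms B.c.lift_hom]
      by metis
    ultimately show ?thesis using z hom(1)[OF z] Suc by (simp add: cocycles_def chain_cycles_def)
  qed
  have bounds: "D.to_Hom ` (koszul_tensor_d p ` carrier (koszul_tensor (Suc p))) = coboundaries koszul_Hom koszul_Hom_d q"
  proof (cases q)
    case 0
    interpret T1: mpoly_module "koszul_tensor (Suc p)" by (rule chain_complexD(2)[OF tc])
    have "w = \<zero>\<^bsub>koszul_tensor (Suc p)\<^esub>" if "w \<in> carrier (koszul_tensor (Suc p))" for w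
      by (rule tensor_trivial[OF _ that]) (use pq 0 in simp)
    then have "carrier (koszul_tensor (Suc p)) = {\<zero>\<^bsub>koszul_tensor (Suc p)\<^esub>}"
      using T1.zero_closed by blast
    moreover have "koszul_tensor_d p \<zero>\<^bsub>koszul_tensor (Suc p)\<^esub> = \<zero>\<^bsub>koszul_tensor p\<^esub>"
      by (rule module_hom_zero_minus(1)[OF chain_complexD(2)[OF tc] chain_complexD(2)[OF tc] chain_complexD(4)[OF tc]])
    ultimately have "koszul_tensor_d p ` carrier (koszul_tensor (Suc p)) = {\<zero>\<^bsub>koszul_tensor p\<^esub>}"
      by (simp only: image_insert image_empty)
    then show ?thesis using hom0 0 by (simp add: coboundaries_def)
  next
    case (Suc q')
    interpret B: koszul_duality N "Suc p" q'
      by (intro koszul_duality.intro koszul_duality_axioms.intro N) (use pq Suc in simp)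
    have comm: "D.to_Hom (koszul_tensor_d p w) = koszul_Hom_d q' (B.to_Hom w)"
      if "w \<in> carrier (koszul_tensor (Suc p))" for w
      using duality_commutes[of p q' w] pq Suc that by simp
    have onto: "B.to_Hom ` carrier (koszul_tensor (Suc p)) = carrier (koszul_Hom q')"
    proof
      show "B.to_Hom ` carrier (koszul_tensor (Suc p)) \<subseteq> carrier (koszul_Hom q')"
        using module_homD(1)[OF B.c.lift_hom] by blast
      show "carrier (koszul_Hom q') \<subseteq> B.to_Hom ` carrier (koszul_tensor (Suc p))"
      proof
        fix u assume u: "u \<in> carrier (koszul_Hom q')"
        then show "u \<in> B.to_Hom ` carrier (koszul_tensor (Suc p))"
          using B.to_Hom_to_tensor[OF u] module_homD(1)[OF B.to_tensor_hom u] by (metis imageI)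
      qed
    qed
    have "D.to_Hom ` (koszul_tensor_d p ` carrier (koszul_tensor (Suc p))) =
        (\<lambda>w. koszul_Hom_d q' (B.to_Hom w)) ` carrier (koszul_tensor (Suc p))"
      unfolding image_image using comm by (intro image_cong) simp_all
    also have "\<dots> = koszul_Hom_d q' ` carrier (koszul_Hom q')" unfolding onto[symmetric] by (simp add: image_image)
    finally show ?thesis using Suc by (simp add: coboundaries_def)
  qed
  have Zc: "z \<in> carrier (koszul_tensor p)" if "z \<in> chain_cycles koszul_tensor koszul_tensor_d p" for z
    using submodule.subset[OF chain_cycles_submodule[OF tc]] that by blast
  have Bc: "z \<in> carrier (koszul_tensor p)" if "z \<in> koszul_tensor_d p ` carrier (koszul_tensor (Suc p))" for z
    using submodule.subset[OF chain_boundaries_submodule[OF tc]] that by blast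
  have Uc: "u \<in> carrier (koszul_Hom q)" if "u \<in> cocycles koszul_Hom koszul_Hom_d q" for u
    using that by (simp add: cocycles_def)
  show "hcomp_dim (quot_module (sub_module (koszul_tensor p) (chain_cycles koszul_tensor koszul_tensor_d p))
        (koszul_tensor_d p ` carrier (koszul_tensor (Suc p)))) b =
      hcomp_dim (quot_module (sub_module (koszul_Hom q) (cocycles koszul_Hom koszul_Hom_d q))
        (coboundaries koszul_Hom koszul_Hom_d q)) (b - 1)"
  proof (rule hcomp_dim_quot_eq[where \<phi> = D.to_Hom and \<psi> = D.to_tensor,
        OF chain_complexD(1)[OF tc] chain_cycles_submodule[OF tc] chain_boundaries_submodule[OF tc]
          chain_boundaries_cycles[OF tc] cochain_complexD(1)[OF hc] cocycles_submodule[OF hc]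
          coboundaries_submodule[OF hc] coboundaries_cocycles[OF hc]])
    show "D.to_Hom z \<in> cocycles koszul_Hom koszul_Hom_d q \<inter> hcomp (koszul_Hom q) (b - 1)"
      if "z \<in> chain_cycles koszul_tensor koszul_tensor_d p" "z \<in> hcomp (koszul_tensor p) b" for z
      using cycles[OF Zc] that D.to_Hom_hcomp by blast
    show "D.to_tensor u \<in> chain_cycles koszul_tensor koszul_tensor_d p \<inter> hcomp (koszul_tensor p) b"
      if "u \<in> cocycles koszul_Hom koszul_Hom_d q" "u \<in> hcomp (koszul_Hom q) (b - 1)" for u
      using cycles[OF tens(1)[OF Uc[OF that(1)]]] D.to_Hom_to_tensor[OF Uc[OF that(1)]] that D.to_tensor_hcomp by simp
    show "D.to_Hom (z \<oplus>\<^bsub>koszul_tensor p\<^esub> w) = D.to_Hom z \<oplus>\<^bsub>koszul_Hom q\<^esub> D.to_Hom w"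
      if "z \<in> chain_cycles koszul_tensor koszul_tensor_d p" "w \<in> chain_cycles koszul_tensor koszul_tensor_d p" for z w
      using hom(2) Zc that by blast
    show "D.to_Hom (const c \<odot>\<^bsub>koszul_tensor p\<^esub> z) = const c \<odot>\<^bsub>koszul_Hom q\<^esub> D.to_Hom z"
      if "z \<in> chain_cycles koszul_tensor koszul_tensor_d p" for z c
      using hom(3) Zc that by blast
    show "D.to_Hom z \<in> coboundaries koszul_Hom koszul_Hom_d q"
      if "z \<in> koszul_tensor_d p ` carrier (koszul_tensor (Suc p))" for z
      using bounds that by blast
    show "D.to_tensor u \<in> koszul_tensor_d p ` carrier (koszul_tensor (Suc p))"
      if "u \<in> coboundaries koszul_Hom koszul_Hom_d q" for u
      using that D.to_tensor_to_Hom[OF Bc] unfolding bounds[symmetric] by auto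
    show "D.to_tensor (D.to_Hom z) \<ominus>\<^bsub>koszul_tensor p\<^esub> z \<in> koszul_tensor_d p ` carrier (koszul_tensor (Suc p))"
      if "z \<in> chain_cycles koszul_tensor koszul_tensor_d p" for z
      using D.to_tensor_to_Hom[OF Zc[OF that]] D.T.tensor.minus_self[OF Zc[OF that]]
        submodule.zero_closed[OF chain_boundaries_submodule[OF tc]] by simp
    show "D.to_Hom (D.to_tensor u) \<ominus>\<^bsub>koszul_Hom q\<^esub> u \<in> coboundaries koszul_Hom koszul_Hom_d q"
      if "u \<in> cocycles koszul_Hom koszul_Hom_d q" for u
      using D.to_Hom_to_tensor[OF Uc[OF that]] D.H.H.minus_self[OF Uc[OF that]]
        submodule.zero_closed[OF coboundaries_submodule[OF hc]] by simp
  qed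
qed

lemma hcomp_dim_homology_trivial:
  fixes C :: "('n, 'k, 'c) gr_mod"
  assumes D: "degreewise_module (quot_module (sub_module C Z) B)" and B: "submodule mpoly_ring B C"
    and Z: "submodule mpoly_ring Z C" and BZ: "B \<subseteq> Z" and C: "degreewise_module C"
    and triv: "\<And>x. x \<in> carrier C \<Longrightarrow> x = \<zero>\<^bsub>C\<^esub>"
  shows "hcomp_dim (quot_module (sub_module C Z) B) b = 0"
proof (rule hcomp_dim_eq_0[OF D])
  interpret C: degreewise_module C by fact
  note sub = submodule_sub_module[OF C.mpoly_module Z B BZ] and mod = sub_module_module[OF C.mpoly_module Z]
  fix m assume "m \<in> hcomp (quot_module (sub_module C Z) B) b"
  then obtain z where z: "z \<in> hcomp (sub_module C Z) b" "m = B +>\<^bsub>sub_module C Z\<^esub> z"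
    unfolding quot_module_hcomp[OF mod sub] by blast
  then have "z = \<zero>\<^bsub>C\<^esub>" using triv C.hcomp_carrier[of z b] by (auto simp: sub_module_def)
  then show "m = \<zero>\<^bsub>quot_module (sub_module C Z) B\<^esub>"
    unfolding quot_module_zero[OF mod sub] z(2) by (simp add: sub_module_def)
qed

lemma tensor_homology_trivial:
  assumes "CARD('n) < i"
  shows "hcomp_dim (chain_homology koszul_tensor koszul_tensor_d i) b = 0"
  using chain_homology_degreewise[OF tensor_complex, of i] tensor_trivial[OF assms]
  unfolding chain_homology_eq
  by (intro hcomp_dim_homology_trivial chain_cycles_submodule[OF tensor_complex]
    chain_boundaries_submodule[OF tensor_complex] chain_boundaries_cycles[OF tensor_complex]
    chain_complexD(1)[OF tensor_complex])

lemma Hom_cohomology_trivial: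
  assumes "CARD('n) < i"
  shows "hcomp_dim (cochain_homology koszul_Hom koszul_Hom_d i) b = 0"
  using cochain_homology_degreewise[OF Hom_complex, of i] Hom_trivial[OF assms]
  unfolding cochain_homology_eq
  by (intro hcomp_dim_homology_trivial cocycles_submodule[OF Hom_complex]
    coboundaries_submodule[OF Hom_complex] coboundaries_cocycles[OF Hom_complex]
    cochain_complexD(1)[OF Hom_complex])

text \<open>
  The dimension of \<open>Tor\<close> does not depend on the resolution, so the chosen one may be replaced by \<open>K\<close>.
\<close>

lemma betti_koszul:
  "betti i b N = (if i < 0 then 0 else hcomp_dim (chain_homology koszul_tensor koszul_tensor_d (nat i)) b)"
proof -
  obtain P d where Pd: "chosen_resolution (residue_field_module :: ('n, 'k, ('n, 'k) mpoly set) gr_mod) = (P, d)"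
    by (cases "chosen_resolution (residue_field_module :: ('n, 'k, ('n, 'k) mpoly set) gr_mod)")
  obtain \<epsilon> where "gr_free_resolution (residue_field_module :: ('n, 'k, ('n, 'k) mpoly set) gr_mod) P d \<epsilon>"
    using chosen_resolution_residue_field[OF Pd] by blast
  then have "resolution (residue_field_module :: ('n, 'k, ('n, 'k) mpoly set) gr_mod) P d \<epsilon>"
    using residue_field_graded by (rule resolution.intro)
  from tensor_homology_independent_of_resolution[OF this
      resolution.intro[OF koszul_resolution residue_field_graded] N.degreewise_module_axioms]
  show ?thesis by (simp add: betti_def Tor_def Pd)
qed

lemma bass_koszul:
  "bass i b N = (if i < 0 then 0 else hcomp_dim (cochain_homology koszul_Hom koszul_Hom_d (nat i)) b)"
proof -
  obtain P d where Pd: "chosen_resolution (residue_field_module :: ('n, 'k, ('n, 'k) mpoly set) gr_mod) = (P, d)"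
    by (cases "chosen_resolution (residue_field_module :: ('n, 'k, ('n, 'k) mpoly set) gr_mod)")
  obtain \<epsilon> where "gr_free_resolution (residue_field_module :: ('n, 'k, ('n, 'k) mpoly set) gr_mod) P d \<epsilon>"
    using chosen_resolution_residue_field[OF Pd] by blast
  then have "resolution (residue_field_module :: ('n, 'k, ('n, 'k) mpoly set) gr_mod) P d \<epsilon>"
    using residue_field_graded by (rule resolution.intro)
  from hom_cohomology_independent_of_resolution[OF this
      resolution.intro[OF koszul_resolution residue_field_graded] N]
  show ?thesis by (simp add: bass_def Ext_def Pd)
qed

theorem betti_eq_bass: "betti (int CARD('n) - i) b N = bass i (b - 1) N"
proof -
  consider "i < 0" | "int CARD('n) < i" | "0 \<le> i" "i \<le> int CARD('n)" by linarith
  then show ?thesis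
  proof cases
    \<comment> \<open>For \<open>i < 0\<close> the Betti number has index beyond \<open>n\<close>, where \<open>K\<close> vanishes.\<close>
    case 1
    then show ?thesis by (simp add: betti_koszul bass_koszul tensor_homology_trivial zless_nat_eq_int_zless del: koszul_simps)
  next
    \<comment> \<open>For \<open>i > n\<close> the Betti number has a negative index and the Bass number one beyond \<open>n\<close>.\<close>
    case 2
    then show ?thesis by (simp add: betti_koszul bass_koszul Hom_cohomology_trivial zless_nat_eq_int_zless del: koszul_simps)
  next
    case 3
    then have "nat (int CARD('n) - i) + nat i = CARD('n)" by simp
    from koszul_duality_dim[OF this, of b] show ?thesis
      using 3 by (simp add: betti_koszul bass_koszul del: koszul_simps)
  qed
qed

end

theorem theorem3p12:
  fixes I :: "('n::finite, 'k::field) mpoly set"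
    and i :: int and b :: "'n \<Rightarrow> int"
  assumes "CARD('n) \<ge> 2"
    and "monomial_ideal I" and "I \<noteq> carrier mpoly_ring"
  shows "betti (int CARD('n) - i) b (quot_module poly_module I) =
    bass i (b - 1) (quot_module poly_module I)"
proof -
  obtain A where "I = Idl\<^bsub>mpoly_ring\<^esub> (monomial ` A)" using assms(2) unfolding monomial_ideal_def by blast
  then have "ideal I mpoly_ring" by (simp add: ring.genideal_ideal[OF ring_from_type_algebra])
  then have "multigraded_module (quot_module poly_module I)" by (intro quot_multigraded ideal_submodule)
  then show ?thesis by (rule betti_eq_bass)
qed

end
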